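(* Let $F:(M_1^{m_1},\phi_1,\xi_1,\eta_1,g_1)\to(M_2^{m_2},g_2)$ be a pointwise slant Riemannian submersion with vertical space of dimension $r\ge3$ and slant function $\theta$. Then, at every point: (1) If $M_1(c)$ is a Sasakian space form, then $$\rho^{\mathcal V}\le\begin{cases}\delta_C^{\mathcal V}(r-1)+\dfrac{c+3}{4}+\dfrac{3(c-1)}{4r}\cos^2\theta-\dfrac{c-1}{2r},&\xi_1\in\Gamma(\ker F_* ),\\[6pt]\delta_C^{\mathcal V}(r-1)+\dfrac{c+3}{4}+\dfrac{3(c-1)}{4(r-1)}\cos^2\theta,&\xi_1\in\Gamma((\ker F_* )^\perp).\end{cases}$$ (2) If $M_1(c)$ is a Kenmotsu space form, then $$\rho^{\mathcal V}\le\begin{cases}\delta_C^{\mathcal V}(r-1)+\dfrac{c-3}{4}+\dfrac{3(c+1)}{4r}\cos^2\theta-\dfrac{c+1}{2r},&\xi_1\in\Gamma(\ker F_* ),\\[6pt]\delta_C^{\mathcal V}(r-1)+\dfrac{c-3}{4}+\dfrac{3(c+1)}{4(r-1)}\cos^2\theta,&\xi_1\in\Gamma((\ker F_* )^\perp).\end{cases}$$ (3) If $M_1(c)$ is a cosymplectic space form, then $$\rho^{\mathcal V}\le\begin{cases}\delta_C^{\mathcal V}(r-1)+\dfrac{c}{4}+\dfrac{3c}{4r}\cos^2\theta-\dfrac{c}{2r},&\xi_1\in\Gamma(\ker F_* ),\\[6pt]\delta_C^{\mathcal V}(r-1)+\dfrac{c}{4}+\dfrac{3c}{4(r-1)}\cos^2\theta,&\xi_1\in\Gamma((\ker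 F_* )^\perp).\end{cases}$$ (4) If $M_1(c)$ is an almost $C(\alpha)$ space form, then $$\rho^{\mathcal V}\le\begin{cases}\delta_C^{\mathcal V}(r-1)+\dfrac{c+3\alpha^2}{4}+\dfrac{3(c-\alpha^2)}{4r}\cos^2\theta-\dfrac{c-\alpha^2}{2r},&\xi_1\in\Gamma(\ker F_* ),\\[6pt]\delta_C^{\mathcal V}(r-1)+\dfrac{c+3\alpha^2}{4}+\dfrac{3(c-\alpha^2)}{4(r-1)}\cos^2\theta,&\xi_1\in\Gamma((\ker F_* )^\perp).\end{cases}$$ In each of (1)–(4) the same inequalities hold with $\delta_C^{\mathcal V}(r-1)$ replaced by $\hat\delta_C^{\mathcal V}(r-1)$. In all cases, equality holds at $p\in M_1$ if and only if for suitable orthonormal bases $\{U_1,\dots,U_r\}$ of $\mathcal V_p$ and $\{U_{r+1},\dots,U_{m_1}\}$ of $\mathcal H_p$ the components of $T$ satisfy $T_{11}^\beta=\cdots=T_{r-1,r-1}^\beta=\frac12T_{rr}^\beta$ and $T_{ij}^\beta=0$ for $i\ne j$, for all $\beta=r+1,\dots,m_1$.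
   Context: All manifolds are smooth, connected, without boundary. A Riemannian submersion $F:(M_1^{m_1},g_1)\to(M_2^{m_2},g_2)$ has vertical distribution $\mathcal V=\ker F_*$ and horizontal distribution $\mathcal H=(\ker F_* )^\perp$; $\mathcal V,\mathcal H$ also denote the orthogonal projections. $\nabla$ is the Levi-Civita connection of $g_1$. O'Neill's tensor $T$ is $T_EG=\mathcal H\nabla_{\mathcal VE}\mathcal VG+\mathcal V\nabla_{\mathcal VE}\mathcal HG$. Almost contact metric manifold $(M,\phi,\xi,\eta,g)$: $\phi^2=-I+\eta\otimes\xi$, $\eta(\xi)=1$, $\phi\xi=0$, with $g$ compatible ($g(\phi X,\phi Y)=g(X,Y)-\eta(X)\eta(Y)$). It is a generalized Sasakian space form $M(c_1,c_2,c_3)$ if for smooth functions $c_1,c_2,c_3$ $$\begin{aligned}R(X,Y)Z={}&c_1\{g(Y,Z)X-g(X,Z)Y\}+c_2\{g(X,\phi Z)\phi Y-g(Y,\phi Z)\phi X+2g(X,\phi Y)\phi Z\}\\&+c_3\{\eta(X)\eta(Z)Y-\eta(Y)\eta(Z)X+g(X,Z)\eta(Y)\xi-g(Y,Z)\eta(X)\xi\}.\end{aligned}$$ Special cases ($c,\alpha$ real constants): Sasakian space form: $c_1=\frac{c+3}4$, $c_2=c_3=\frac{c-1}4$; Kenmotsu space form: $c_1=\frac{c-3}4$, $c_2=c_3=\frac{c+1}4$; cosymplectic space form: $c_1=c_2=c_3=\frac c4$; almost $C(\alpha)$ space form: $c_1=\frac{c+3\alpha^2}4$, $c_2=c_3=\frac{c-\alpha^2}4$.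 Pointwise slant: for vertical $U$ write $\phi_1U=P^{\mathcal V}U+Q^{\mathcal V}U$ with $P^{\mathcal V}U$ vertical, $Q^{\mathcal V}U$ horizontal. The Reeb field $\xi_1$ is either vertical or horizontal. $F$ is pointwise slant with slant function $\theta:M_1\to[0,\pi/2]$ if at each $p$ the angle between $\phi_1U$ and $\mathcal V_p$ equals $\theta(p)$ for every nonzero $U\in\mathcal V_p$ orthogonal to $\xi_1$; equivalently $\|P^{\mathcal V}U\|=\cos\theta(p)\|U\|$, i.e. $(P^{\mathcal V})^2=-\cos^2\theta\,I$, on the orthogonal complement of $\xi_1$ in $\mathcal V$ (on all of $\mathcal V$ when $\xi_1$ is horizontal). Vertical Casorati curvatures at $p$: let $\{U_1,\dots,U_r\}$, $\{U_{r+1},\dots,U_{m_1}\}$ be orthonormal bases of $\mathcal V_p$, $\mathcal H_p$, and $T_{ij}^\beta=g_1(T_{U_i}U_j,U_\beta)$. Then $C^{\mathcal V}=\frac1r\sum_{\beta}\sum_{i,j=1}^r(T_{ij}^\beta)^2$; for a $k$-dimensional subspace $L\subset\mathcal V_p$ ($k\ge2$) with orthonormal basis $\{U_1,\dots,U_k\}$, $C(L)=\frac1k\sum_\beta\sum_{i,j=1}^k(T_{ij}^\beta)^2$; and, with $L$ ranging over hyperplanes ($(r-1)$-dimensional subspaces) of $\mathcal V_p$, $$\delta_C^{\mathcal V}(r-1)=\tfrac12C^{\mathcal V}+\tfrac{r+1}{2r}\inf_LC(L),\qquad \hat\delta_C^{\mathcal V}(r-1)=2C^{\mathcal V}-\tfrac{2r-1}{2r}\sup_LC(L).$$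 Normalized scalar curvature of the fibers: $\rho^{\mathcal V}=\frac{2\tau^{\mathcal V}}{r(r-1)}$ with $2\tau^{\mathcal V}=\sum_{i,j=1}^r g_1(\hat R(U_i,U_j)U_j,U_i)$, where $\hat R$ is the (intrinsic) curvature tensor of the fibers.
   Formalization: For the inequalities with δ̂_C the equality condition is corrected to T_11=…=T_{r-1,r-1}=2T_rr (with T_ij=0 for i≠j); the stated ratio 1/2 is right only for δ_C and fails for δ̂_C, e.g. for T=diag(1/2,1/2,1) in a flat cosymplectic space. *)

theory Defs
  imports "HOL-Analysis.Analysis"
begin

section \<open>Smooth maps between Euclidean spaces\<close>

primrec Ck_on :: "nat \<Rightarrow> 'a::real_normed_vector set \<Rightarrow> ('a \<Rightarrow> 'b::real_normed_vector) \<Rightarrow> bool" where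
  "Ck_on 0 S f \<longleftrightarrow> continuous_on S f"
| "Ck_on (Suc k) S f \<longleftrightarrow> (\<forall>x\<in>S. f differentiable (at x)) \<and>
     (\<forall>v. Ck_on k S (\<lambda>x. frechet_derivative f (at x) v))"

text \<open>Only used for open \<open>S\<close>.\<close>
definition smooth_on :: "'a::real_normed_vector set \<Rightarrow> ('a \<Rightarrow> 'b::real_normed_vector) \<Rightarrow> bool" where
  "smooth_on S f \<longleftrightarrow> (\<forall>k. Ck_on k S f)"


section \<open>Smooth manifolds\<close>

text \<open>A manifold consists of a topology on its point set and an atlas of charts (domain, coordinate map)
  with values in the Euclidean space \<open>'e\<close>, whose dimension is the dimension of the manifold.\<close>

type_synonym ('a, 'e) chart = "'a set \<times> ('a \<Rightarrow> 'e)"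

record ('a, 'e) manifold =
  mtop :: "'a topology"
  atlas :: "('a, 'e) chart set"

abbreviation pts :: "('a, 'e) manifold \<Rightarrow> 'a set" where
  "pts M \<equiv> topspace (mtop M)"

definition pt :: "('a, 'e) chart \<Rightarrow> 'e \<Rightarrow> 'a" where
  "pt c = inv_into (fst c) (snd c)"

definition is_chart :: "'a topology \<Rightarrow> ('a, 'e::euclidean_space) chart \<Rightarrow> bool" where
  "is_chart X c \<longleftrightarrow> openin X (fst c) \<and> open (snd c ` fst c) \<and>
     homeomorphic_map (subtopology X (fst c)) (top_of_set (snd c ` fst c)) (snd c)"

definition smooth_manifold :: "('a, 'e::euclidean_space) manifold \<Rightarrow> bool" where
  "smooth_manifold M \<longleftrightarrow>
     Hausdorff_space (mtop M) \<and> second_countable (mtop M) \<and> connected_space (mtop M) \<and>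
     (\<forall>c\<in>atlas M. is_chart (mtop M) c) \<and> (\<Union>c\<in>atlas M. fst c) = pts M \<and>
     (\<forall>c\<in>atlas M. \<forall>d\<in>atlas M. smooth_on (snd c ` (fst c \<inter> fst d)) (snd d \<circ> pt c))"

text \<open>The tangent space at \<open>p\<close> is \<open>'e\<close>: a tangent vector is given by its components in the chart
  \<open>chart_at M p\<close>, a chart around \<open>p\<close> selected once and for all.  Accordingly a vector field is a function
  \<open>'a \<Rightarrow> 'e\<close>, and a tensor field is a function of the point and of tangent vectors at that point.\<close>

definition chart_at :: "('a, 'e) manifold \<Rightarrow> 'a \<Rightarrow> ('a, 'e) chart" where
  "chart_at M p = (SOME c. c \<in> atlas M \<and> p \<in> fst c)"

text \<open>Components in the chart \<open>c\<close> of a tangent vector at \<open>q\<close>, and conversely.\<close>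

definition to_chart :: "('a, 'e::euclidean_space) manifold \<Rightarrow> ('a, 'e) chart \<Rightarrow> 'a \<Rightarrow> 'e \<Rightarrow> 'e" where
  "to_chart M c q =
     frechet_derivative (snd c \<circ> pt (chart_at M q)) (at (snd (chart_at M q) q))"

definition from_chart :: "('a, 'e::euclidean_space) manifold \<Rightarrow> ('a, 'e) chart \<Rightarrow> 'a \<Rightarrow> 'e \<Rightarrow> 'e" where
  "from_chart M c q = frechet_derivative (snd (chart_at M q) \<circ> pt c) (at (snd c q))"

definition smooth_map :: "('a, 'e::euclidean_space) manifold \<Rightarrow> ('b, 'f::euclidean_space) manifold \<Rightarrow>
    ('a \<Rightarrow> 'b) \<Rightarrow> bool" where
  "smooth_map M N F \<longleftrightarrow> continuous_map (mtop M) (mtop N) F \<and>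
     (\<forall>c\<in>atlas M. \<forall>d\<in>atlas N. smooth_on (snd c ` {q \<in> fst c. F q \<in> fst d}) (snd d \<circ> F \<circ> pt c))"

definition differential :: "('a, 'e::euclidean_space) manifold \<Rightarrow> ('b, 'f::euclidean_space) manifold \<Rightarrow>
    ('a \<Rightarrow> 'b) \<Rightarrow> 'a \<Rightarrow> 'e \<Rightarrow> 'f" where
  "differential M N F p =
     frechet_derivative (snd (chart_at N (F p)) \<circ> F \<circ> pt (chart_at M p)) (at (snd (chart_at M p) p))"

definition smooth_fun :: "('a, 'e::euclidean_space) manifold \<Rightarrow> ('a \<Rightarrow> real) \<Rightarrow> bool" where
  "smooth_fun M f \<longleftrightarrow> (\<forall>c\<in>atlas M. smooth_on (snd c ` fst c) (f \<circ> pt c))"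

definition field_in_chart :: "('a, 'e::euclidean_space) manifold \<Rightarrow> ('a, 'e) chart \<Rightarrow> ('a \<Rightarrow> 'e) \<Rightarrow>
    'e \<Rightarrow> 'e" where
  "field_in_chart M c X z = to_chart M c (pt c z) (X (pt c z))"

definition smooth_field :: "('a, 'e::euclidean_space) manifold \<Rightarrow> ('a \<Rightarrow> 'e) \<Rightarrow> bool" where
  "smooth_field M X \<longleftrightarrow> (\<forall>c\<in>atlas M. smooth_on (snd c ` fst c) (field_in_chart M c X))"

definition smooth_one_form :: "('a, 'e::euclidean_space) manifold \<Rightarrow> ('a \<Rightarrow> 'e \<Rightarrow> real) \<Rightarrow> bool" where
  "smooth_one_form M \<eta> \<longleftrightarrow> (\<forall>p\<in>pts M. linear (\<eta> p)) \<and>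
     (\<forall>c\<in>atlas M. \<forall>u. smooth_on (snd c ` fst c) (\<lambda>z. \<eta> (pt c z) (from_chart M c (pt c z) u)))"

definition smooth_endomorphism :: "('a, 'e::euclidean_space) manifold \<Rightarrow> ('a \<Rightarrow> 'e \<Rightarrow> 'e) \<Rightarrow> bool" where
  "smooth_endomorphism M \<phi> \<longleftrightarrow> (\<forall>p\<in>pts M. linear (\<phi> p)) \<and>
     (\<forall>c\<in>atlas M. \<forall>u. smooth_on (snd c ` fst c)
        (\<lambda>z. to_chart M c (pt c z) (\<phi> (pt c z) (from_chart M c (pt c z) u))))"

text \<open>The structure of an embedded submanifold on \<open>S\<close>: all charts of the subspace \<open>S\<close> for which
  the inclusion into \<open>M\<close> is a smooth immersion.  The dimension is that of \<open>'v\<close>.\<close>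

definition submanifold :: "('a, 'e::euclidean_space) manifold \<Rightarrow> 'a set \<Rightarrow>
    ('a, 'v::euclidean_space) manifold" where
  "submanifold M S = \<lparr> mtop = subtopology (mtop M) S,
     atlas = {d. is_chart (subtopology (mtop M) S) d \<and>
       (\<forall>c\<in>atlas M. smooth_on (snd d ` (fst d \<inter> fst c)) (snd c \<circ> pt d) \<and>
          (\<forall>z\<in>snd d ` (fst d \<inter> fst c). inj (frechet_derivative (snd c \<circ> pt d) (at z))))} \<rparr>"


section \<open>Riemannian geometry\<close>

type_synonym ('a, 'e) metric = "'a \<Rightarrow> 'e \<Rightarrow> 'e \<Rightarrow> real"

definition metric_in_chart :: "('a, 'e::euclidean_space) manifold \<Rightarrow> ('a, 'e) metric \<Rightarrow>
    ('a, 'e) chart \<Rightarrow> 'e \<Rightarrow> 'e \<Rightarrow> 'e \<Rightarrow> real" where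
  "metric_in_chart M g c z u v =
     g (pt c z) (from_chart M c (pt c z) u) (from_chart M c (pt c z) v)"

definition riemannian_metric :: "('a, 'e::euclidean_space) manifold \<Rightarrow> ('a, 'e) metric \<Rightarrow> bool" where
  "riemannian_metric M g \<longleftrightarrow>
     (\<forall>p\<in>pts M. bilinear (g p) \<and> (\<forall>u v. g p u v = g p v u) \<and> (\<forall>u. u \<noteq> 0 \<longrightarrow> g p u u > 0)) \<and>
     (\<forall>c\<in>atlas M. \<forall>u v. smooth_on (snd c ` fst c) (\<lambda>z. metric_in_chart M g c z u v))"

definition riemannian_manifold :: "('a, 'e::euclidean_space) manifold \<Rightarrow> ('a, 'e) metric \<Rightarrow> bool" where
  "riemannian_manifold M g \<longleftrightarrow> smooth_manifold M \<and> riemannian_metric M g"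

text \<open>\<open>christoffel G z u v\<close> is the vector with components
  \<open>\<Gamma>\<^sup>k\<^sub>i\<^sub>j u\<^sup>i v\<^sup>j\<close>, with
  \<open>2 g\<^sub>k\<^sub>l \<Gamma>\<^sup>k\<^sub>i\<^sub>j = \<partial>\<^sub>i g\<^sub>j\<^sub>l + \<partial>\<^sub>j g\<^sub>i\<^sub>l - \<partial>\<^sub>l g\<^sub>i\<^sub>j\<close>.\<close>

definition christoffel :: "('e::euclidean_space \<Rightarrow> 'e \<Rightarrow> 'e \<Rightarrow> real) \<Rightarrow> 'e \<Rightarrow> 'e \<Rightarrow> 'e \<Rightarrow> 'e" where
  "christoffel G z u v = (THE w. \<forall>k. 2 * G z w k =
     frechet_derivative (\<lambda>y. G y v k) (at z) u
     + frechet_derivative (\<lambda>y. G y u k) (at z) v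
     - frechet_derivative (\<lambda>y. G y u v) (at z) k)"

text \<open>The Levi-Civita connection: \<open>nabla M g X Y p\<close> is \<open>(\<nabla>\<^sub>X Y)(p)\<close>.\<close>

definition nabla :: "('a, 'e::euclidean_space) manifold \<Rightarrow> ('a, 'e) metric \<Rightarrow>
    ('a \<Rightarrow> 'e) \<Rightarrow> ('a \<Rightarrow> 'e) \<Rightarrow> 'a \<Rightarrow> 'e" where
  "nabla M g X Y p = (let c = chart_at M p; z = snd c p in
     frechet_derivative (field_in_chart M c Y) (at z) (X p)
     + christoffel (metric_in_chart M g c) z (X p) (Y p))"

definition lie_bracket :: "('a, 'e::euclidean_space) manifold \<Rightarrow> ('a \<Rightarrow> 'e) \<Rightarrow> ('a \<Rightarrow> 'e) \<Rightarrow>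
    'a \<Rightarrow> 'e" where
  "lie_bracket M X Y p = (let c = chart_at M p; z = snd c p in
     frechet_derivative (field_in_chart M c Y) (at z) (X p)
     - frechet_derivative (field_in_chart M c X) (at z) (Y p))"

definition curvature :: "('a, 'e::euclidean_space) manifold \<Rightarrow> ('a, 'e) metric \<Rightarrow>
    ('a \<Rightarrow> 'e) \<Rightarrow> ('a \<Rightarrow> 'e) \<Rightarrow> ('a \<Rightarrow> 'e) \<Rightarrow> 'a \<Rightarrow> 'e" where
  "curvature M g X Y Z p =
     nabla M g X (nabla M g Y Z) p - nabla M g Y (nabla M g X Z) p
     - nabla M g (lie_bracket M X Y) Z p"

text \<open>The local vector field with constant components \<open>u\<close> in \<open>chart_at M p\<close>; it extends the tangent
  vector \<open>u\<close> at \<open>p\<close>.  It is used to evaluate expressions that are tensorial in vector fields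
  on tangent vectors.  Its values outside the domain of the chart are meaningless, and irrelevant for germs at \<open>p\<close>.\<close>

definition extend :: "('a, 'e::euclidean_space) manifold \<Rightarrow> 'a \<Rightarrow> 'e \<Rightarrow> 'a \<Rightarrow> 'e" where
  "extend M p u q = from_chart M (chart_at M p) q u"

definition curvature_tensor :: "('a, 'e::euclidean_space) manifold \<Rightarrow> ('a, 'e) metric \<Rightarrow>
    'a \<Rightarrow> 'e \<Rightarrow> 'e \<Rightarrow> 'e \<Rightarrow> 'e" where
  "curvature_tensor M g p u v w = curvature M g (extend M p u) (extend M p v) (extend M p w) p"

definition pullback_metric :: "('a, 'e::euclidean_space) manifold \<Rightarrow> ('b, 'f::euclidean_space) manifold \<Rightarrow>
    ('a \<Rightarrow> 'b) \<Rightarrow> ('b, 'f) metric \<Rightarrow> ('a, 'e) metric" where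
  "pullback_metric N M f g p u v = g (f p) (differential N M f p u) (differential N M f p v)"


section \<open>Linear algebra of an inner product on a tangent space\<close>

definition orth_comp :: "('e::real_vector \<Rightarrow> 'e \<Rightarrow> real) \<Rightarrow> 'e set \<Rightarrow> 'e set" where
  "orth_comp B W = {v. \<forall>w\<in>W. B v w = 0}"

definition orth_proj :: "('e::real_vector \<Rightarrow> 'e \<Rightarrow> real) \<Rightarrow> 'e set \<Rightarrow> 'e \<Rightarrow> 'e" where
  "orth_proj B W v = (THE w. w \<in> W \<and> v - w \<in> orth_comp B W)"

definition vnorm :: "('e \<Rightarrow> 'e \<Rightarrow> real) \<Rightarrow> 'e \<Rightarrow> real" where
  "vnorm B v = sqrt (B v v)"

text \<open>Angle between a nonzero vector and a subspace.\<close>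
definition angle_to :: "('e::real_vector \<Rightarrow> 'e \<Rightarrow> real) \<Rightarrow> 'e \<Rightarrow> 'e set \<Rightarrow> real" where
  "angle_to B v W = arccos (vnorm B (orth_proj B W v) / vnorm B v)"

definition orthonormal_basis :: "('e::real_vector \<Rightarrow> 'e \<Rightarrow> real) \<Rightarrow> 'e set \<Rightarrow> nat set \<Rightarrow>
    (nat \<Rightarrow> 'e) \<Rightarrow> bool" where
  "orthonormal_basis B W I U \<longleftrightarrow>
     (\<forall>i\<in>I. \<forall>j\<in>I. B (U i) (U j) = (if i = j then 1 else 0)) \<and> span (U ` I) = W"

text \<open>Everything defined below through this arbitrarily selected basis is independent of the selection.\<close>
definition some_onb :: "('e::real_vector \<Rightarrow> 'e \<Rightarrow> real) \<Rightarrow> 'e set \<Rightarrow> nat \<Rightarrow> 'e" where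
  "some_onb B W = (SOME U. orthonormal_basis B W {1..dim W} U)"


section \<open>Riemannian submersions\<close>

definition vert :: "('a, 'e::euclidean_space) manifold \<Rightarrow> ('b, 'f::euclidean_space) manifold \<Rightarrow>
    ('a \<Rightarrow> 'b) \<Rightarrow> 'a \<Rightarrow> 'e set" where
  "vert M N F p = {v. differential M N F p v = 0}"

definition hor :: "('a, 'e::euclidean_space) manifold \<Rightarrow> ('b, 'f::euclidean_space) manifold \<Rightarrow>
    ('a \<Rightarrow> 'b) \<Rightarrow> ('a, 'e) metric \<Rightarrow> 'a \<Rightarrow> 'e set" where
  "hor M N F g p = orth_comp (g p) (vert M N F p)"

definition riemannian_submersion :: "('a, 'e::euclidean_space) manifold \<Rightarrow> ('a, 'e) metric \<Rightarrow>
    ('b, 'f::euclidean_space) manifold \<Rightarrow> ('b, 'f) metric \<Rightarrow> ('a \<Rightarrow> 'b) \<Rightarrow> bool" where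
  "riemannian_submersion M g N h F \<longleftrightarrow>
     riemannian_manifold M g \<and> riemannian_manifold N h \<and> smooth_map M N F \<and>
     (\<forall>p\<in>pts M. surj (differential M N F p) \<and>
        (\<forall>u\<in>hor M N F g p. \<forall>v\<in>hor M N F g p.
           h (F p) (differential M N F p u) (differential M N F p v) = g p u v))"

text \<open>The orthogonal projections to the vertical and to the horizontal distribution.\<close>

definition vproj :: "('a, 'e::euclidean_space) manifold \<Rightarrow> ('b, 'f::euclidean_space) manifold \<Rightarrow>
    ('a \<Rightarrow> 'b) \<Rightarrow> ('a, 'e) metric \<Rightarrow> 'a \<Rightarrow> 'e \<Rightarrow> 'e" where
  "vproj M N F g p = orth_proj (g p) (vert M N F p)"

definition hproj :: "('a, 'e::euclidean_space) manifold \<Rightarrow> ('b, 'f::euclidean_space) manifold \<Rightarrow>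
    ('a \<Rightarrow> 'b) \<Rightarrow> ('a, 'e) metric \<Rightarrow> 'a \<Rightarrow> 'e \<Rightarrow> 'e" where
  "hproj M N F g p = orth_proj (g p) (hor M N F g p)"

definition oneill_T :: "('a, 'e::euclidean_space) manifold \<Rightarrow> ('b, 'f::euclidean_space) manifold \<Rightarrow>
    ('a \<Rightarrow> 'b) \<Rightarrow> ('a, 'e) metric \<Rightarrow> ('a \<Rightarrow> 'e) \<Rightarrow> ('a \<Rightarrow> 'e) \<Rightarrow> 'a \<Rightarrow> 'e" where
  "oneill_T M N F g E G p =
     (let \<V> = vproj M N F g; \<H> = hproj M N F g in
      \<H> p (nabla M g (\<lambda>q. \<V> q (E q)) (\<lambda>q. \<V> q (G q)) p)
      + \<V> p (nabla M g (\<lambda>q. \<V> q (E q)) (\<lambda>q. \<H> q (G q)) p))"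

definition T_tensor :: "('a, 'e::euclidean_space) manifold \<Rightarrow> ('b, 'f::euclidean_space) manifold \<Rightarrow>
    ('a \<Rightarrow> 'b) \<Rightarrow> ('a, 'e) metric \<Rightarrow> 'a \<Rightarrow> 'e \<Rightarrow> 'e \<Rightarrow> 'e" where
  "T_tensor M N F g p u v = oneill_T M N F g (extend M p u) (extend M p v) p"

text \<open>The fibre through \<open>p\<close>, a manifold modelled on \<open>'v\<close>, and its intrinsic curvature tensor, i.e. the
  curvature tensor of its induced metric, transported to vertical vectors of the total space by the differential
  of the inclusion.\<close>

definition fibre :: "('a, 'e::euclidean_space) manifold \<Rightarrow> ('a \<Rightarrow> 'b) \<Rightarrow> 'a \<Rightarrow>
    ('a, 'v::euclidean_space) manifold" where
  "fibre M F p = submanifold M {q \<in> pts M. F q = F p}"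

definition fibre_curvature :: "'v::euclidean_space itself \<Rightarrow> ('a, 'e::euclidean_space) manifold \<Rightarrow>
    ('a \<Rightarrow> 'b) \<Rightarrow> ('a, 'e) metric \<Rightarrow> 'a \<Rightarrow> 'e \<Rightarrow> 'e \<Rightarrow> 'e \<Rightarrow> 'e" where
  "fibre_curvature _ M F g p u v w =
     (let N = (fibre M F p :: ('a, 'v) manifold);
          \<iota> = differential N M (\<lambda>q. q) p;
          \<kappa> = inv_into UNIV \<iota>
      in \<iota> (curvature_tensor N (pullback_metric N M (\<lambda>q. q) g) p (\<kappa> u) (\<kappa> v) (\<kappa> w)))"

definition tau_vert :: "'v::euclidean_space itself \<Rightarrow> ('a, 'e::euclidean_space) manifold \<Rightarrow>
    ('b, 'f::euclidean_space) manifold \<Rightarrow> ('a \<Rightarrow> 'b) \<Rightarrow> ('a, 'e) metric \<Rightarrow> 'a \<Rightarrow> real" where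
  "tau_vert ty M N F g p =
     (let V = vert M N F p; U = some_onb (g p) V in
      (1/2) * (\<Sum>i=1..dim V. \<Sum>j=1..dim V. g p (fibre_curvature ty M F g p (U i) (U j) (U j)) (U i)))"

definition rho_vert :: "'v::euclidean_space itself \<Rightarrow> ('a, 'e::euclidean_space) manifold \<Rightarrow>
    ('b, 'f::euclidean_space) manifold \<Rightarrow> ('a \<Rightarrow> 'b) \<Rightarrow> ('a, 'e) metric \<Rightarrow> 'a \<Rightarrow> real" where
  "rho_vert ty M N F g p =
     (let r = real (dim (vert M N F p)) in 2 * tau_vert ty M N F g p / (r * (r - 1)))"


section \<open>Casorati curvatures\<close>

text \<open>\<open>C(L)\<close> for a subspace \<open>L\<close> of the vertical space at \<open>p\<close>; the value at the
  whole vertical space is \<open>C\<^sup>V\<close>.\<close>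

definition casorati :: "('a, 'e::euclidean_space) manifold \<Rightarrow> ('b, 'f::euclidean_space) manifold \<Rightarrow>
    ('a \<Rightarrow> 'b) \<Rightarrow> ('a, 'e) metric \<Rightarrow> 'a \<Rightarrow> 'e set \<Rightarrow> real" where
  "casorati M N F g p L =
     (let H = hor M N F g p; U = some_onb (g p) L; W = some_onb (g p) H in
      (1 / real (dim L)) *
      (\<Sum>\<beta>=1..dim H. \<Sum>i=1..dim L. \<Sum>j=1..dim L. (g p (T_tensor M N F g p (U i) (U j)) (W \<beta>))\<^sup>2))"

definition hyperplanes :: "'e::real_vector set \<Rightarrow> 'e set set" where
  "hyperplanes V = {L. subspace L \<and> L \<subseteq> V \<and> dim L = dim V - 1}"

definition delta_vert :: "('a, 'e::euclidean_space) manifold \<Rightarrow> ('b, 'f::euclidean_space) manifold \<Rightarrow>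
    ('a \<Rightarrow> 'b) \<Rightarrow> ('a, 'e) metric \<Rightarrow> 'a \<Rightarrow> real" where
  "delta_vert M N F g p =
     (let V = vert M N F p; r = real (dim V) in
      (1/2) * casorati M N F g p V
      + (r + 1) / (2 * r) * (INF L\<in>hyperplanes V. casorati M N F g p L))"

definition delta_hat_vert :: "('a, 'e::euclidean_space) manifold \<Rightarrow> ('b, 'f::euclidean_space) manifold \<Rightarrow>
    ('a \<Rightarrow> 'b) \<Rightarrow> ('a, 'e) metric \<Rightarrow> 'a \<Rightarrow> real" where
  "delta_hat_vert M N F g p =
     (let V = vert M N F p; r = real (dim V) in
      2 * casorati M N F g p V
      - (2 * r - 1) / (2 * r) * (SUP L\<in>hyperplanes V. casorati M N F g p L))"

text \<open>In suitable orthonormal bases of the vertical and the horizontal space the components of \<open>T\<close> satisfy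
  \<open>T\<^sub>1\<^sub>1 = \<dots> = T\<^sub>r\<^sub>-\<^sub>1\<^sub>,\<^sub>r\<^sub>-\<^sub>1 = a T\<^sub>r\<^sub>r\<close>
  and \<open>T\<^sub>i\<^sub>j = 0\<close> for \<open>i \<noteq> j\<close>.\<close>

definition T_diagonal_form :: "real \<Rightarrow> ('a, 'e::euclidean_space) manifold \<Rightarrow>
    ('b, 'f::euclidean_space) manifold \<Rightarrow> ('a \<Rightarrow> 'b) \<Rightarrow> ('a, 'e) metric \<Rightarrow> 'a \<Rightarrow> bool" where
  "T_diagonal_form a M N F g p \<longleftrightarrow>
     (let V = vert M N F p; H = hor M N F g p; r = dim V; m = DIM('e) in
      \<exists>U. orthonormal_basis (g p) V {1..r} U \<and> orthonormal_basis (g p) H {r+1..m} U \<and>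
        (let T = (\<lambda>i j \<beta>. g p (T_tensor M N F g p (U i) (U j)) (U \<beta>)) in
         \<forall>\<beta>\<in>{r+1..m}.
           (\<forall>i\<in>{1..r-1}. T i i \<beta> = a * T r r \<beta>) \<and>
           (\<forall>i\<in>{1..r}. \<forall>j\<in>{1..r}. i \<noteq> j \<longrightarrow> T i j \<beta> = 0)))"

text \<open>Both Casorati inequalities at \<open>p\<close> with additive term \<open>K\<close>, with their equality cases.  The two
  equality cases have different ratios: equality for \<open>\<delta>\<close> means that the vectors
  \<open>(\<surd>2 T\<^sub>1\<^sub>1, \<dots>, \<surd>2 T\<^sub>r\<^sub>-\<^sub>1\<^sub>,\<^sub>r\<^sub>-\<^sub>1, T\<^sub>r\<^sub>r)\<close> and
  \<open>(1/\<surd>2, \<dots>, 1/\<surd>2, 1)\<close> are parallel, and for the hat version \<open>\<surd>2\<close> and \<open>1/\<surd>2\<close> are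
  interchanged.\<close>

definition casorati_inequalities :: "'v::euclidean_space itself \<Rightarrow> ('a, 'e::euclidean_space) manifold \<Rightarrow>
    ('b, 'f::euclidean_space) manifold \<Rightarrow> ('a \<Rightarrow> 'b) \<Rightarrow> ('a, 'e) metric \<Rightarrow> 'a \<Rightarrow> real \<Rightarrow> bool" where
  "casorati_inequalities ty M N F g p K \<longleftrightarrow>
     rho_vert ty M N F g p \<le> delta_vert M N F g p + K \<and>
     (rho_vert ty M N F g p = delta_vert M N F g p + K \<longleftrightarrow> T_diagonal_form (1/2) M N F g p) \<and>
     rho_vert ty M N F g p \<le> delta_hat_vert M N F g p + K \<and>
     (rho_vert ty M N F g p = delta_hat_vert M N F g p + K \<longleftrightarrow> T_diagonal_form 2 M N F g p)"


section \<open>Almost contact metric manifolds and space forms\<close>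

definition almost_contact_metric :: "('a, 'e::euclidean_space) manifold \<Rightarrow> ('a \<Rightarrow> 'e \<Rightarrow> 'e) \<Rightarrow>
    ('a \<Rightarrow> 'e) \<Rightarrow> ('a \<Rightarrow> 'e \<Rightarrow> real) \<Rightarrow> ('a, 'e) metric \<Rightarrow> bool" where
  "almost_contact_metric M \<phi> \<xi> \<eta> g \<longleftrightarrow>
     riemannian_manifold M g \<and> smooth_endomorphism M \<phi> \<and> smooth_field M \<xi> \<and> smooth_one_form M \<eta> \<and>
     (\<forall>p\<in>pts M.
        (\<forall>X. \<phi> p (\<phi> p X) = - X + \<eta> p X *\<^sub>R \<xi> p) \<and> \<eta> p (\<xi> p) = 1 \<and> \<phi> p (\<xi> p) = 0 \<and>
        (\<forall>X Y. g p (\<phi> p X) (\<phi> p Y) = g p X Y - \<eta> p X * \<eta> p Y))"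

definition generalized_sasakian_space_form :: "('a, 'e::euclidean_space) manifold \<Rightarrow>
    ('a \<Rightarrow> 'e \<Rightarrow> 'e) \<Rightarrow> ('a \<Rightarrow> 'e) \<Rightarrow> ('a \<Rightarrow> 'e \<Rightarrow> real) \<Rightarrow> ('a, 'e) metric \<Rightarrow>
    ('a \<Rightarrow> real) \<Rightarrow> ('a \<Rightarrow> real) \<Rightarrow> ('a \<Rightarrow> real) \<Rightarrow> bool" where
  "generalized_sasakian_space_form M \<phi> \<xi> \<eta> g c1 c2 c3 \<longleftrightarrow>
     almost_contact_metric M \<phi> \<xi> \<eta> g \<and> smooth_fun M c1 \<and> smooth_fun M c2 \<and> smooth_fun M c3 \<and>
     (\<forall>p\<in>pts M. \<forall>X Y Z. curvature_tensor M g p X Y Z =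
        c1 p *\<^sub>R (g p Y Z *\<^sub>R X - g p X Z *\<^sub>R Y)
        + c2 p *\<^sub>R (g p X (\<phi> p Z) *\<^sub>R \<phi> p Y - g p Y (\<phi> p Z) *\<^sub>R \<phi> p X
                   + (2 * g p X (\<phi> p Y)) *\<^sub>R \<phi> p Z)
        + c3 p *\<^sub>R ((\<eta> p X * \<eta> p Z) *\<^sub>R Y - (\<eta> p Y * \<eta> p Z) *\<^sub>R X
                   + (g p X Z * \<eta> p Y) *\<^sub>R \<xi> p - (g p Y Z * \<eta> p X) *\<^sub>R \<xi> p))"

definition sasakian_space_form where
  "sasakian_space_form M \<phi> \<xi> \<eta> g c \<longleftrightarrow> generalized_sasakian_space_form M \<phi> \<xi> \<eta> g
     (\<lambda>_. (c + 3) / 4) (\<lambda>_. (c - 1) / 4) (\<lambda>_. (c - 1) / 4)"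

definition kenmotsu_space_form where
  "kenmotsu_space_form M \<phi> \<xi> \<eta> g c \<longleftrightarrow> generalized_sasakian_space_form M \<phi> \<xi> \<eta> g
     (\<lambda>_. (c - 3) / 4) (\<lambda>_. (c + 1) / 4) (\<lambda>_. (c + 1) / 4)"

definition cosymplectic_space_form where
  "cosymplectic_space_form M \<phi> \<xi> \<eta> g c \<longleftrightarrow> generalized_sasakian_space_form M \<phi> \<xi> \<eta> g
     (\<lambda>_. c / 4) (\<lambda>_. c / 4) (\<lambda>_. c / 4)"

definition almost_C_space_form where
  "almost_C_space_form M \<phi> \<xi> \<eta> g \<alpha> c \<longleftrightarrow> generalized_sasakian_space_form M \<phi> \<xi> \<eta> g
     (\<lambda>_. (c + 3 * \<alpha>\<^sup>2) / 4) (\<lambda>_. (c - \<alpha>\<^sup>2) / 4) (\<lambda>_. (c - \<alpha>\<^sup>2) / 4)"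

definition vertical_field :: "('a, 'e::euclidean_space) manifold \<Rightarrow> ('b, 'f::euclidean_space) manifold \<Rightarrow>
    ('a \<Rightarrow> 'b) \<Rightarrow> ('a \<Rightarrow> 'e) \<Rightarrow> bool" where
  "vertical_field M N F X \<longleftrightarrow> (\<forall>p\<in>pts M. X p \<in> vert M N F p)"

definition horizontal_field :: "('a, 'e::euclidean_space) manifold \<Rightarrow> ('b, 'f::euclidean_space) manifold \<Rightarrow>
    ('a \<Rightarrow> 'b) \<Rightarrow> ('a, 'e) metric \<Rightarrow> ('a \<Rightarrow> 'e) \<Rightarrow> bool" where
  "horizontal_field M N F g X \<longleftrightarrow> (\<forall>p\<in>pts M. X p \<in> hor M N F g p)"

definition pointwise_slant_submersion :: "('a, 'e::euclidean_space) manifold \<Rightarrow> ('a \<Rightarrow> 'e \<Rightarrow> 'e) \<Rightarrow>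
    ('a \<Rightarrow> 'e) \<Rightarrow> ('a \<Rightarrow> 'e \<Rightarrow> real) \<Rightarrow> ('a, 'e) metric \<Rightarrow>
    ('b, 'f::euclidean_space) manifold \<Rightarrow> ('b, 'f) metric \<Rightarrow> ('a \<Rightarrow> 'b) \<Rightarrow> ('a \<Rightarrow> real) \<Rightarrow> bool" where
  "pointwise_slant_submersion M \<phi> \<xi> \<eta> g N h F \<theta> \<longleftrightarrow>
     almost_contact_metric M \<phi> \<xi> \<eta> g \<and> riemannian_submersion M g N h F \<and>
     (vertical_field M N F \<xi> \<or> horizontal_field M N F g \<xi>) \<and>
     (\<forall>p\<in>pts M. \<theta> p \<in> {0..pi/2} \<and>
        (\<forall>U\<in>vert M N F p. U \<noteq> 0 \<and> g p U (\<xi> p) = 0 \<longrightarrow>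
           angle_to (g p) (\<phi> p U) (vert M N F p) = \<theta> p))"

end

theory Submission
  imports Defs
begin

text \<open>
  Fix a point \<open>p\<close>, let \<open>V\<close> be its vertical space, of dimension \<open>r\<close>, and let \<open>h\<close> be the second fundamental
  form of the fibre, which is the restriction of \<open>T\<close> to vertical vectors. By the Gauss equation
  (\<open>gauss_equation\<close>, \<open>gauss_fibre\<close>) the curvature of the fibre differs from that of the total space by
  terms quadratic in \<open>h\<close>, and summing over an orthonormal basis of \<open>V\<close> gives
  \<open>r (r - 1) \<rho> = \<Sum>\<^sub>i\<^sub>j R(U\<^sub>i, U\<^sub>j, U\<^sub>j, U\<^sub>i) + |tr h|\<^sup>2 - |h|\<^sup>2\<close>.

  The curvature sum is, up to the factor \<open>r (r - 1)\<close>, the additive term of the claim: in a space form it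
  only involves the lengths of the vertical parts of the vectors \<open>\<phi> U\<^sub>j\<close>, and for a slant fibre these are
  \<open>cos \<theta>\<close> times the length of the part of \<open>U\<^sub>j\<close> orthogonal to \<open>\<xi>\<close> (\<open>curvature_trace\<close>).

  What remains is a statement about quadratic forms. With \<open>\<mu> = 1/2\<close> for \<open>\<delta>\<close> and \<open>\<mu> = 2\<close> for the hat
  version, the inequality is
  \<open>|tr h|\<^sup>2 \<le> ((r - 1) \<mu> + 1) (|h|\<^sup>2 + (1/\<mu> - 1) |h on L|\<^sup>2)\<close>
  for the hyperplane \<open>L\<close> of \<open>V\<close> that makes the right side smallest. In a basis adapted to \<open>L\<close>, and for each
  normal direction, the off-diagonal components only enlarge the right side, and on the diagonal this is
  the Cauchy-Schwarz inequality; equality forces \<open>h\<close> to be diagonal with entries in the ratio \<open>\<mu>\<close>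
  (\<open>single_form_bound\<close>). An optimal hyperplane exists because unit normals form a compact set
  (\<open>extremal_hyperplane\<close>), so the equality case can be read off in a basis adapted to it, which serves all normal
  directions simultaneously (\<open>casorati_optimal\<close>).

  The geometric part lives in coordinates. The basic analytic tool is that solutions of linear systems
  with smooth injective coefficients are smooth (\<open>Ck_on_linear_system\<close>); it yields the smoothness of Christoffel
  symbols, of local inverses, and of the orthogonal projection to the vertical distribution. The local
  Gauss formula (\<open>gauss_formula\<close>) is used twice. For a change of charts, where there is no normal part, it is
  the transformation law of the Christoffel symbols; this is what makes the covariant
  derivative, computed at each point in the chart selected there, a smooth field. For a parametrization of the
  fibre the normal part is \<open>h\<close>. That \<open>T\<close> has the same normal part follows by differentiating the condition that
  the projected field is vertical along the fibre (\<open>T_tensor_sff\<close>).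
\<close>

section \<open>Calculus of smooth maps\<close>

abbreviation FD :: "('a::real_normed_vector \<Rightarrow> 'b::real_normed_vector) \<Rightarrow> 'a \<Rightarrow> 'a \<Rightarrow> 'b" where
  "FD f x \<equiv> frechet_derivative f (at x)"

lemma FD_eqI: "(f has_derivative f') (at x) \<Longrightarrow> FD f x = f'"
  using frechet_derivative_at by metis

lemma FD_cong_open:
  assumes "f differentiable (at x)" "open S" "x \<in> S" "\<And>y. y \<in> S \<Longrightarrow> f y = g y"
  shows "FD f x = FD g x"
  using frechet_derivative_transform_within_open assms by metis

lemma differentiable_cong_open:
  assumes "f differentiable (at x)" "open S" "x \<in> S" "\<And>y. y \<in> S \<Longrightarrow> f y = g y"
  shows "g differentiable (at x)"
  using assms by (meson differentiable_def has_derivative_transform_within_open)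

lemma Ck_on_cong:
  assumes "open S" "\<And>x. x \<in> S \<Longrightarrow> f x = g x" "Ck_on k S f"
  shows "Ck_on k S g"
  using assms(2,3)
proof (induction k arbitrary: f g)
  case 0
  then show ?case by (metis Ck_on.simps(1) continuous_on_cong)
next
  case (Suc k)
  have d: "f differentiable (at x)" if "x \<in> S" for x using Suc.prems that by simp
  have "g differentiable (at x)" if "x \<in> S" for x
    using differentiable_cong_open[OF d[OF that] \<open>open S\<close> that] Suc.prems(1) by blast
  moreover have "Ck_on k S (\<lambda>x. FD g x v)" for v
  proof (rule Suc.IH[of "\<lambda>x. FD f x v"])
    show "FD f x v = FD g x v" if "x \<in> S" for x
      using FD_cong_open[OF d[OF that] \<open>open S\<close> that, of g] Suc.prems(1) by metis
    show "Ck_on k S (\<lambda>x. FD f x v)" using Suc.prems(2) by simp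
  qed
  ultimately show ?case unfolding Ck_on.simps by blast
qed

lemma Ck_on_SucI:
  assumes "open S" "\<And>x. x \<in> S \<Longrightarrow> (f has_derivative f' x) (at x)" "\<And>v. Ck_on k S (\<lambda>x. f' x v)"
  shows "Ck_on (Suc k) S f"
proof -
  have "Ck_on k S (\<lambda>x. FD f x v)" for v
    by (rule Ck_on_cong[OF assms(1) _ assms(3)[of v]]) (simp add: FD_eqI[OF assms(2)])
  moreover have "f differentiable (at x)" if "x \<in> S" for x
    using assms(2)[OF that] differentiable_def by blast
  ultimately show ?thesis by simp
qed

lemma
  assumes "Ck_on (Suc k) S f"
  shows Ck_on_Suc_has_derivative: "x \<in> S \<Longrightarrow> (f has_derivative FD f x) (at x)"
    and Ck_on_Suc_FD: "Ck_on k S (\<lambda>x. FD f x v)"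
  using assms frechet_derivative_works unfolding Ck_on.simps by blast+

lemma Ck_on_continuous: "Ck_on k S f \<Longrightarrow> continuous_on S f"
proof (cases k)
  case (Suc j)
  assume "Ck_on k S f"
  then have "continuous (at x) f" if "x \<in> S" for x
    using that Suc differentiable_imp_continuous_within unfolding Suc Ck_on.simps by blast
  then show ?thesis by (simp add: continuous_at_imp_continuous_on)
qed simp

lemma Ck_on_Suc_imp: "Ck_on (Suc k) S f \<Longrightarrow> Ck_on k S f"
proof (induction k arbitrary: f)
  case 0
  then show ?case using Ck_on_continuous by (metis Ck_on.simps(1))
qed simp

lemma Ck_on_const: "open S \<Longrightarrow> Ck_on k S (\<lambda>x. c)"
  by (induction k arbitrary: c) auto

lemma Ck_on_add:
  assumes "open S" shows "Ck_on k S f \<Longrightarrow> Ck_on k S g \<Longrightarrow> Ck_on k S (\<lambda>x. f x + g x)"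
proof (induction k arbitrary: f g)
  case (Suc k)
  show ?case
    by (rule Ck_on_SucI[OF assms, where f' = "\<lambda>x v. FD f x v + FD g x v"])
      (auto intro!: has_derivative_add Ck_on_Suc_has_derivative[OF Suc.prems(1)]
        Ck_on_Suc_has_derivative[OF Suc.prems(2)] Suc.IH
        Ck_on_Suc_FD[OF Suc.prems(1)] Ck_on_Suc_FD[OF Suc.prems(2)])
qed (auto intro: continuous_intros)

lemma Ck_on_sum:
  assumes "open S" "\<And>i. i \<in> I \<Longrightarrow> Ck_on k S (f i)" shows "Ck_on k S (\<lambda>x. \<Sum>i\<in>I. f i x)"
  using assms(2) by (induction I rule: infinite_finite_induct)
    (simp_all add: Ck_on_const[OF assms(1)] Ck_on_add[OF assms(1)])

lemma Ck_on_linear: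
  assumes "open S" "bounded_linear l" shows "Ck_on k S f \<Longrightarrow> Ck_on k S (\<lambda>x. l (f x))"
proof (induction k arbitrary: f)
  case (Suc k)
  show ?case
    by (rule Ck_on_SucI[OF assms(1), where f' = "\<lambda>x v. l (FD f x v)"])
      (auto intro!: Ck_on_Suc_has_derivative[OF Suc.prems(1)] Suc.IH
        Ck_on_Suc_FD[OF Suc.prems(1)] bounded_linear.has_derivative[OF assms(2)])
qed (auto intro: bounded_linear.continuous_on[OF assms(2)])

lemma Ck_on_bilinear:
  assumes "open S" "bounded_bilinear m"
  shows "Ck_on k S f \<Longrightarrow> Ck_on k S g \<Longrightarrow> Ck_on k S (\<lambda>x. m (f x) (g x))"
proof (induction k arbitrary: f g)
  case (Suc k)
  show ?case
    by (rule Ck_on_SucI[OF assms(1), where f' = "\<lambda>x v. m (f x) (FD g x v) + m (FD f x v) (g x)"])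
      (auto intro!: bounded_bilinear.FDERIV[OF assms(2)] Ck_on_add[OF assms(1)]
        Ck_on_Suc_has_derivative[OF Suc.prems(1)]
        Ck_on_Suc_has_derivative[OF Suc.prems(2)] Suc.IH Ck_on_Suc_imp[OF Suc.prems(1)]
        Ck_on_Suc_imp[OF Suc.prems(2)]
        Ck_on_Suc_FD[OF Suc.prems(1)] Ck_on_Suc_FD[OF Suc.prems(2)])
qed (auto intro: bounded_bilinear.continuous_on[OF assms(2)])

lemma linear_basis_expansion:
  fixes l :: "'a::euclidean_space \<Rightarrow> 'b::real_vector"
  assumes "linear l"
  shows "l v = (\<Sum>i\<in>Basis. (v \<bullet> i) *\<^sub>R l i)"
proof -
  have "l v = l (\<Sum>i\<in>Basis. (v \<bullet> i) *\<^sub>R i)" by (simp add: euclidean_representation)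
  also have "\<dots> = (\<Sum>i\<in>Basis. (v \<bullet> i) *\<^sub>R l i)"
    by (simp add: linear_sum[OF assms] linear_cmul[OF assms])
  finally show ?thesis .
qed

text \<open>Expanding the argument in a basis reduces a linear family at a moving argument to products of
  \<open>C\<^sup>k\<close> functions, so no operator norm on the space of linear maps is needed.\<close>

lemma Ck_on_linear_family:
  fixes y :: "'a::real_normed_vector \<Rightarrow> 'b::euclidean_space"
    and L :: "'a \<Rightarrow> 'b \<Rightarrow> 'c::real_normed_vector"
  assumes "open S" "\<And>x. x \<in> S \<Longrightarrow> linear (L x)" "\<And>w. Ck_on k S (\<lambda>x. L x w)" "Ck_on k S y"
  shows "Ck_on k S (\<lambda>x. L x (y x))"
proof (rule Ck_on_cong[OF assms(1)])
  show "Ck_on k S (\<lambda>x. \<Sum>i\<in>Basis. (y x \<bullet> i) *\<^sub>R L x i)"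
    by (intro Ck_on_sum Ck_on_bilinear[OF assms(1) bounded_bilinear_scaleR] assms
        Ck_on_linear[OF assms(1) bounded_linear_inner_left])
qed (simp add: linear_basis_expansion[OF assms(2), symmetric])

lemma linear_FD: "(f has_derivative FD f x) (at x) \<Longrightarrow> linear (FD f x)"
  by (simp add: has_derivative_linear)

lemma Ck_on_mono: "S \<subseteq> T \<Longrightarrow> Ck_on k T f \<Longrightarrow> Ck_on k S f"
proof (induction k arbitrary: f)
  case 0 then show ?case using continuous_on_subset by auto
qed auto

text \<open>The chain rule writes the derivative of the composition as a linear family applied to a moving vector, and both have
  one derivative less; this is the induction step.\<close>

lemma Ck_on_compose:
  fixes f :: "'a::real_normed_vector \<Rightarrow> 'b::euclidean_space" and g :: "'b \<Rightarrow> 'c::real_normed_vector"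
  assumes "open S" "open T" "f ` S \<subseteq> T"
  shows "Ck_on k T g \<Longrightarrow> Ck_on k S f \<Longrightarrow> Ck_on k S (\<lambda>x. g (f x))"
  using assms(3)
proof (induction k arbitrary: f g)
  case 0
  then show ?case by (auto intro: continuous_on_compose2)
next
  case (Suc k)
  have g: "(g has_derivative FD g (f x)) (at (f x))" if "x \<in> S" for x
    using Ck_on_Suc_has_derivative[OF Suc.prems(1)] Suc.prems(3) that by auto
  show ?case
  proof (rule Ck_on_SucI[OF assms(1), where f' = "\<lambda>x v. FD g (f x) (FD f x v)"])
    show "((\<lambda>x. g (f x)) has_derivative (\<lambda>v. FD g (f x) (FD f x v))) (at x)" if "x \<in> S" for x
      using diff_chain_at[OF Ck_on_Suc_has_derivative[OF Suc.prems(2) that] g[OF that]]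
      by (simp add: o_def)
    show "Ck_on k S (\<lambda>x. FD g (f x) (FD f x v))" for v
      by (rule Ck_on_linear_family[OF assms(1), where L = "\<lambda>x. FD g (f x)" and y = "\<lambda>x. FD f x v"])
        (auto intro!: Suc.IH[where f = f] Suc.prems Ck_on_Suc_FD[OF Suc.prems(1)] Ck_on_Suc_FD[OF Suc.prems(2)]
          linear_FD g Ck_on_Suc_imp[OF Suc.prems(2)])
  qed
qed

text \<open>Where \<open>h\<close> vanishes, the product rule needs no derivative of the other factor: its increment is multiplied by
  \<open>h\<close>, which is already of first order.\<close>

lemma has_derivative_mult_vanishing:
  fixes h :: "'a::real_normed_vector \<Rightarrow> 'b::real_normed_vector" and a :: "'a \<Rightarrow> real"
  assumes h: "(h has_derivative h') (at x)" and "h x = 0" and a: "continuous (at x) a"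
  shows "((\<lambda>y. a y *\<^sub>R h y) has_derivative (\<lambda>v. a x *\<^sub>R h' v)) (at x)"
proof -
  have bl: "bounded_linear h'" using h by (rule has_derivative_bounded_linear)
  obtain K where K: "\<And>v. norm (h' v) \<le> norm v * K"
    using bounded_linear.bounded[OF bl] by blast
  have l1: "((\<lambda>y. norm (h y - h' (y - x)) / norm (y - x)) \<longlongrightarrow> 0) (at x)"
    using h \<open>h x = 0\<close> by (simp add: has_derivative_iff_norm)
  have ta: "((\<lambda>y. a y - a x) \<longlongrightarrow> 0) (at x)"
    using a by (simp add: continuous_at LIM_zero)
  have ta': "((\<lambda>y. a y) \<longlongrightarrow> a x) (at x)"
    using a by (simp add: continuous_at)
  have lim: "((\<lambda>y. \<bar>a y\<bar> * (norm (h y - h' (y - x)) / norm (y - x)) + \<bar>a y - a x\<bar> * K) \<longlongrightarrow> \<bar>a x\<bar> * 0 + \<bar>0\<bar> * K) (at x)"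
    by (intro tendsto_intros l1 ta ta')
  have "norm (a y *\<^sub>R h y - a x *\<^sub>R h' (y - x)) / norm (y - x)
     \<le> \<bar>a y\<bar> * (norm (h y - h' (y - x)) / norm (y - x)) + \<bar>a y - a x\<bar> * K" if "y \<noteq> x" for y
  proof -
    have n: "norm (y - x) > 0" using that by simp
    have "a y *\<^sub>R h y - a x *\<^sub>R h' (y - x) = a y *\<^sub>R (h y - h' (y - x)) + (a y - a x) *\<^sub>R h' (y - x)"
      by (simp add: algebra_simps)
    also have "norm \<dots> \<le> \<bar>a y\<bar> * norm (h y - h' (y - x)) + \<bar>a y - a x\<bar> * norm (h' (y - x))"
      by (metis norm_scaleR norm_triangle_ineq)
    also have "\<dots> \<le> \<bar>a y\<bar> * norm (h y - h' (y - x)) + \<bar>a y - a x\<bar> * (norm (y - x) * K)"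
      by (intro add_left_mono mult_left_mono K) auto
    finally show ?thesis using n by (simp add: field_simps)
  qed
  then have "((\<lambda>y. norm (a y *\<^sub>R h y - a x *\<^sub>R h' (y - x)) / norm (y - x)) \<longlongrightarrow> 0) (at x)"
    using lim by (intro Lim_null_comparison[OF _ lim[simplified]]) (auto simp: eventually_at_filter)
  moreover have "bounded_linear (\<lambda>v. a x *\<^sub>R h' v)"
    by (rule bounded_linear_compose[OF bounded_linear_scaleR_right bl])
  ultimately show ?thesis using \<open>h x = 0\<close> by (simp add: has_derivative_iff_norm)
qed

text \<open>An injective \<open>L x0\<close> is bounded below, and near \<open>x0\<close> the operators \<open>L x\<close> differ from it by less than half of
  that bound; this controls the solution by the right side.\<close>

lemma linear_system_continuous:
  fixes L :: "'a::real_normed_vector \<Rightarrow> 'b::euclidean_space \<Rightarrow> 'c::euclidean_space"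
  assumes "open S" and x0: "x0 \<in> S" and lin: "\<And>x. x \<in> S \<Longrightarrow> linear (L x)" and inj: "inj (L x0)"
    and L: "\<And>w. continuous_on S (\<lambda>x. L x w)" and b: "continuous_on S b"
    and eq: "\<And>x. x \<in> S \<Longrightarrow> L x (y x) = b x"
  shows "continuous (at x0) y"
proof -
  have at: "at x0 within S = at x0" using \<open>open S\<close> x0 by (rule at_within_open[rotated])
  obtain m where m: "m > 0" "\<And>w. m * norm w \<le> norm (L x0 w)"
  proof -
    obtain B where "B > 0" "\<And>x. B * norm x \<le> norm (L x0 x)"
      using linear_inj_bounded_below_pos[OF lin[OF x0] inj] by (auto simp: mult.commute)
    then show ?thesis using that by blast
  qed
  define E where "E x = (\<Sum>i\<in>Basis. norm (L x i - L x0 i))" for x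
  have tL: "((\<lambda>x. L x w) \<longlongrightarrow> L x0 w) (at x0)" for w
    using L x0 at by (metis continuous_on_def)
  have tb: "(b \<longlongrightarrow> b x0) (at x0)" using b x0 at by (metis continuous_on_def)
  have "(E \<longlongrightarrow> (\<Sum>i\<in>Basis. norm (L x0 i - L x0 i))) (at x0)"
    unfolding E_def by (intro tendsto_intros tL)
  then have tE: "(E \<longlongrightarrow> 0) (at x0)" by simp
  have E: "norm (L x w - L x0 w) \<le> E x * norm w" if "x \<in> S" for x w
  proof -
    have "L x w - L x0 w = (\<Sum>i\<in>Basis. (w \<bullet> i) *\<^sub>R (L x i - L x0 i))"
      using linear_basis_expansion[OF lin[OF that], of w] linear_basis_expansion[OF lin[OF x0], of w]
      by (simp add: sum_subtractf algebra_simps)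
    also have "norm \<dots> \<le> (\<Sum>i\<in>Basis. \<bar>w \<bullet> i\<bar> * norm (L x i - L x0 i))"
      by (rule sum_norm_le) simp
    also have "\<dots> \<le> (\<Sum>i\<in>Basis. norm w * norm (L x i - L x0 i))"
      by (intro sum_mono mult_right_mono Basis_le_norm) auto
    finally show ?thesis by (simp add: E_def sum_distrib_left mult.commute)
  qed
  have evS: "\<forall>\<^sub>F x in at x0. x \<in> S" using \<open>open S\<close> x0 by (metis at eventually_at_topological)
  have evE: "\<forall>\<^sub>F x in at x0. E x < m / 2" 
    by (rule order_tendstoD(2)[OF tE]) (use m(1) in simp)
  \<comment> \<open>The factor \<open>2/m\<close> comes from \<open>E x < m/2\<close>, which leaves \<open>m - E x > m/2\<close>.\<close>
  let ?R = "\<lambda>x. (2 / m) * (norm (b x - b x0) + E x * norm (y x0))"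
  have "(?R \<longlongrightarrow> (2 / m) * (norm (b x0 - b x0) + 0 * norm (y x0))) (at x0)"
    by (intro tendsto_intros tE tb)
  then have lim: "(?R \<longlongrightarrow> 0) (at x0)" by simp
  have "\<forall>\<^sub>F x in at x0. norm (y x - y x0) \<le> ?R x"
    using evS evE
  proof eventually_elim
    case (elim x)
    let ?n = "norm (y x - y x0)"
    have "m * ?n \<le> norm (L x0 (y x - y x0))" by (rule m)
    also have "L x0 (y x - y x0) = (b x - b x0) - (L x (y x) - L x0 (y x))"
      using eq[OF x0] eq[OF elim(1)] by (simp add: linear_diff[OF lin[OF x0]])
    also have "norm \<dots> \<le> norm (b x - b x0) + E x * norm (y x)"
      using norm_triangle_ineq4 E[OF elim(1)] by (smt (verit))
    also have "\<dots> \<le> norm (b x - b x0) + E x * (?n + norm (y x0))"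
    proof -
      have "norm (y x) \<le> ?n + norm (y x0)" by (metis norm_triangle_sub add.commute)
      moreover have "E x \<ge> 0" unfolding E_def by (intro sum_nonneg) auto
      ultimately show ?thesis by (simp add: mult_left_mono)
    qed
    finally have "m * ?n \<le> norm (b x - b x0) + E x * norm (y x0) + E x * ?n"
      by (simp add: algebra_simps)
    moreover have "E x * ?n \<le> m / 2 * ?n" using elim(2) by (intro mult_right_mono) auto
    ultimately have "m / 2 * ?n \<le> norm (b x - b x0) + E x * norm (y x0)" by simp
    then show ?case using m(1) by (simp add: field_simps)
  qed
  then have "((\<lambda>x. y x - y x0) \<longlongrightarrow> 0) (at x0)"
    by (rule Lim_null_comparison[OF _ lim])
  then show ?thesis by (simp add: continuous_at LIM_zero_iff)
qed

text \<open>Subtracting the systems at \<open>x\<close> and \<open>x0\<close> shows that \<open>L x0 (y x - y x0)\<close> is the increment of \<open>b\<close> minus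
  the increments of the columns of \<open>L\<close> weighted with the coordinates of \<open>y x\<close>. These weights are merely continuous, but the
  increments vanish at \<open>x0\<close>. The derivative of \<open>y\<close> solves a system with the same operator.\<close>

lemma linear_system_has_derivative:
  fixes L :: "'a::real_normed_vector \<Rightarrow> 'b::euclidean_space \<Rightarrow> 'c::euclidean_space"
  assumes "open S" and x0: "x0 \<in> S" and lin: "\<And>x. x \<in> S \<Longrightarrow> linear (L x)" and inj: "inj (L x0)"
    and L: "\<And>w. ((\<lambda>x. L x w) has_derivative L' w) (at x0)" and b: "(b has_derivative b') (at x0)"
    and eq: "\<And>x. x \<in> S \<Longrightarrow> L x (y x) = b x" and cont: "continuous (at x0) y"
  obtains y' where "(y has_derivative y') (at x0)"
    "\<And>v. L x0 (y' v) = b' v - (\<Sum>i\<in>Basis. (y x0 \<bullet> i) *\<^sub>R L' i v)"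
proof -
  obtain K where K: "linear K" "K \<circ> L x0 = id"
    using linear_injective_left_inverse[OF lin[OF x0] inj] by blast
  have KL: "K (L x0 w) = w" for w using K(2) by (metis comp_apply id_apply)
  let ?\<phi> = "\<lambda>x. b x - b x0 - (\<Sum>i\<in>Basis. (y x \<bullet> i) *\<^sub>R (L x i - L x0 i))"
  let ?\<phi>' = "\<lambda>v. b' v - (\<Sum>i\<in>Basis. (y x0 \<bullet> i) *\<^sub>R L' i v)"
  have ph: "L x0 (y x) = L x0 (y x0) + ?\<phi> x" if "x \<in> S" for x
  proof -
    have "(\<Sum>i\<in>Basis. (y x \<bullet> i) *\<^sub>R (L x i - L x0 i)) = L x (y x) - L x0 (y x)"
      using linear_basis_expansion[OF lin[OF that], of "y x"] linear_basis_expansion[OF lin[OF x0], of "y x"]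
      by (simp add: sum_subtractf algebra_simps)
    then show ?thesis using eq[OF x0] eq[OF that] by simp
  qed
  have d\<phi>: "(?\<phi> has_derivative ?\<phi>') (at x0)"
  proof -
    have "((\<lambda>x. (y x \<bullet> i) *\<^sub>R (L x i - L x0 i)) has_derivative (\<lambda>v. (y x0 \<bullet> i) *\<^sub>R L' i v)) (at x0)" for i
      by (rule has_derivative_mult_vanishing)
        (auto intro!: continuous_intros cont derivative_eq_intros L)
    then have "((\<lambda>x. \<Sum>i\<in>Basis. (y x \<bullet> i) *\<^sub>R (L x i - L x0 i)) has_derivative
        (\<lambda>v. \<Sum>i\<in>Basis. (y x0 \<bullet> i) *\<^sub>R L' i v)) (at x0)"
      by (intro has_derivative_sum) blast
    moreover have "((\<lambda>x. b x - b x0) has_derivative b') (at x0)"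
      using has_derivative_diff[OF b has_derivative_const] by simp
    ultimately show ?thesis by (rule has_derivative_diff[rotated])
  qed
  have bK: "bounded_linear K" using K(1) by (rule linear_linear[THEN iffD2])
  have dy: "(y has_derivative (\<lambda>v. K (?\<phi>' v))) (at x0)"
  proof (rule has_derivative_transform_within_open[OF _ \<open>open S\<close> x0])
    show "((\<lambda>x. y x0 + K (?\<phi> x)) has_derivative (\<lambda>v. K (?\<phi>' v))) (at x0)"
      using has_derivative_add[OF has_derivative_const bounded_linear.has_derivative[OF bK d\<phi>]] by simp
    show "y x0 + K (?\<phi> x) = y x" if "x \<in> S" for x
    proof -
      have "?\<phi> x = L x0 (y x - y x0)" using ph[OF that] by (simp add: linear_diff[OF lin[OF x0]])
      then show ?thesis using KL[of "y x - y x0"] by simp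
    qed
  qed
  have "((\<lambda>x. L x0 (y x)) has_derivative (\<lambda>v. L x0 (K (?\<phi>' v)))) (at x0)"
    by (rule bounded_linear.has_derivative[OF _ dy]) (use lin[OF x0] linear_linear in blast)
  moreover have "((\<lambda>x. L x0 (y x)) has_derivative ?\<phi>') (at x0)"
  proof (rule has_derivative_transform_within_open[OF _ \<open>open S\<close> x0])
    show "((\<lambda>x. L x0 (y x0) + ?\<phi> x) has_derivative ?\<phi>') (at x0)"
      using has_derivative_add[OF has_derivative_const d\<phi>] by simp
  qed (simp add: ph)
  ultimately have "(\<lambda>v. L x0 (K (?\<phi>' v))) = ?\<phi>'" by (rule has_derivative_unique)
  then show ?thesis using that[OF dy] by meson
qed

text \<open>The derivative of the solution solves a system with the same operator, whose right side has one derivative less, so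
  the regularity of the data passes to the solution by induction.\<close>

lemma Ck_on_linear_system:
  fixes L :: "'a::real_normed_vector \<Rightarrow> 'b::euclidean_space \<Rightarrow> 'c::euclidean_space"
  assumes "open S" and lin: "\<And>x. x \<in> S \<Longrightarrow> linear (L x)" and inj: "\<And>x. x \<in> S \<Longrightarrow> inj (L x)"
    and "\<And>w. Ck_on k S (\<lambda>x. L x w)" and "Ck_on k S b"
    and "\<And>x. x \<in> S \<Longrightarrow> L x (y x) = b x"
  shows "Ck_on k S y"
  using assms(4-)
proof (induction k arbitrary: b y)
  case 0
  have "continuous (at x) y" if "x \<in> S" for x
    by (rule linear_system_continuous[where L = L and b = b, OF \<open>open S\<close> that lin inj[OF that]])
      (use 0 in auto)
  then show ?case by (simp add: continuous_at_imp_continuous_on)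
next
  case (Suc k)
  have yk: "Ck_on k S y"
    by (rule Suc.IH[of b]) (use Suc.prems Ck_on_Suc_imp in blast)+
  have cont: "continuous (at x) y" if "x \<in> S" for x
    using Ck_on_continuous[OF yk] that \<open>open S\<close> continuous_on_eq_continuous_at by blast
  let ?b = "\<lambda>v x. FD b x v - (\<Sum>i\<in>Basis. (y x \<bullet> i) *\<^sub>R FD (\<lambda>x. L x i) x v)"
  have ex: "\<exists>y'. (y has_derivative y') (at x) \<and> (\<forall>v. L x (y' v) = ?b v x)" if "x \<in> S" for x
    using linear_system_has_derivative[OF \<open>open S\<close> that lin inj[OF that]
        Ck_on_Suc_has_derivative[OF Suc.prems(1) that] Ck_on_Suc_has_derivative[OF Suc.prems(2) that]
        Suc.prems(3) cont[OF that]] by metis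
  then have "\<forall>x\<in>S. \<exists>y'. (y has_derivative y') (at x) \<and> (\<forall>v. L x (y' v) = ?b v x)" by blast
  from bchoice[OF this] obtain y' where
    y'': "\<forall>x\<in>S. (y has_derivative y' x) (at x) \<and> (\<forall>v. L x (y' x v) = ?b v x)" ..
  then have y': "\<And>x. x \<in> S \<Longrightarrow> (y has_derivative y' x) (at x)"
    "\<And>x v. x \<in> S \<Longrightarrow> L x (y' x v) = ?b v x" by blast+
  show ?case
  proof (rule Ck_on_SucI[OF \<open>open S\<close> y'(1)])
    fix v
    have eq: "(\<lambda>x. ?b v x) = (\<lambda>x. FD b x v + (\<Sum>i\<in>Basis. (- (y x \<bullet> i)) *\<^sub>R FD (\<lambda>x. L x i) x v))"
      by (simp add: sum_negf)
    have "Ck_on k S (\<lambda>x. ?b v x)"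
      unfolding eq
      by (intro Ck_on_add Ck_on_sum Ck_on_bilinear[OF _ bounded_bilinear_scaleR]
          Ck_on_Suc_FD Suc.prems \<open>open S\<close>
          Ck_on_linear[OF \<open>open S\<close> bounded_linear_minus[OF bounded_linear_inner_left]] yk)
    then show "Ck_on k S (\<lambda>x. y' x v)"
      by (rule Suc.IH[rotated]) (use Suc.prems(1) Ck_on_Suc_imp y'(2) in blast)+
  qed auto
qed


lemma Ck_on_local:
  assumes "\<And>x. x \<in> S \<Longrightarrow> \<exists>U. open U \<and> x \<in> U \<and> Ck_on k U f"
  shows "Ck_on k S f"
  using assms
proof (induction k arbitrary: f)
  case 0
  have "continuous (at x) f" if "x \<in> S" for x
    using 0[OF that] by (auto simp: continuous_on_eq_continuous_at)
  then show ?case by (simp add: continuous_at_imp_continuous_on)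
next
  case (Suc k)
  have "f differentiable (at x)" if "x \<in> S" for x
    using Suc.prems[OF that] by auto
  moreover have "Ck_on k S (\<lambda>x. FD f x v)" for v
  proof (rule Suc.IH)
    show "\<exists>U. open U \<and> x \<in> U \<and> Ck_on k U (\<lambda>x. FD f x v)" if "x \<in> S" for x
      using Suc.prems[OF that] Ck_on_Suc_FD by blast
  qed
  ultimately show ?case unfolding Ck_on.simps by blast
qed

lemma smooth_on_cong:
  "open S \<Longrightarrow> (\<And>x. x \<in> S \<Longrightarrow> f x = g x) \<Longrightarrow> smooth_on S f \<Longrightarrow> smooth_on S g"
  unfolding smooth_on_def using Ck_on_cong by blast

lemma smooth_on_has_derivative: "smooth_on S f \<Longrightarrow> x \<in> S \<Longrightarrow> (f has_derivative FD f x) (at x)"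
  unfolding smooth_on_def using Ck_on_Suc_has_derivative by blast

lemma smooth_on_differentiable: "smooth_on S f \<Longrightarrow> x \<in> S \<Longrightarrow> f differentiable (at x)"
  using smooth_on_has_derivative differentiable_def by blast

lemma smooth_on_linear_FD: "smooth_on S f \<Longrightarrow> x \<in> S \<Longrightarrow> linear (FD f x)"
  using smooth_on_has_derivative linear_FD by blast

lemma smooth_on_FD: "smooth_on S f \<Longrightarrow> smooth_on S (\<lambda>x. FD f x u)"
  unfolding smooth_on_def using Ck_on_Suc_FD by blast

lemma smooth_on_continuous: "smooth_on S f \<Longrightarrow> continuous_on S f"
  unfolding smooth_on_def using Ck_on_continuous by metis

lemma smooth_on_mono: "smooth_on T f \<Longrightarrow> S \<subseteq> T \<Longrightarrow> smooth_on S f"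
  unfolding smooth_on_def using Ck_on_mono by metis

lemma smooth_on_const: "open S \<Longrightarrow> smooth_on S (\<lambda>x. c)"
  by (simp add: smooth_on_def Ck_on_const)

lemma smooth_on_linear: "open S \<Longrightarrow> bounded_linear l \<Longrightarrow> smooth_on S f \<Longrightarrow> smooth_on S (\<lambda>x. l (f x))"
  by (simp add: smooth_on_def Ck_on_linear)

lemma smooth_on_ident: "open S \<Longrightarrow> smooth_on S (\<lambda>x. x)"
proof -
  assume S: "open S"
  have "Ck_on k S (\<lambda>x. x)" for k
    by (cases k) (auto intro!: Ck_on_SucI[OF S, where f' = "\<lambda>x v. v"] Ck_on_const S)
  then show ?thesis by (simp add: smooth_on_def)
qed

lemma smooth_on_add: "open S \<Longrightarrow> smooth_on S f \<Longrightarrow> smooth_on S g \<Longrightarrow> smooth_on S (\<lambda>x. f x + g x)"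
  by (simp add: smooth_on_def Ck_on_add)

lemma smooth_on_diff: "open S \<Longrightarrow> smooth_on S f \<Longrightarrow> smooth_on S g \<Longrightarrow> smooth_on S (\<lambda>x. f x - g x)"
  using smooth_on_add[of S f "\<lambda>x. - g x"] smooth_on_linear[OF _ bounded_linear_minus[OF bounded_linear_ident], of S g]
  by simp

lemma smooth_on_sum:
  "open S \<Longrightarrow> (\<And>i. i \<in> I \<Longrightarrow> smooth_on S (f i)) \<Longrightarrow> smooth_on S (\<lambda>x. \<Sum>i\<in>I. f i x)"
  by (simp add: smooth_on_def Ck_on_sum)

lemma smooth_on_Pair:
  "open S \<Longrightarrow> smooth_on S f \<Longrightarrow> smooth_on S g \<Longrightarrow> smooth_on S (\<lambda>x. (f x, g x))"
  using smooth_on_add[of S "\<lambda>x. (f x, 0)" "\<lambda>x. (0, g x)"]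
    smooth_on_linear[of S "\<lambda>a. (a, 0)" f] smooth_on_linear[of S "\<lambda>b. (0, b)" g]
  by (simp add: bounded_linear_Pair)

lemma smooth_on_linear_family:
  fixes y :: "'a::real_normed_vector \<Rightarrow> 'b::euclidean_space"
    and L :: "'a \<Rightarrow> 'b \<Rightarrow> 'c::real_normed_vector"
  assumes "open S" "\<And>x. x \<in> S \<Longrightarrow> linear (L x)" "\<And>w. smooth_on S (\<lambda>x. L x w)" "smooth_on S y"
  shows "smooth_on S (\<lambda>x. L x (y x))"
  unfolding smooth_on_def
proof
  fix k
  show "Ck_on k S (\<lambda>x. L x (y x))"
    by (rule Ck_on_linear_family) (use assms in \<open>auto simp: smooth_on_def\<close>)
qed

lemma smooth_on_compose:
  fixes f :: "'a::real_normed_vector \<Rightarrow> 'b::euclidean_space" and g :: "'b \<Rightarrow> 'c::real_normed_vector"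
  assumes "open S" "open T" "f ` S \<subseteq> T" "smooth_on T g" "smooth_on S f"
  shows "smooth_on S (\<lambda>x. g (f x))"
  unfolding smooth_on_def
proof
  fix k
  show "Ck_on k S (\<lambda>x. g (f x))"
    by (rule Ck_on_compose[OF assms(1-3)]) (use assms in \<open>auto simp: smooth_on_def\<close>)
qed

lemma smooth_on_linear_system:
  fixes L :: "'a::real_normed_vector \<Rightarrow> 'b::euclidean_space \<Rightarrow> 'c::euclidean_space"
  assumes "open S" "\<And>x. x \<in> S \<Longrightarrow> linear (L x)" "\<And>x. x \<in> S \<Longrightarrow> inj (L x)"
    and "\<And>w. smooth_on S (\<lambda>x. L x w)" "smooth_on S b"
    and "\<And>x. x \<in> S \<Longrightarrow> L x (y x) = b x"
  shows "smooth_on S y"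
  unfolding smooth_on_def
proof
  fix k
  show "Ck_on k S y"
    by (rule Ck_on_linear_system[where L = L and b = b]) (use assms in \<open>auto simp: smooth_on_def\<close>)
qed

lemma smooth_on_local:
  assumes "\<And>x. x \<in> S \<Longrightarrow> \<exists>U. open U \<and> x \<in> U \<and> smooth_on U f"
  shows "smooth_on S f"
  unfolding smooth_on_def
proof
  fix k
  show "Ck_on k S f"
  proof (rule Ck_on_local)
    fix x assume "x \<in> S"
    from assms[OF this] show "\<exists>U. open U \<and> x \<in> U \<and> Ck_on k U f"
      unfolding smooth_on_def by (elim exE conjE) (intro exI conjI, auto)
  qed
qed

lemma FD_compose:
  assumes "(f has_derivative FD f x) (at x)" "(g has_derivative FD g (f x)) (at (f x))"
  shows "FD (\<lambda>x. g (f x)) x v = FD g (f x) (FD f x v)"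
  using FD_eqI[OF diff_chain_at[OF assms]] by (simp add: o_def)

section \<open>Symmetry of second derivatives\<close>

lemma directional_real_derivative:
  fixes f :: "'a::real_normed_vector \<Rightarrow> real"
  assumes "(f has_derivative FD f (p + s *\<^sub>R u)) (at (p + s *\<^sub>R u))"
  shows "((\<lambda>s. f (p + s *\<^sub>R u)) has_real_derivative FD f (p + s *\<^sub>R u) u) (at s)"
proof -
  have "((\<lambda>s. p + s *\<^sub>R u) has_derivative (\<lambda>t. t *\<^sub>R u)) (at s)"
    by (auto intro!: derivative_eq_intros)
  from diff_chain_at[OF this assms]
  have "((\<lambda>s. f (p + s *\<^sub>R u)) has_derivative (\<lambda>t. FD f (p + s *\<^sub>R u) (t *\<^sub>R u))) (at s)"
    by (simp add: o_def)
  moreover have "(\<lambda>t. FD f (p + s *\<^sub>R u) (t *\<^sub>R u)) = (*) (FD f (p + s *\<^sub>R u) u)"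
    using linear_cmul[OF linear_FD[OF assms]] by (auto simp: mult.commute)
  ultimately show ?thesis by (simp add: has_field_derivative_def)
qed

text \<open>The second difference of \<open>f\<close> over a parallelogram does not depend on the order of its sides, whereas the mean
  value theorem expresses it by a second derivative taken in a definite order.\<close>

lemma mixed_difference_mean_value:
  fixes f :: "'a::real_normed_vector \<Rightarrow> real"
  assumes h: "h > 0" and S: "\<And>s t. 0 \<le> s \<Longrightarrow> s \<le> h \<Longrightarrow> 0 \<le> t \<Longrightarrow> t \<le> h \<Longrightarrow> x + s *\<^sub>R u + t *\<^sub>R v \<in> S"
    and f: "smooth_on S f"
  obtains s t where "0 < s" "s < h" "0 < t" "t < h"
    "f (x + h *\<^sub>R u + h *\<^sub>R v) - f (x + h *\<^sub>R u) - f (x + h *\<^sub>R v) + f x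
      = h * h * FD (\<lambda>y. FD f y u) (x + s *\<^sub>R u + t *\<^sub>R v) v"
proof -
  have d: "((\<lambda>s. f ((x + t *\<^sub>R v) + s *\<^sub>R u)) has_real_derivative FD f ((x + t *\<^sub>R v) + s *\<^sub>R u) u) (at s)"
    if "0 \<le> s" "s \<le> h" "0 \<le> t" "t \<le> h" for s t
    by (rule directional_real_derivative, rule smooth_on_has_derivative[OF f])
      (use S[OF that] in \<open>simp add: ac_simps\<close>)
  \<comment> \<open>First the difference in the direction \<open>v\<close> as a function of the step in the direction \<open>u\<close>.\<close>
  obtain s where s: "0 < s" "s < h"
    "(f ((x + h *\<^sub>R v) + h *\<^sub>R u) - f ((x + 0 *\<^sub>R v) + h *\<^sub>R u)) - (f ((x + h *\<^sub>R v) + 0 *\<^sub>R u) - f ((x + 0 *\<^sub>R v) + 0 *\<^sub>R u))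
      = (h - 0) * (FD f ((x + h *\<^sub>R v) + s *\<^sub>R u) u - FD f ((x + 0 *\<^sub>R v) + s *\<^sub>R u) u)"
  proof -
    have "((\<lambda>s. f ((x + h *\<^sub>R v) + s *\<^sub>R u) - f ((x + 0 *\<^sub>R v) + s *\<^sub>R u)) has_real_derivative
        FD f ((x + h *\<^sub>R v) + s *\<^sub>R u) u - FD f ((x + 0 *\<^sub>R v) + s *\<^sub>R u) u) (at s)"
      if "0 \<le> s" "s \<le> h" for s
      by (rule DERIV_diff[OF d[OF that] d[OF that]]) (use h in auto)
    from MVT2[OF h this] show ?thesis using that by blast
  qed
  have d2: "((\<lambda>t. FD f ((x + s *\<^sub>R u) + t *\<^sub>R v) u) has_real_derivative
      FD (\<lambda>y. FD f y u) ((x + s *\<^sub>R u) + t *\<^sub>R v) v) (at t)" if "0 \<le> t" "t \<le> h" for t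
    by (rule directional_real_derivative[where f = "\<lambda>y. FD f y u"], rule smooth_on_has_derivative[OF smooth_on_FD[OF f]])
      (use S[of s t] s that in simp)
  obtain t where t: "0 < t" "t < h"
    "FD f ((x + s *\<^sub>R u) + h *\<^sub>R v) u - FD f ((x + s *\<^sub>R u) + 0 *\<^sub>R v) u = (h - 0) * FD (\<lambda>y. FD f y u) ((x + s *\<^sub>R u) + t *\<^sub>R v) v"
    using MVT2[OF h d2] by blast
  show ?thesis
    by (rule that[OF s(1,2) t(1,2)]) (use s(3) t(3) in \<open>simp add: ac_simps\<close>)
qed

text \<open>Both orders of differentiation give the same second difference at points of a parallelogram of side \<open>h\<close>; by
  continuity the values at \<open>x\<close> itself cannot differ.\<close>

lemma second_derivative_symmetric_real:
  fixes f :: "'a::real_normed_vector \<Rightarrow> real"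
  assumes "open S" "smooth_on S f" "x \<in> S"
  shows "FD (\<lambda>y. FD f y u) x v = FD (\<lambda>y. FD f y v) x u"
proof (rule ccontr)
  define A where "A y = FD (\<lambda>y. FD f y u) y v" for y
  define B where "B y = FD (\<lambda>y. FD f y v) y u" for y
  define \<epsilon> where "\<epsilon> = \<bar>A x - B x\<bar> / 2"
  assume "FD (\<lambda>y. FD f y u) x v \<noteq> FD (\<lambda>y. FD f y v) x u"
  then have "\<epsilon> > 0" by (simp add: \<epsilon>_def A_def B_def)
  have "continuous_on S A" "continuous_on S B"
    unfolding A_def B_def
    by (rule smooth_on_continuous[OF smooth_on_FD[OF smooth_on_FD[OF assms(2)]]])+
  then have "isCont A x" "isCont B x"
    using assms(1,3) by (simp_all add: continuous_on_eq_continuous_at)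
  then obtain d1 d2 where d: "d1 > 0" "d2 > 0" "\<And>y. dist y x < d1 \<Longrightarrow> dist (A y) (A x) < \<epsilon>"
    "\<And>y. dist y x < d2 \<Longrightarrow> dist (B y) (B x) < \<epsilon>"
    using \<open>\<epsilon> > 0\<close> unfolding continuous_at_eps_delta by blast
  obtain d3 where d3: "d3 > 0" "ball x d3 \<subseteq> S" using assms open_contains_ball by blast
  define \<delta> where "\<delta> = min d1 (min d2 d3)"
  have "\<delta> > 0" using d d3 by (simp add: \<delta>_def)
  define h where "h = \<delta> / (2 * (norm u + norm v + 1))"
  have hp: "h > 0" using \<open>\<delta> > 0\<close> by (simp add: h_def add_nonneg_pos)
  have near: "dist (x + s *\<^sub>R u + t *\<^sub>R v) x < \<delta>" if "0 \<le> s" "s \<le> h" "0 \<le> t" "t \<le> h" for s t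
  proof -
    have "norm (s *\<^sub>R u + t *\<^sub>R v) \<le> s * norm u + t * norm v"
      using that by (metis norm_triangle_ineq norm_scaleR abs_of_nonneg)
    also have "\<dots> \<le> h * norm u + h * norm v"
      using that by (intro add_mono mult_right_mono) auto
    also have "\<dots> \<le> h * (norm u + norm v + 1)" using hp by (simp add: algebra_simps)
    also have "\<dots> = \<delta> / 2"
    proof -
      have "norm u + norm v + 1 > 0" by (simp add: add_nonneg_pos)
      then show ?thesis unfolding h_def by (simp add: field_simps)
    qed
    finally show ?thesis using \<open>\<delta> > 0\<close> by (simp add: dist_norm add.assoc)
  qed
  have inS: "x + s *\<^sub>R u + t *\<^sub>R v \<in> S" if "0 \<le> s" "s \<le> h" "0 \<le> t" "t \<le> h" for s t
    using near[OF that] d3(2) by (auto simp: \<delta>_def dist_commute)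
  obtain s t where st: "0 < s" "s < h" "0 < t" "t < h"
    "f (x + h *\<^sub>R u + h *\<^sub>R v) - f (x + h *\<^sub>R u) - f (x + h *\<^sub>R v) + f x = h * h * A (x + s *\<^sub>R u + t *\<^sub>R v)"
    unfolding A_def by (rule mixed_difference_mean_value[OF hp inS assms(2)])
  have inS': "x + s *\<^sub>R v + t *\<^sub>R u \<in> S" if "0 \<le> s" "s \<le> h" "0 \<le> t" "t \<le> h" for s t
    using inS[of t s] that by (simp add: ac_simps)
  obtain s' t' where st': "0 < s'" "s' < h" "0 < t'" "t' < h"
    "f (x + h *\<^sub>R v + h *\<^sub>R u) - f (x + h *\<^sub>R v) - f (x + h *\<^sub>R u) + f x = h * h * B (x + s' *\<^sub>R v + t' *\<^sub>R u)"
    unfolding B_def by (rule mixed_difference_mean_value[OF hp inS' assms(2)])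
  have "h * h * A (x + s *\<^sub>R u + t *\<^sub>R v) = h * h * B (x + t' *\<^sub>R u + s' *\<^sub>R v)"
    unfolding st(5)[symmetric] using st'(5) by (simp add: add.assoc add.commute[of "_ *\<^sub>R u"])
  then have "A (x + s *\<^sub>R u + t *\<^sub>R v) = B (x + t' *\<^sub>R u + s' *\<^sub>R v)" using hp by simp
  moreover have "dist (A (x + s *\<^sub>R u + t *\<^sub>R v)) (A x) < \<epsilon>"
    by (rule d(3)) (use near[of s t] st in \<open>simp add: \<delta>_def\<close>)
  moreover have "dist (B (x + t' *\<^sub>R u + s' *\<^sub>R v)) (B x) < \<epsilon>"
    by (rule d(4)) (use near[of t' s'] st' in \<open>simp add: \<delta>_def\<close>)
  ultimately show False unfolding \<epsilon>_def dist_real_def by (smt (verit) field_sum_of_halves)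
qed

lemma second_derivative_symmetric:
  fixes f :: "'a::real_normed_vector \<Rightarrow> 'b::euclidean_space"
  assumes "open S" "smooth_on S f" "x \<in> S"
  shows "FD (\<lambda>y. FD f y u) x v = FD (\<lambda>y. FD f y v) x u"
proof (rule euclidean_eqI)
  fix i :: 'b
  have fi: "smooth_on S (\<lambda>y. f y \<bullet> i)"
    by (rule smooth_on_linear[OF assms(1) bounded_linear_inner_left assms(2)])
  have comp: "FD (\<lambda>y. g y \<bullet> i) y w = FD g y w \<bullet> i" if "smooth_on S g" "y \<in> S" for g :: "'a \<Rightarrow> 'b" and y w
    using FD_eqI[OF bounded_linear.has_derivative[OF bounded_linear_inner_left smooth_on_has_derivative[OF that]]]
    by simp
  have "FD (\<lambda>y. FD f y u) x v \<bullet> i = FD (\<lambda>y. FD (\<lambda>y. f y \<bullet> i) y u) x v" for u v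
  proof -
    have "FD (\<lambda>y. FD f y u) x v \<bullet> i = FD (\<lambda>y. FD f y u \<bullet> i) x v"
      by (rule comp[symmetric, OF smooth_on_FD[OF assms(2)] assms(3)])
    also have "FD (\<lambda>y. FD f y u \<bullet> i) x = FD (\<lambda>y. FD (\<lambda>y. f y \<bullet> i) y u) x"
    proof (rule FD_cong_open[OF _ assms(1,3)])
      show "(\<lambda>y. FD f y u \<bullet> i) differentiable at x"
        by (rule smooth_on_differentiable[OF smooth_on_linear[OF assms(1) bounded_linear_inner_left smooth_on_FD[OF assms(2)]] assms(3)])
    qed (use comp[OF assms(2)] in metis)
    finally show ?thesis .
  qed
  then show "FD (\<lambda>y. FD f y u) x v \<bullet> i = FD (\<lambda>y. FD f y v) x u \<bullet> i"
    using second_derivative_symmetric_real[OF assms(1) fi assms(3)] by metis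
qed

section \<open>Smooth inverse functions\<close>

text \<open>The inverse function theorem gives a differentiable local inverse. Its derivative applied to \<open>v\<close> solves a linear system whose
  operator is the derivative of \<open>f\<close> at the inverse, and this bootstraps the inverse to all orders.\<close>

lemma smooth_inverse_function_endo:
  fixes f :: "'a::euclidean_space \<Rightarrow> 'a"
  assumes "open S" "smooth_on S f" "x0 \<in> S" "inj (FD f x0)"
  obtains U V g where "open U" "U \<subseteq> S" "x0 \<in> U" "open V" "homeomorphism U V f g" "smooth_on V g"
proof -
  have bl: "bounded_linear (FD f x)" if "x \<in> S" for x
    using smooth_on_linear_FD[OF assms(2) that] linear_linear by blast
  define f' where "f' x = Blinfun (FD f x)" for x
  have f': "blinfun_apply (f' x) = FD f x" if "x \<in> S" for x
    unfolding f'_def by (simp add: bounded_linear_Blinfun_apply[OF bl[OF that]])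
  obtain K where K: "linear K" "K \<circ> FD f x0 = id"
    using linear_injective_left_inverse[OF smooth_on_linear_FD[OF assms(2,3)] assms(4)] by blast
  have KL: "K (FD f x0 w) = w" for w using K(2) by (metis comp_apply id_apply)
  have bK: "bounded_linear K" using K(1) linear_linear by blast
  have inv: "Blinfun K o\<^sub>L f' x0 = id_blinfun"
    by (rule blinfun_eqI) (simp add: f'[OF assms(3)] bounded_linear_Blinfun_apply[OF bK] KL)
  have cont: "continuous_on S f'"
  proof (rule continuous_on_blinfun_componentwise)
    show "continuous_on S (\<lambda>x. blinfun_apply (f' x) i)" if "i \<in> Basis" for i
    proof (rule continuous_on_eq[OF smooth_on_continuous[OF smooth_on_FD[OF assms(2), of i]]])
      show "\<And>x. x \<in> S \<Longrightarrow> FD f x i = blinfun_apply (f' x) i" using f' by simp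
    qed
  qed
  have der: "(f has_derivative blinfun_apply (f' x)) (at x)" if "x \<in> S" for x
    using f'[OF that] smooth_on_has_derivative[OF assms(2) that] by simp
  obtain U V g g' where UV: "open U" "U \<subseteq> S" "x0 \<in> U" "open V" "f x0 \<in> V" "homeomorphism U V f g"
    "\<And>y. y \<in> V \<Longrightarrow> (g has_derivative (g' y)) (at y)"
    "\<And>y. y \<in> V \<Longrightarrow> g' y = inv (blinfun_apply (f'(g y)))"
    "\<And>y. y \<in> V \<Longrightarrow> bij (blinfun_apply (f'(g y)))"
    using inverse_function_theorem[OF assms(1) der cont assms(3) inv] by metis
  have gS: "g y \<in> S" if "y \<in> V" for y
    using UV(2,6) that by (metis homeomorphism_def imageI subsetD)
  have "Ck_on k V g" for k
  proof (induction k)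
    case 0
    then show ?case using UV(6) by (simp add: homeomorphism_def)
  next
    case (Suc k)
    show ?case
    proof (rule Ck_on_SucI[OF UV(4,7)])
      fix v
      show "Ck_on k V (\<lambda>y. g' y v)"
      proof (rule Ck_on_linear_system[where L = "\<lambda>y. FD f (g y)" and b = "\<lambda>y. v"])
        show "Ck_on k V (\<lambda>y. FD f (g y) w)" for w
          by (rule Ck_on_compose[OF UV(4) assms(1) _ _ Suc])
            (use gS smooth_on_FD[OF assms(2)] in \<open>auto simp: smooth_on_def\<close>)
        show "FD f (g y) (g' y v) = v" if "y \<in> V" for y
          using UV(8,9)[OF that] f'[OF gS[OF that]] by (metis bij_inv_eq_iff)
        show "inj (FD f (g y))" if "y \<in> V" for y
          using UV(9)[OF that] f'[OF gS[OF that]] by (simp add: bij_is_inj)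
      qed (use UV(4) gS smooth_on_linear_FD[OF assms(2)] in \<open>auto intro: Ck_on_const\<close>)
    qed
  qed
  then show ?thesis using that UV by (auto simp: smooth_on_def)
qed

lemma smooth_inverse_function:
  fixes f :: "'a::euclidean_space \<Rightarrow> 'b::euclidean_space"
  assumes "open S" "smooth_on S f" "x0 \<in> S" "bij (FD f x0)"
  obtains U V g where "open U" "U \<subseteq> S" "x0 \<in> U" "open V" "homeomorphism U V f g" "smooth_on V g"
proof -
  \<comment> \<open>A linear isomorphism identifies the two spaces, which have the same dimension.\<close>
  define L where "L = FD f x0"
  have lin: "linear L" unfolding L_def by (rule smooth_on_linear_FD[OF assms(2,3)])
  obtain K where K: "linear K" "K \<circ> L = id"
    using linear_injective_left_inverse[OF lin] assms(4) by (auto simp: L_def bij_def)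
  have KL: "K (L w) = w" for w using K(2) by (metis comp_apply id_apply)
  have LK: "L (K y) = y" for y using assms(4) KL by (metis L_def bij_pointE)
  have bK: "bounded_linear K" using K(1) linear_linear by blast
  have s: "smooth_on S (\<lambda>x. K (f x))" by (rule smooth_on_linear[OF assms(1) bK assms(2)])
  have "FD (\<lambda>x. K (f x)) x0 = (\<lambda>v. K (L v))"
    unfolding L_def by (rule FD_eqI[OF bounded_linear.has_derivative[OF bK smooth_on_has_derivative[OF assms(2,3)]]])
  then have "inj (FD (\<lambda>x. K (f x)) x0)" by (simp add: KL)
  then obtain U V g where UV: "open U" "U \<subseteq> S" "x0 \<in> U" "open V" "homeomorphism U V (\<lambda>x. K (f x)) g" "smooth_on V g"
    using smooth_inverse_function_endo[OF assms(1) s assms(3)] by metis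
  have oV: "open (K -` V)"
    by (rule open_vimage[OF UV(4) linear_continuous_on[OF bK]])
  have "homeomorphism U (K -` V) f (\<lambda>y. g (K y))"
  proof (rule homeomorphismI)
    show "continuous_on U f" using smooth_on_continuous[OF assms(2)] UV(2) continuous_on_subset by blast
    show "continuous_on (K -` V) (\<lambda>y. g (K y))"
      using UV(5) bK by (intro continuous_on_compose2[of V g _ K]) (auto simp: homeomorphism_def linear_continuous_on)
    show "f ` U \<subseteq> K -` V" "(\<lambda>y. g (K y)) ` (K -` V) \<subseteq> U" "\<And>x. x \<in> U \<Longrightarrow> g (K (f x)) = x"
      using UV(5) by (auto simp: homeomorphism_def)
    show "f (g (K y)) = y" if "y \<in> K -` V" for y
    proof -
      have "K (f (g (K y))) = K y" using UV(5) that by (auto simp: homeomorphism_def)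
      then show ?thesis by (metis LK)
    qed
  qed
  moreover have "smooth_on (K -` V) (\<lambda>y. g (K y))"
    by (rule smooth_on_compose[OF oV UV(4) _ UV(6)])
      (auto intro: smooth_on_linear[OF oV bK smooth_on_ident[OF oV]])
  ultimately show ?thesis using that UV oV by blast
qed

section \<open>Riemannian metrics on open sets\<close>

lemma FD_linear_family:
  fixes y :: "'a::real_normed_vector \<Rightarrow> 'b::euclidean_space"
    and L :: "'a \<Rightarrow> 'b \<Rightarrow> 'c::real_normed_vector"
  assumes "open S" and x: "x \<in> S" and lin: "\<And>x. x \<in> S \<Longrightarrow> linear (L x)"
    and L: "\<And>w. smooth_on S (\<lambda>x. L x w)" and y: "smooth_on S y"
  shows "FD (\<lambda>x. L x (y x)) x v = FD (\<lambda>x'. L x' (y x)) x v + L x (FD y x v)"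
proof -
  have dL: "((\<lambda>x. L x w) has_derivative FD (\<lambda>x. L x w) x) (at x)" for w
    by (rule smooth_on_has_derivative[OF L x])
  have dy: "(y has_derivative FD y x) (at x)" by (rule smooth_on_has_derivative[OF y x])
  let ?D = "\<lambda>v. \<Sum>i\<in>Basis. (y x \<bullet> i) *\<^sub>R FD (\<lambda>x. L x i) x v + (FD y x v \<bullet> i) *\<^sub>R L x i"
  have "((\<lambda>x. \<Sum>i\<in>Basis. (y x \<bullet> i) *\<^sub>R L x i) has_derivative ?D) (at x)"
    by (intro has_derivative_sum has_derivative_scaleR dL
        bounded_linear.has_derivative[OF bounded_linear_inner_left dy])
  then have "((\<lambda>x. L x (y x)) has_derivative ?D) (at x)"
    by (rule has_derivative_transform_within_open[OF _ \<open>open S\<close> x])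
      (rule linear_basis_expansion[OF lin, symmetric])
  then have 1: "FD (\<lambda>x. L x (y x)) x v = ?D v" by (simp add: FD_eqI)
  have "((\<lambda>x'. \<Sum>i\<in>Basis. (y x \<bullet> i) *\<^sub>R L x' i) has_derivative
      (\<lambda>v. \<Sum>i\<in>Basis. (y x \<bullet> i) *\<^sub>R FD (\<lambda>x. L x i) x v)) (at x)"
    by (intro has_derivative_sum has_derivative_scaleR_right dL)
  then have "((\<lambda>x'. L x' (y x)) has_derivative
      (\<lambda>v. \<Sum>i\<in>Basis. (y x \<bullet> i) *\<^sub>R FD (\<lambda>x. L x i) x v)) (at x)"
    by (rule has_derivative_transform_within_open[OF _ \<open>open S\<close> x])
      (rule linear_basis_expansion[OF lin, symmetric])
  then have 2: "FD (\<lambda>x'. L x' (y x)) x v = (\<Sum>i\<in>Basis. (y x \<bullet> i) *\<^sub>R FD (\<lambda>x. L x i) x v)"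
    by (simp add: FD_eqI)
  show ?thesis
    unfolding 1 2 linear_basis_expansion[OF lin[OF x], of "FD y x v"] by (simp add: sum.distrib)
qed

lemma smooth_on_bilinear_family:
  fixes X :: "'a::real_normed_vector \<Rightarrow> 'b::euclidean_space" and Y :: "'a \<Rightarrow> 'c::euclidean_space"
    and B :: "'a \<Rightarrow> 'b \<Rightarrow> 'c \<Rightarrow> 'd::real_normed_vector"
  assumes "open S" and lin: "\<And>x. x \<in> S \<Longrightarrow> bilinear (B x)"
    and B: "\<And>u v. smooth_on S (\<lambda>x. B x u v)" and "smooth_on S X" "smooth_on S Y"
  shows "smooth_on S (\<lambda>x. B x (X x) (Y x))"
proof (rule smooth_on_linear_family[where L = "\<lambda>x. B x (X x)"])
  show "smooth_on S (\<lambda>x. B x (X x) w)" for w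
    by (rule smooth_on_linear_family[where L = "\<lambda>x u. B x u w"])
      (use assms in \<open>auto simp: bilinear_def\<close>)
qed (use assms in \<open>auto simp: bilinear_def\<close>)

lemma FD_bilinear_family:
  fixes X :: "'a::real_normed_vector \<Rightarrow> 'b::euclidean_space" and Y :: "'a \<Rightarrow> 'c::euclidean_space"
    and B :: "'a \<Rightarrow> 'b \<Rightarrow> 'c \<Rightarrow> 'd::real_normed_vector"
  assumes "open S" "x \<in> S" and lin: "\<And>x. x \<in> S \<Longrightarrow> bilinear (B x)"
    and B: "\<And>u v. smooth_on S (\<lambda>x. B x u v)" and "smooth_on S X" "smooth_on S Y"
  shows "FD (\<lambda>x. B x (X x) (Y x)) x v =
    FD (\<lambda>x'. B x' (X x) (Y x)) x v + B x (FD X x v) (Y x) + B x (X x) (FD Y x v)"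
proof -
  have 1: "smooth_on S (\<lambda>x. B x (X x) w)" for w
    by (rule smooth_on_linear_family[where L = "\<lambda>x u. B x u w"])
      (use assms in \<open>auto simp: bilinear_def\<close>)
  have "FD (\<lambda>x. B x (X x) (Y x)) x v = FD (\<lambda>x'. B x' (X x') (Y x)) x v + B x (X x) (FD Y x v)"
    by (rule FD_linear_family[where L = "\<lambda>x. B x (X x)", OF assms(1,2) _ 1 assms(6)])
      (use lin in \<open>auto simp: bilinear_def\<close>)
  also have "FD (\<lambda>x'. B x' (X x') (Y x)) x v = FD (\<lambda>x'. B x' (X x) (Y x)) x v + B x (FD X x v) (Y x)"
    by (rule FD_linear_family[where L = "\<lambda>x' u. B x' u (Y x)", OF assms(1,2) _ B assms(5)])
      (use lin in \<open>auto simp: bilinear_def\<close>)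
  finally show ?thesis by simp
qed

lemma FD_add:
  assumes "f differentiable (at x)" "g differentiable (at x)"
  shows "FD (\<lambda>x. f x + g x) x v = FD f x v + FD g x v"
  using assms[unfolded frechet_derivative_works] FD_eqI[OF has_derivative_add[of f "FD f x" "at x" g "FD g x"]]
  by simp

lemma FD_diff:
  assumes "f differentiable (at x)" "g differentiable (at x)"
  shows "FD (\<lambda>x. f x - g x) x v = FD f x v - FD g x v"
  using assms[unfolded frechet_derivative_works] FD_eqI[OF has_derivative_diff[of f "FD f x" "at x" g "FD g x"]]
  by simp

text \<open>The curvature tensor on constant coordinate fields; their Lie brackets vanish.\<close>

definition local_curvature :: "('e::euclidean_space \<Rightarrow> 'e \<Rightarrow> 'e \<Rightarrow> real) \<Rightarrow> 'e \<Rightarrow> 'e \<Rightarrow> 'e \<Rightarrow> 'e \<Rightarrow> 'e" where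
  "local_curvature G z u v x =
     FD (\<lambda>y. christoffel G y v x) z u + christoffel G z u (christoffel G z v x)
     - (FD (\<lambda>y. christoffel G y u x) z v + christoffel G z v (christoffel G z u x))"

text \<open>The covariant derivative, in the direction \<open>a\<close>, of a vector field \<open>X\<close> along the map \<open>f\<close>. With it the Gauss formula
  and the Gauss equation can be computed on the parameter domain, without extending tangent fields
  to the ambient space.\<close>

definition cov_along :: "('e::euclidean_space \<Rightarrow> 'e \<Rightarrow> 'e \<Rightarrow> real) \<Rightarrow> ('v::euclidean_space \<Rightarrow> 'e) \<Rightarrow>
    ('v \<Rightarrow> 'e) \<Rightarrow> 'v \<Rightarrow> 'v \<Rightarrow> 'e" where
  "cov_along G f X w a = FD X w a + christoffel G (f w) (FD f w a) (X w)"

locale local_metric =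
  fixes Z :: "'e::euclidean_space set" and G :: "'e \<Rightarrow> 'e \<Rightarrow> 'e \<Rightarrow> real"
  assumes open_Z: "open Z"
    and bilinear_G: "z \<in> Z \<Longrightarrow> bilinear (G z)"
    and sym_G: "z \<in> Z \<Longrightarrow> G z u v = G z v u"
    and pos_G: "z \<in> Z \<Longrightarrow> u \<noteq> 0 \<Longrightarrow> G z u u > 0"
    and smooth_G: "smooth_on Z (\<lambda>z. G z u v)"
begin

lemma G_simps:
  assumes "z \<in> Z"
  shows "G z (u + v) w = G z u w + G z v w" "G z u (v + w) = G z u v + G z u w"
    "G z (u - v) w = G z u w - G z v w" "G z u (v - w) = G z u v - G z u w"
    "G z (a *\<^sub>R u) w = a * G z u w" "G z u (a *\<^sub>R w) = a * G z u w"
    "G z 0 w = 0" "G z u 0 = 0"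
  using bilinear_G[OF assms]
  by (simp_all add: bilinear_ladd bilinear_radd bilinear_lsub bilinear_rsub bilinear_lmul bilinear_rmul
      bilinear_lzero bilinear_rzero)

lemma linear_G: "z \<in> Z \<Longrightarrow> linear (G z u)" "z \<in> Z \<Longrightarrow> linear (\<lambda>u. G z u v)"
  using bilinear_G by (auto simp: bilinear_def)

lemma G_nondegenerate:
  assumes "z \<in> Z" "\<And>k. G z u k = G z v k"
  shows "u = v"
proof (rule ccontr)
  assume "u \<noteq> v"
  then have "G z (u - v) (u - v) > 0" using pos_G[OF assms(1), of "u - v"] by simp
  then show False using assms by (simp add: G_simps)
qed

text \<open>The vector that represents the functional \<open>G z w\<close> in the standard inner product; with this
  operator the definition of Christoffel symbols becomes a linear system.\<close>

definition gram :: "'e \<Rightarrow> 'e \<Rightarrow> 'e" where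
  "gram z w = (\<Sum>k\<in>Basis. G z w k *\<^sub>R k)"

lemma gram_inner: "z \<in> Z \<Longrightarrow> gram z w \<bullet> v = G z w v"
  unfolding gram_def
  using linear_basis_expansion[OF linear_G(1), of z w v]
  by (simp add: inner_sum_left inner_commute[of v] mult.commute)

lemma linear_gram: "z \<in> Z \<Longrightarrow> linear (gram z)"
  unfolding gram_def
  by (rule linearI) (simp_all add: G_simps scaleR_add_left sum.distrib scaleR_sum_right)

lemma inj_gram: assumes z: "z \<in> Z" shows "inj (gram z)"
proof (rule injI)
  fix u v assume "gram z u = gram z v"
  then have "G z u k = G z v k" for k using gram_inner[OF z] by metis
  then show "u = v" by (rule G_nondegenerate[OF z])
qed

lemma G_represent:
  assumes z: "z \<in> Z" and l: "linear l"
  shows "\<exists>w. \<forall>k. G z w k = l k"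
proof -
  have "surj (gram z)"
    using linear_gram[OF z] inj_gram[OF z] linear_injective_imp_surjective by blast
  then obtain w where w: "gram z w = (\<Sum>k\<in>Basis. l k *\<^sub>R k)" by (metis surjD)
  have "G z w k = l k" for k
    using linear_basis_expansion[OF l, of k]
    by (simp add: gram_inner[OF z, symmetric] w inner_sum_left inner_commute[of k] mult.commute)
  then show ?thesis by blast
qed

lemma linear_FD_G:
  assumes z: "z \<in> Z"
  shows "linear (\<lambda>k. FD (\<lambda>y. G y u v) z k)" "linear (\<lambda>u. FD (\<lambda>y. G y u v) z k)"
    "linear (\<lambda>v. FD (\<lambda>y. G y u v) z k)"
proof -
  show "linear (\<lambda>k. FD (\<lambda>y. G y u v) z k)"
    using smooth_on_linear_FD[OF smooth_G z] by simp
  have d: "(\<lambda>y. G y u v) differentiable (at z)" for u v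
    by (rule smooth_on_differentiable[OF smooth_G z])
  have add: "FD (\<lambda>y. G y (u + u') v) z k = FD (\<lambda>y. G y u v) z k + FD (\<lambda>y. G y u' v) z k" for u u' v
    using FD_cong_open[OF d open_Z z, of _ _ "\<lambda>y. G y u v + G y u' v"] FD_add[OF d d]
    by (simp add: G_simps)
  have add2: "FD (\<lambda>y. G y u (v + v')) z k = FD (\<lambda>y. G y u v) z k + FD (\<lambda>y. G y u v') z k" for u v v'
    using FD_cong_open[OF d open_Z z, of _ _ "\<lambda>y. G y u v + G y u v'"] FD_add[OF d d]
    by (simp add: G_simps)
  have sc: "FD (\<lambda>y. c * G y u v) z k = c * FD (\<lambda>y. G y u v) z k" for c u v
    by (rule fun_cong[OF FD_eqI[OF has_derivative_mult_right], of _ "FD (\<lambda>y. G y u v) z"])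
      (use d in \<open>simp add: frechet_derivative_works\<close>)
  have mul: "FD (\<lambda>y. G y (c *\<^sub>R u) v) z k = c * FD (\<lambda>y. G y u v) z k" for c u v
    using FD_cong_open[OF d open_Z z, of _ _ "\<lambda>y. c * G y u v"] sc by (simp add: G_simps)
  have mul2: "FD (\<lambda>y. G y u (c *\<^sub>R v)) z k = c * FD (\<lambda>y. G y u v) z k" for c u v
    using FD_cong_open[OF d open_Z z, of _ _ "\<lambda>y. c * G y u v"] sc by (simp add: G_simps)
  show "linear (\<lambda>u. FD (\<lambda>y. G y u v) z k)" by (rule linearI) (simp_all add: add mul)
  show "linear (\<lambda>v. FD (\<lambda>y. G y u v) z k)" by (rule linearI) (simp_all add: add2 mul2)
qed

text \<open>The right side is linear in \<open>k\<close> and the metric is nondegenerate, so the vector in the definition exists and is unique.\<close>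

lemma christoffel_eq:
  assumes z: "z \<in> Z"
  shows "2 * G z (christoffel G z u v) k =
     FD (\<lambda>y. G y v k) z u + FD (\<lambda>y. G y u k) z v - FD (\<lambda>y. G y u v) z k"
proof -
  let ?l = "\<lambda>k. (FD (\<lambda>y. G y v k) z u + FD (\<lambda>y. G y u k) z v - FD (\<lambda>y. G y u v) z k) / 2"
  have "linear ?l"
    by (rule linearI)
      (simp_all add: linear_add[OF linear_FD_G(1)[OF z]] linear_add[OF linear_FD_G(3)[OF z]]
        linear_cmul[OF linear_FD_G(1)[OF z]] linear_cmul[OF linear_FD_G(3)[OF z]] field_simps)
  then obtain w where w: "\<forall>k. G z w k = ?l k" using G_represent[OF z] by blast
  let ?P = "\<lambda>w. \<forall>k. 2 * G z w k =
     FD (\<lambda>y. G y v k) z u + FD (\<lambda>y. G y u k) z v - FD (\<lambda>y. G y u v) z k"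
  have "?P w"
  proof
    show "2 * G z w k = FD (\<lambda>y. G y v k) z u + FD (\<lambda>y. G y u k) z v - FD (\<lambda>y. G y u v) z k" for k
      unfolding spec[OF w, of k] by simp
  qed
  moreover have "w' = w" if "?P w'" for w'
  proof (rule G_nondegenerate[OF z])
    show "G z w' k = G z w k" for k using spec[OF that, of k] spec[OF w, of k] by simp
  qed
  ultimately have "?P (christoffel G z u v)"
    unfolding christoffel_def by (rule theI)
  then show ?thesis by blast
qed

lemma christoffel_eqI:
  assumes z: "z \<in> Z" and "\<And>k. 2 * G z w k =
     FD (\<lambda>y. G y v k) z u + FD (\<lambda>y. G y u k) z v - FD (\<lambda>y. G y u v) z k"
  shows "christoffel G z u v = w"
proof (rule G_nondegenerate[OF z])
  show "G z (christoffel G z u v) k = G z w k" for k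
    using assms(2)[of k] christoffel_eq[OF z, of u v k] by simp
qed

lemma FD_G_sym: "z \<in> Z \<Longrightarrow> FD (\<lambda>y. G y u v) z k = FD (\<lambda>y. G y v u) z k"
  using FD_cong_open[OF smooth_on_differentiable[OF smooth_G] open_Z, of z u v "\<lambda>y. G y v u"] sym_G by simp

lemma christoffel_sym: "z \<in> Z \<Longrightarrow> christoffel G z u v = christoffel G z v u"
  by (rule christoffel_eqI) (simp_all add: christoffel_eq FD_G_sym[of z u v])

lemma linear_christoffel: assumes z: "z \<in> Z" shows "linear (christoffel G z u)"
proof (rule linearI)
  show "christoffel G z u (v + v') = christoffel G z u v + christoffel G z u v'" for v v'
    by (rule christoffel_eqI[OF z])
      (simp add: G_simps[OF z] distrib_left christoffel_eq[OF z] linear_add[OF linear_FD_G(1)[OF z]]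
        linear_add[OF linear_FD_G(2)[OF z]] linear_add[OF linear_FD_G(3)[OF z]])
  show "christoffel G z u (c *\<^sub>R v) = c *\<^sub>R christoffel G z u v" for c v
    by (rule christoffel_eqI[OF z])
      (simp add: G_simps[OF z] mult.left_commute[of 2] christoffel_eq[OF z] linear_cmul[OF linear_FD_G(1)[OF z]]
        linear_cmul[OF linear_FD_G(2)[OF z]] linear_cmul[OF linear_FD_G(3)[OF z]] algebra_simps)
qed

lemma bilinear_christoffel: assumes z: "z \<in> Z" shows "bilinear (christoffel G z)"
proof -
  have "(\<lambda>u. christoffel G z u v) = christoffel G z v" for v
    by (rule ext) (rule christoffel_sym[OF z])
  then show ?thesis unfolding bilinear_def using linear_christoffel[OF z] by simp
qed

lemma christoffel_simps:
  assumes "z \<in> Z"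
  shows "christoffel G z (u + v) w = christoffel G z u w + christoffel G z v w"
    "christoffel G z u (v + w) = christoffel G z u v + christoffel G z u w"
    "christoffel G z 0 w = 0" "christoffel G z u 0 = 0"
  using bilinear_christoffel[OF assms]
  by (simp_all add: bilinear_ladd bilinear_radd bilinear_lzero bilinear_rzero)

lemma smooth_christoffel: "smooth_on Z (\<lambda>z. christoffel G z u v)"
proof (rule smooth_on_linear_system[where L = "\<lambda>z w. \<Sum>k\<in>Basis. G z w k *\<^sub>R k" and
      b = "\<lambda>z. \<Sum>k\<in>Basis. ((FD (\<lambda>y. G y v k) z u + FD (\<lambda>y. G y u k) z v - FD (\<lambda>y. G y u v) z k) * (1/2)) *\<^sub>R k"])
  show "smooth_on Z (\<lambda>z. \<Sum>k\<in>Basis. G z w k *\<^sub>R k)" for w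
    by (intro smooth_on_sum smooth_on_linear[OF _ bounded_linear_scaleR_left] open_Z smooth_G)
  show "smooth_on Z (\<lambda>z. \<Sum>k\<in>Basis. ((FD (\<lambda>y. G y v k) z u + FD (\<lambda>y. G y u k) z v - FD (\<lambda>y. G y u v) z k) * (1/2)) *\<^sub>R k)"
    by (intro smooth_on_sum smooth_on_linear[OF _ bounded_linear_scaleR_left] open_Z
        smooth_on_linear[OF _ bounded_linear_mult_left] smooth_on_diff smooth_on_add smooth_on_FD smooth_G)
  show "inj (\<lambda>w. \<Sum>k\<in>Basis. G z w k *\<^sub>R k)" "linear (\<lambda>w. \<Sum>k\<in>Basis. G z w k *\<^sub>R k)" if "z \<in> Z" for z
    using inj_gram[OF that] linear_gram[OF that] unfolding gram_def by auto
  show "(\<Sum>k\<in>Basis. G z (christoffel G z u v) k *\<^sub>R k) =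
    (\<Sum>k\<in>Basis. ((FD (\<lambda>y. G y v k) z u + FD (\<lambda>y. G y u k) z v - FD (\<lambda>y. G y u v) z k) * (1/2)) *\<^sub>R k)"
    if "z \<in> Z" for z
    unfolding christoffel_eq[OF that, symmetric] by simp
qed (rule open_Z)

text \<open>Adding the defining equations for \<open>(k, u, v)\<close> and \<open>(k, v, u)\<close> cancels all derivatives except one.\<close>

lemma metric_compatible:
  assumes z: "z \<in> Z"
  shows "FD (\<lambda>y. G y u v) z k = G z (christoffel G z k u) v + G z u (christoffel G z k v)"
  using christoffel_eq[OF z, of k u v] christoffel_eq[OF z, of k v u]
    sym_G[OF z, of u "christoffel G z k v"] FD_G_sym[OF z, of u v k] by simp

lemma cov_along_metric:
  fixes f :: "'v::euclidean_space \<Rightarrow> 'e"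
  assumes W: "open W" "w \<in> W" and f: "smooth_on W f" "f ` W \<subseteq> Z" and X: "smooth_on W X" and Y: "smooth_on W Y"
  shows "FD (\<lambda>w. G (f w) (X w) (Y w)) w a
    = G (f w) (cov_along G f X w a) (Y w) + G (f w) (X w) (cov_along G f Y w a)"
proof -
  have z: "f w \<in> Z" using W f by auto
  have "FD (\<lambda>w. G (f w) (X w) (Y w)) w a
     = FD (\<lambda>w'. G (f w') (X w) (Y w)) w a + G (f w) (FD X w a) (Y w) + G (f w) (X w) (FD Y w a)"
    by (rule FD_bilinear_family[where B = "\<lambda>w. G (f w)", OF W _ _ X Y])
      (use f bilinear_G in \<open>auto intro!: smooth_on_compose[OF W(1) open_Z f(2) smooth_G f(1)]\<close>)
  also have "FD (\<lambda>w'. G (f w') (X w) (Y w)) w a = FD (\<lambda>z. G z (X w) (Y w)) (f w) (FD f w a)"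
    by (rule FD_compose[OF smooth_on_has_derivative[OF f(1) W(2)] smooth_on_has_derivative[OF smooth_G z]])
  finally show ?thesis
    by (simp add: cov_along_def G_simps[OF z] metric_compatible[OF z])
qed

lemma smooth_cov_along:
  fixes f :: "'v::euclidean_space \<Rightarrow> 'e"
  assumes W: "open W" and f: "smooth_on W f" "f ` W \<subseteq> Z" and X: "smooth_on W X"
  shows "smooth_on W (\<lambda>w. cov_along G f X w a)"
  unfolding cov_along_def
proof (rule smooth_on_add[OF W smooth_on_FD[OF X]])
  show "smooth_on W (\<lambda>w. christoffel G (f w) (FD f w a) (X w))"
    by (rule smooth_on_bilinear_family[where B = "\<lambda>w. christoffel G (f w)", OF W _ _ smooth_on_FD[OF f(1)] X])
      (use f bilinear_christoffel in \<open>auto intro!: smooth_on_compose[OF W open_Z f(2) smooth_christoffel f(1)]\<close>)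
qed

text \<open>Second derivatives of \<open>X\<close> and of \<open>f\<close> are symmetric and cancel; only derivatives of the Christoffel symbols and
  their products remain.\<close>

lemma cov_along_commutator:
  fixes f :: "'v::euclidean_space \<Rightarrow> 'e"
  assumes W: "open W" "w \<in> W" and f: "smooth_on W f" "f ` W \<subseteq> Z" and X: "smooth_on W X"
  shows "cov_along G f (\<lambda>w. cov_along G f X w b) w a - cov_along G f (\<lambda>w. cov_along G f X w a) w b
    = local_curvature G (f w) (FD f w a) (FD f w b) (X w)"
proof -
  have z: "f w \<in> Z" using W f by auto
  have d: "FD (\<lambda>w. cov_along G f X w b) w a = FD (\<lambda>w. FD X w b) w a
      + (FD (\<lambda>z. christoffel G z (FD f w b) (X w)) (f w) (FD f w a)
      + christoffel G (f w) (FD (\<lambda>w. FD f w b) w a) (X w) + christoffel G (f w) (FD f w b) (FD X w a))" for a b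
  proof -
    have c1: "smooth_on W (\<lambda>w. christoffel G (f w) u v)" for u v
      by (rule smooth_on_compose[OF W(1) open_Z f(2) smooth_christoffel f(1)])
    have b1: "bilinear (christoffel G (f w))" if "w \<in> W" for w
      using bilinear_christoffel f(2) that by auto
    have s: "smooth_on W (\<lambda>w. christoffel G (f w) (FD f w b) (X w))"
      by (rule smooth_on_bilinear_family[where B = "\<lambda>w. christoffel G (f w)", OF W(1) b1 c1 smooth_on_FD[OF f(1)] X])
    have "FD (\<lambda>w. cov_along G f X w b) w a
      = FD (\<lambda>w. FD X w b) w a + FD (\<lambda>w. christoffel G (f w) (FD f w b) (X w)) w a"
      unfolding cov_along_def
      by (rule FD_add[OF smooth_on_differentiable[OF smooth_on_FD[OF X] W(2)] smooth_on_differentiable[OF s W(2)]])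
    also have "FD (\<lambda>w. christoffel G (f w) (FD f w b) (X w)) w a
      = FD (\<lambda>w'. christoffel G (f w') (FD f w b) (X w)) w a
      + christoffel G (f w) (FD (\<lambda>w. FD f w b) w a) (X w) + christoffel G (f w) (FD f w b) (FD X w a)"
      by (rule FD_bilinear_family[where B = "\<lambda>w. christoffel G (f w)", OF W b1 c1 smooth_on_FD[OF f(1)] X])
    also have "FD (\<lambda>w'. christoffel G (f w') (FD f w b) (X w)) w a
      = FD (\<lambda>z. christoffel G z (FD f w b) (X w)) (f w) (FD f w a)"
      by (rule FD_compose[OF smooth_on_has_derivative[OF f(1) W(2)] smooth_on_has_derivative[OF smooth_christoffel z]])
    finally show ?thesis .
  qed
  have "FD (\<lambda>w. FD X w b) w a = FD (\<lambda>w. FD X w a) w b"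
    by (rule second_derivative_symmetric[OF W(1) X W(2)])
  moreover have "FD (\<lambda>w. FD f w b) w a = FD (\<lambda>w. FD f w a) w b"
    by (rule second_derivative_symmetric[OF W(1) f(1) W(2)])
  ultimately show ?thesis
    unfolding cov_along_def[of G f "\<lambda>w. cov_along G f X w _"] d
    by (simp add: local_curvature_def cov_along_def christoffel_simps[OF z])
qed

end

text \<open>Both inclusions of submanifolds and changes of charts are isometric immersions in this sense. Injectivity of the
  derivative is implied by the positivity of the induced metric.\<close>

locale isometric_immersion = amb: local_metric Z G + ind: local_metric W G'
  for Z :: "'e::euclidean_space set" and G and W :: "'v::euclidean_space set" and G' +
  fixes f :: "'v \<Rightarrow> 'e"
  assumes smooth_f: "smooth_on W f" and f_in: "f ` W \<subseteq> Z"
    and induced: "w \<in> W \<Longrightarrow> G' w a b = G (f w) (FD f w a) (FD f w b)"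
begin

lemma f_Z: "w \<in> W \<Longrightarrow> f w \<in> Z" using f_in by auto

text \<open>The derivative of the coordinate tangent field \<open>Df b\<close> along the immersion.\<close>

definition hess :: "'v \<Rightarrow> 'v \<Rightarrow> 'v \<Rightarrow> 'e" where
  "hess w a b = cov_along G f (\<lambda>w. FD f w b) w a"

lemma hess_sym: "w \<in> W \<Longrightarrow> hess w a b = hess w b a"
  unfolding hess_def cov_along_def
  using second_derivative_symmetric[OF ind.open_Z smooth_f] amb.christoffel_sym[OF f_Z] by metis

lemma FD_induced:
  assumes w: "w \<in> W"
  shows "FD (\<lambda>w. G' w b c) w a = G (f w) (hess w a b) (FD f w c) + G (f w) (FD f w b) (hess w a c)"
proof -
  have "FD (\<lambda>w. G' w b c) w = FD (\<lambda>w. G (f w) (FD f w b) (FD f w c)) w"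
    by (rule FD_cong_open[OF smooth_on_differentiable[OF ind.smooth_G w] ind.open_Z w]) (rule induced)
  then show ?thesis
    unfolding hess_def
    using amb.cov_along_metric[OF ind.open_Z w smooth_f f_in smooth_on_FD[OF smooth_f] smooth_on_FD[OF smooth_f]]
    by simp
qed

text \<open>In the Koszul formula for the induced metric, metric compatibility expands every derivative into two terms; by the
  symmetry of \<open>hess\<close> four of the six cancel.\<close>

lemma gauss_formula:
  assumes w: "w \<in> W"
  shows "G (f w) (hess w a b) (FD f w k) = G' w (christoffel G' w a b) k"
proof -
  have "2 * G' w (christoffel G' w a b) k = 2 * G (f w) (hess w a b) (FD f w k)"
    unfolding ind.christoffel_eq[OF w] FD_induced[OF w]
    using hess_sym[OF w, of a b] hess_sym[OF w, of a k] hess_sym[OF w, of b k]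
      amb.sym_G[OF f_Z[OF w], of "FD f w b"] amb.sym_G[OF f_Z[OF w], of "FD f w a"] by simp
  then show ?thesis by simp
qed

text \<open>By the Gauss formula the subtracted vector is the tangential part.\<close>

definition sff :: "'v \<Rightarrow> 'v \<Rightarrow> 'v \<Rightarrow> 'e" where
  "sff w a b = hess w a b - FD f w (christoffel G' w a b)"

lemma sff_normal: "w \<in> W \<Longrightarrow> G (f w) (sff w a b) (FD f w k) = 0"
  unfolding sff_def amb.G_simps(3)[OF f_Z] gauss_formula by (simp add: induced)

lemma sff_sym: "w \<in> W \<Longrightarrow> sff w a b = sff w b a"
  unfolding sff_def using hess_sym[of w a b] ind.christoffel_sym[of w a b] by simp

lemma linear_f': "w \<in> W \<Longrightarrow> linear (FD f w)"
  by (rule smooth_on_linear_FD[OF smooth_f])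

lemma bilinear_hess: assumes w: "w \<in> W" shows "bilinear (hess w)"
proof -
  have 1: "linear (\<lambda>a. hess w a b)" for b
  proof -
    have l1: "linear (FD (\<lambda>w. FD f w b) w)" by (rule smooth_on_linear_FD[OF smooth_on_FD[OF smooth_f] w])
    have l2: "linear (\<lambda>u. christoffel G (f w) u (FD f w b))"
      using amb.bilinear_christoffel[OF f_Z[OF w]] by (simp add: bilinear_def)
    have l3: "linear (\<lambda>a. christoffel G (f w) (FD f w a) (FD f w b))"
      using linear_compose[OF linear_f'[OF w] l2] by (simp add: o_def)
    show ?thesis unfolding hess_def cov_along_def by (rule linear_compose_add[OF l1 l3])
  qed
  have 2: "hess w b = (\<lambda>a. hess w a b)" for b by (rule ext) (rule hess_sym[OF w])
  have "linear (hess w b)" for b by (subst 2) (rule 1)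
  then show ?thesis unfolding bilinear_def using 1 by blast
qed

lemma bilinear_sff: assumes w: "w \<in> W" shows "bilinear (sff w)"
proof -
  have 1: "linear (sff w a)" for a
  proof -
    have "linear (\<lambda>b. FD f w (christoffel G' w a b))"
      using linear_compose[OF ind.linear_christoffel[OF w] linear_f'[OF w]] by (simp add: o_def)
    then show ?thesis unfolding sff_def
      using bilinear_hess[OF w] linear_compose_sub[of "hess w a"] by (simp add: bilinear_def)
  qed
  have "(\<lambda>a. sff w a b) = sff w b" for b by (rule ext) (rule sff_sym[OF w])
  then show ?thesis unfolding bilinear_def using 1 by simp
qed

text \<open>Differentiating the inner product of \<open>hess w b c\<close> with a tangent vector compares the second covariant derivatives of the
  ambient space and of the induced metric. They differ by a product of two first covariant derivatives, whose normal parts are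
  the second fundamental forms; antisymmetrizing in \<open>a\<close> and \<open>b\<close> turns second derivatives into curvatures.\<close>

theorem gauss_equation:
  assumes w: "w \<in> W"
  shows "G (f w) (local_curvature G (f w) (FD f w a) (FD f w b) (FD f w c)) (FD f w d)
    = G' w (local_curvature G' w a b c) d
      - (G (f w) (sff w b c) (sff w a d) - G (f w) (sff w a c) (sff w b d))"
proof -
  note z = f_Z[OF w]
  have sc: "smooth_on W (\<lambda>w. FD f w c)" for c by (rule smooth_on_FD[OF smooth_f])
  have sh: "smooth_on W (\<lambda>w. hess w a b)" for a b
    unfolding hess_def by (rule amb.smooth_cov_along[OF ind.open_Z smooth_f f_in sc])
  have split: "hess w a b = FD f w (christoffel G' w a b) + sff w a b" for a b
    by (simp add: sff_def)
  have hh: "G (f w) (hess w b c) (hess w a d)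
      = G' w (christoffel G' w b c) (christoffel G' w a d) + G (f w) (sff w b c) (sff w a d)" for a b c d
    unfolding split
    by (simp add: amb.G_simps[OF z] sff_normal[OF w] induced[OF w] amb.sym_G[OF z, of "FD f w _" "sff w _ _"])
  have amb2: "G (f w) (cov_along G f (\<lambda>w. hess w b c) w a) (FD f w d)
      = FD (\<lambda>w. G' w (christoffel G' w b c) d) w a - G (f w) (hess w b c) (hess w a d)" for a b
  proof -
    have "FD (\<lambda>w. G (f w) (hess w b c) (FD f w d)) w a
      = G (f w) (cov_along G f (\<lambda>w. hess w b c) w a) (FD f w d) + G (f w) (hess w b c) (hess w a d)"
      unfolding hess_def[of _ _ d]
      by (rule amb.cov_along_metric[OF ind.open_Z w smooth_f f_in sh sc])
    moreover have "FD (\<lambda>w. G (f w) (hess w b c) (FD f w d)) w = FD (\<lambda>w. G' w (christoffel G' w b c) d) w"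
    proof (rule FD_cong_open[OF _ ind.open_Z w gauss_formula])
      show "(\<lambda>w. G (f w) (hess w b c) (FD f w d)) differentiable at w"
        by (rule smooth_on_differentiable[OF _ w],
            rule smooth_on_bilinear_family[where B = "\<lambda>w. G (f w)", OF ind.open_Z _ _ sh sc])
          (use f_Z amb.bilinear_G in \<open>auto intro!: smooth_on_compose[OF ind.open_Z amb.open_Z f_in amb.smooth_G smooth_f]\<close>)
    qed
    ultimately show ?thesis by simp
  qed
  have ind2: "G' w (FD (\<lambda>w. christoffel G' w b c) w a + christoffel G' w a (christoffel G' w b c)) d
      = FD (\<lambda>w. G' w (christoffel G' w b c) d) w a - G' w (christoffel G' w b c) (christoffel G' w a d)" for a b
  proof -
    have "FD (\<lambda>w. G' w (christoffel G' w b c) d) w a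
      = G' w (cov_along G' (\<lambda>w. w) (\<lambda>w. christoffel G' w b c) w a) d
        + G' w (christoffel G' w b c) (cov_along G' (\<lambda>w. w) (\<lambda>w. d) w a)"
      by (rule ind.cov_along_metric[where f = "\<lambda>w. w", OF ind.open_Z w smooth_on_ident[OF ind.open_Z] _
            ind.smooth_christoffel smooth_on_const[OF ind.open_Z]]) simp
    then show ?thesis by (simp add: cov_along_def)
  qed
  have "G (f w) (local_curvature G (f w) (FD f w a) (FD f w b) (FD f w c)) (FD f w d)
     = G (f w) (cov_along G f (\<lambda>w. hess w b c) w a) (FD f w d) - G (f w) (cov_along G f (\<lambda>w. hess w a c) w b) (FD f w d)"
    unfolding hess_def
    by (subst amb.cov_along_commutator[OF ind.open_Z w smooth_f f_in sc, symmetric]) (simp add: amb.G_simps[OF z])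
  also have "\<dots> = G' w (local_curvature G' w a b c) d
      - (G (f w) (sff w b c) (sff w a d) - G (f w) (sff w a c) (sff w b d))"
    unfolding amb2 hh local_curvature_def ind.G_simps(3)[OF w] ind2 by simp
  finally show ?thesis .
qed

end

section \<open>The Levi-Civita connection in charts\<close>

lemma
  assumes "is_chart X c"
  shows is_chart_openin: "openin X (fst c)"
    and is_chart_open: "open (snd c ` fst c)"
    and is_chart_inj: "inj_on (snd c) (fst c)"
proof -
  show o: "openin X (fst c)" "open (snd c ` fst c)" using assms by (auto simp: is_chart_def)
  have "topspace (subtopology X (fst c)) = fst c"
    using openin_subset[OF o(1)] by auto
  then show "inj_on (snd c) (fst c)"
    using assms homeomorphic_imp_injective_map unfolding is_chart_def by metis
qed

lemma pt_coord: "is_chart X c \<Longrightarrow> q \<in> fst c \<Longrightarrow> pt c (snd c q) = q"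
  unfolding pt_def by (rule inv_into_f_f[OF is_chart_inj])

lemma coord_pt: "z \<in> snd c ` fst c \<Longrightarrow> snd c (pt c z) = z"
  unfolding pt_def by (rule f_inv_into_f)

lemma pt_in: "z \<in> snd c ` fst c \<Longrightarrow> pt c z \<in> fst c"
  unfolding pt_def by (rule inv_into_into)

lemma coord_image_open:
  assumes c: "is_chart X c" and U: "openin X U"
  shows "open (snd c ` (fst c \<inter> U))"
proof -
  have "openin (subtopology X (fst c)) (fst c \<inter> U)"
    using U by (simp add: openin_subtopology_Int2)
  moreover have "open_map (subtopology X (fst c)) (top_of_set (snd c ` fst c)) (snd c)"
    using c homeomorphic_imp_open_map unfolding is_chart_def by metis
  ultimately have "openin (top_of_set (snd c ` fst c)) (snd c ` (fst c \<inter> U))"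
    by (simp add: open_map_def)
  then show ?thesis using is_chart_open[OF c] by (simp add: openin_open_eq)
qed

text \<open>The change of components of a tangent vector at \<open>q\<close> from the chart \<open>c\<close> to the chart \<open>d\<close>. The charts may be modelled on
  different spaces: from a chart of a submanifold to one of the ambient manifold this is the derivative of the inclusion.\<close>

definition Dtr :: "('a, 'e::euclidean_space) chart \<Rightarrow> ('a, 'f::euclidean_space) chart \<Rightarrow> 'a \<Rightarrow> 'e \<Rightarrow> 'f" where
  "Dtr c d q = FD (snd d \<circ> pt c) (snd c q)"

lemma to_chart_eq: "to_chart M c q = Dtr (chart_at M q) c q"
  by (simp add: to_chart_def Dtr_def)

lemma from_chart_eq: "from_chart M c q = Dtr c (chart_at M q) q"
  by (simp add: from_chart_def Dtr_def)

lemma chart_at_in: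
  assumes "c \<in> atlas M" "q \<in> fst c"
  shows "chart_at M q \<in> atlas M" "q \<in> fst (chart_at M q)"
proof -
  have "\<exists>c. c \<in> atlas M \<and> q \<in> fst c" using assms by blast
  from someI_ex[OF this] show "chart_at M q \<in> atlas M" "q \<in> fst (chart_at M q)"
    by (simp_all add: chart_at_def)
qed

lemma local_metric_subset:
  assumes "local_metric Z G" "open W" "W \<subseteq> Z"
  shows "local_metric W G"
proof -
  interpret local_metric Z G by (rule assms(1))
  show ?thesis
    by unfold_locales
      (use assms(2,3) bilinear_G sym_G pos_G smooth_on_mono[OF smooth_G assms(3)] in auto)
qed

locale chart_atlas =
  fixes M :: "('a, 'e::euclidean_space) manifold"
  assumes chart: "c \<in> atlas M \<Longrightarrow> is_chart (mtop M) c"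
    and smooth_transition: "c \<in> atlas M \<Longrightarrow> d \<in> atlas M \<Longrightarrow>
      smooth_on (snd c ` (fst c \<inter> fst d)) (snd d \<circ> pt c)"
begin

lemma open_overlap: "c \<in> atlas M \<Longrightarrow> d \<in> atlas M \<Longrightarrow> open (snd c ` (fst c \<inter> fst d))"
  by (rule coord_image_open[OF chart is_chart_openin[OF chart]])

lemma transition_has_derivative:
  assumes "c \<in> atlas M" "d \<in> atlas M" "q \<in> fst c" "q \<in> fst d"
  shows "((snd d \<circ> pt c) has_derivative Dtr c d q) (at (snd c q))"
  unfolding Dtr_def
  by (rule smooth_on_has_derivative[OF smooth_transition[OF assms(1,2)]]) (use assms in auto)

lemma linear_Dtr:
  "c \<in> atlas M \<Longrightarrow> d \<in> atlas M \<Longrightarrow> q \<in> fst c \<Longrightarrow> q \<in> fst d \<Longrightarrow> linear (Dtr c d q)"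
  by (rule has_derivative_linear[OF transition_has_derivative])

lemma Dtr_chain:
  assumes c: "c \<in> atlas M" "q \<in> fst c" and d: "d \<in> atlas M" "q \<in> fst d" and e: "e \<in> atlas M" "q \<in> fst e"
  shows "Dtr d e q (Dtr c d q u) = Dtr c e q u"
proof -
  have pc: "(snd d \<circ> pt c) (snd c q) = snd d q" by (simp add: pt_coord[OF chart[OF c(1)] c(2)])
  have "((snd e \<circ> pt d) \<circ> (snd d \<circ> pt c) has_derivative Dtr d e q \<circ> Dtr c d q) (at (snd c q))"
    by (rule diff_chain_at[OF transition_has_derivative[OF c(1) d(1) c(2) d(2)]])
      (use transition_has_derivative[OF d(1) e(1) d(2) e(2)] pc in simp)
  then have "((snd e \<circ> pt c) has_derivative Dtr d e q \<circ> Dtr c d q) (at (snd c q))"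
  proof (rule has_derivative_transform_within_open)
    show "open (snd c ` (fst c \<inter> fst d))" by (rule open_overlap[OF c(1) d(1)])
    show "snd c q \<in> snd c ` (fst c \<inter> fst d)" using c d by auto
    show "((snd e \<circ> pt d) \<circ> (snd d \<circ> pt c)) z = (snd e \<circ> pt c) z" if "z \<in> snd c ` (fst c \<inter> fst d)" for z
      using that by (auto simp: pt_coord[OF chart[OF c(1)]] pt_coord[OF chart[OF d(1)]])
  qed
  from has_derivative_unique[OF this transition_has_derivative[OF c(1) e(1) c(2) e(2)]]
  show ?thesis by (metis comp_apply)
qed

lemma Dtr_same:
  assumes c: "c \<in> atlas M" "q \<in> fst c"
  shows "Dtr c c q u = u"
proof -
  have "((snd c \<circ> pt c) has_derivative (\<lambda>u. u)) (at (snd c q))"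
    by (rule has_derivative_transform_within_open[OF has_derivative_ident is_chart_open[OF chart[OF c(1)]]])
      (use c in \<open>auto simp: coord_pt\<close>)
  then show ?thesis unfolding Dtr_def by (simp add: FD_eqI)
qed

lemma Dtr_inverse:
  assumes "c \<in> atlas M" "q \<in> fst c" "d \<in> atlas M" "q \<in> fst d"
  shows "Dtr d c q (Dtr c d q u) = u"
  using Dtr_chain[OF assms assms(1,2)] Dtr_same[OF assms(1,2)] by simp

lemma to_from_chart:
  assumes "c \<in> atlas M" "q \<in> fst c" "d \<in> atlas M" "q \<in> fst d"
  shows "to_chart M d q (from_chart M c q u) = Dtr c d q u"
  unfolding to_chart_eq from_chart_eq
  by (rule Dtr_chain[OF assms(1,2) chart_at_in[OF assms(1,2)] assms(3,4)])

lemma extend_in_chart: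
  assumes "c \<in> atlas M" "z \<in> snd c ` fst c" "d \<in> atlas M" "pt c z \<in> fst d" "d = chart_at M p"
  shows "field_in_chart M c (extend M p u) z = Dtr d c (pt c z) u"
  unfolding field_in_chart_def extend_def assms(5)[symmetric]
  by (rule to_from_chart) (use assms pt_in[OF assms(2)] in auto)

lemma extend_at: "c \<in> atlas M \<Longrightarrow> p \<in> fst c \<Longrightarrow> extend M p u p = u"
  unfolding extend_def from_chart_eq by (rule Dtr_same[OF chart_at_in])

end

lemma smooth_manifold_chart_atlas: "smooth_manifold M \<Longrightarrow> chart_atlas M"
  by unfold_locales (auto simp: smooth_manifold_def)

locale riemannian_atlas = chart_atlas M
  for M :: "('a, 'e::euclidean_space) manifold" and g :: "('a, 'e) metric" +
  assumes metric_at: "c \<in> atlas M \<Longrightarrow> q \<in> fst c \<Longrightarrow>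
      bilinear (g q) \<and> (\<forall>u v. g q u v = g q v u) \<and> (\<forall>u. u \<noteq> 0 \<longrightarrow> g q u u > 0)"
    and smooth_metric: "c \<in> atlas M \<Longrightarrow> smooth_on (snd c ` fst c) (\<lambda>z. metric_in_chart M g c z u v)"
begin

lemma metric_in_chart_coord:
  assumes "c \<in> atlas M" "q \<in> fst c"
  shows "metric_in_chart M g c (snd c q) u v = g q (from_chart M c q u) (from_chart M c q v)"
  by (simp add: metric_in_chart_def pt_coord[OF chart[OF assms(1)] assms(2)])

lemma local_metric_chart:
  assumes c: "c \<in> atlas M"
  shows "local_metric (snd c ` fst c) (metric_in_chart M g c)"
proof
  show "open (snd c ` fst c)" by (rule is_chart_open[OF chart[OF c]])
  fix z assume "z \<in> snd c ` fst c"
  then have q: "pt c z \<in> fst c" by (rule pt_in)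
  let ?q = "pt c z"
  note m = metric_at[OF c q]
  note ca = chart_at_in[OF c q]
  have lin: "linear (from_chart M c ?q)"
    unfolding from_chart_eq by (rule linear_Dtr[OF c ca(1) q ca(2)])
  have inj: "from_chart M c ?q u \<noteq> 0" if "u \<noteq> 0" for u
    using Dtr_inverse[OF c q ca, of u] linear_0[OF linear_Dtr[OF ca(1) c ca(2) q]] that
    unfolding from_chart_eq by metis
  show "bilinear (metric_in_chart M g c z)"
    unfolding bilinear_def metric_in_chart_def
  proof (intro conjI allI)
    have b: "linear (g ?q x)" "linear (\<lambda>x. g ?q x y)" for x y using m by (auto simp: bilinear_def)
    show "linear (\<lambda>y. g ?q (from_chart M c ?q x) (from_chart M c ?q y))" for x
      using linear_compose[OF lin b(1)] by (simp add: o_def)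
    show "linear (\<lambda>x. g ?q (from_chart M c ?q x) (from_chart M c ?q y))" for y
      using linear_compose[OF lin b(2)] by (simp add: o_def)
  qed
  show "metric_in_chart M g c z u v = metric_in_chart M g c z v u" for u v
    using m by (simp add: metric_in_chart_def)
  show "metric_in_chart M g c z u u > 0" if "u \<noteq> 0" for u
    using m inj[OF that] by (simp add: metric_in_chart_def)
qed (rule smooth_metric[OF c])

lemma metric_transition:
  assumes "c \<in> atlas M" "q \<in> fst c" "d \<in> atlas M" "q \<in> fst d"
  shows "metric_in_chart M g c (snd c q) u v
    = metric_in_chart M g d (snd d q) (Dtr c d q u) (Dtr c d q v)"
  unfolding metric_in_chart_coord[OF assms(1,2)] metric_in_chart_coord[OF assms(3,4)] from_chart_eq
  by (simp add: Dtr_chain[OF assms chart_at_in[OF assms(1,2)]])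

lemma transition_isometric:
  assumes c: "c \<in> atlas M" and d: "d \<in> atlas M"
  shows "isometric_immersion (snd d ` fst d) (metric_in_chart M g d)
    (snd c ` (fst c \<inter> fst d)) (metric_in_chart M g c) (snd d \<circ> pt c)"
proof (rule isometric_immersion.intro)
  show "local_metric (snd d ` fst d) (metric_in_chart M g d)" by (rule local_metric_chart[OF d])
  show "local_metric (snd c ` (fst c \<inter> fst d)) (metric_in_chart M g c)"
    by (rule local_metric_subset[OF local_metric_chart[OF c] open_overlap[OF c d]]) auto
  show "isometric_immersion_axioms (snd d ` fst d) (metric_in_chart M g d)
    (snd c ` (fst c \<inter> fst d)) (metric_in_chart M g c) (snd d \<circ> pt c)"
  proof
    show "smooth_on (snd c ` (fst c \<inter> fst d)) (snd d \<circ> pt c)" by (rule smooth_transition[OF c d])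
    show "(snd d \<circ> pt c) ` snd c ` (fst c \<inter> fst d) \<subseteq> snd d ` fst d"
      by (auto simp: pt_coord[OF chart[OF c]])
    fix w a b assume "w \<in> snd c ` (fst c \<inter> fst d)"
    then obtain q where q: "q \<in> fst c" "q \<in> fst d" "w = snd c q" by auto
    show "metric_in_chart M g c w a b = metric_in_chart M g d ((snd d \<circ> pt c) w) (FD (snd d \<circ> pt c) w a) (FD (snd d \<circ> pt c) w b)"
      using metric_transition[OF c q(1) d q(2), of a b]
      by (simp add: q(3) pt_coord[OF chart[OF c] q(1)] Dtr_def)
  qed
qed

text \<open>A change of charts is an isometric immersion with invertible derivative, so its Gauss formula determines the
  covariant derivative completely.\<close>

lemma christoffel_transition:
  assumes c: "c \<in> atlas M" and d: "d \<in> atlas M" and q: "q \<in> fst c" "q \<in> fst d"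
  shows "Dtr c d q (christoffel (metric_in_chart M g c) (snd c q) a b)
    = FD (\<lambda>w. FD (snd d \<circ> pt c) w b) (snd c q) a
      + christoffel (metric_in_chart M g d) (snd d q) (Dtr c d q a) (Dtr c d q b)"
proof -
  interpret T: isometric_immersion "snd d ` fst d" "metric_in_chart M g d"
    "snd c ` (fst c \<inter> fst d)" "metric_in_chart M g c" "snd d \<circ> pt c"
    by (rule transition_isometric[OF c d])
  let ?w = "snd c q"
  have w: "?w \<in> snd c ` (fst c \<inter> fst d)" using q by auto
  have e: "(snd d \<circ> pt c) ?w = snd d q" by (simp add: pt_coord[OF chart[OF c] q(1)])
  have "T.hess ?w a b = Dtr c d q (christoffel (metric_in_chart M g c) ?w a b)"
  proof (rule T.amb.G_nondegenerate[OF T.f_Z[OF w]])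
    fix k
    obtain k' where k: "k = FD (snd d \<circ> pt c) ?w k'"
      using Dtr_inverse[OF d q(2) c q(1), of k] unfolding Dtr_def[of c d] by metis
    show "metric_in_chart M g d ((snd d \<circ> pt c) ?w) (T.hess ?w a b) k =
        metric_in_chart M g d ((snd d \<circ> pt c) ?w) (Dtr c d q (christoffel (metric_in_chart M g c) ?w a b)) k"
      unfolding k T.gauss_formula[OF w] unfolding Dtr_def by (rule T.induced[OF w])
  qed
  then show ?thesis unfolding T.hess_def cov_along_def e by (simp add: Dtr_def)
qed

text \<open>At \<open>q\<close> the covariant derivative is computed in the chart selected at \<open>q\<close>, which changes from point to point. The transformation law
  shows that in the chart at \<open>p\<close> the result is given by the Christoffel symbols there, so that it can be differentiated again.\<close>

lemma nabla_extend_in_chart: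
  assumes c: "c \<in> atlas M" "c = chart_at M p" and z: "z \<in> snd c ` fst c"
  shows "field_in_chart M c (nabla M g (extend M p u) (extend M p v)) z
    = christoffel (metric_in_chart M g c) z u v"
proof -
  define q where "q = pt c z"
  have q: "q \<in> fst c" unfolding q_def by (rule pt_in[OF z])
  have zq: "z = snd c q" by (simp add: q_def coord_pt[OF z])
  define d where "d = chart_at M q"
  have d: "d \<in> atlas M" "q \<in> fst d" using chart_at_in[OF c(1) q] by (auto simp: d_def)
  have ext: "extend M p w q = Dtr c d q w" for w
    by (simp add: extend_def c(2)[symmetric] from_chart_eq d_def)
  let ?\<psi> = "snd d \<circ> pt c" and ?\<phi> = "snd c \<circ> pt d"
  have \<phi>q: "?\<phi> (snd d q) = z" by (simp add: pt_coord[OF chart[OF d(1)] d(2)] zq)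
  have sm: "smooth_on (snd c ` (fst c \<inter> fst d)) (\<lambda>w. FD ?\<psi> w v)"
    by (rule smooth_on_FD[OF smooth_transition[OF c(1) d(1)]])
  have "((\<lambda>w. FD ?\<psi> w v) has_derivative FD (\<lambda>w. FD ?\<psi> w v) z) (at (?\<phi> (snd d q)))"
    unfolding \<phi>q by (rule smooth_on_has_derivative[OF sm]) (use q d zq in auto)
  from diff_chain_at[OF transition_has_derivative[OF d(1) c(1) d(2) q] this]
  have "((\<lambda>y. FD ?\<psi> (?\<phi> y) v) has_derivative (\<lambda>w. FD (\<lambda>w. FD ?\<psi> w v) z (Dtr d c q w))) (at (snd d q))"
    by (simp add: o_def)
  then have "(field_in_chart M d (extend M p v) has_derivative
      (\<lambda>w. FD (\<lambda>w. FD ?\<psi> w v) z (Dtr d c q w))) (at (snd d q))"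
  proof (rule has_derivative_transform_within_open)
    show "open (snd d ` (fst d \<inter> fst c))" by (rule open_overlap[OF d(1) c(1)])
    show "snd d q \<in> snd d ` (fst d \<inter> fst c)" using d q by auto
    fix y assume "y \<in> snd d ` (fst d \<inter> fst c)"
    then obtain q' where q': "q' \<in> fst d" "q' \<in> fst c" "y = snd d q'" by auto
    show "FD ?\<psi> (?\<phi> y) v = field_in_chart M d (extend M p v) y"
      using extend_in_chart[OF d(1) _ c(1) _ c(2), of y v] q'
      by (simp add: pt_coord[OF chart[OF d(1)]] Dtr_def)
  qed
  then have "FD (field_in_chart M d (extend M p v)) (snd d q) (Dtr c d q u) = FD (\<lambda>w. FD ?\<psi> w v) z u"
    by (simp add: FD_eqI Dtr_inverse[OF c(1) q d])
  then have "nabla M g (extend M p u) (extend M p v) q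
      = Dtr c d q (christoffel (metric_in_chart M g c) z u v)"
    unfolding nabla_def Let_def d_def[symmetric] ext
    using christoffel_transition[OF c(1) d(1) q d(2), of u v] by (simp add: zq)
  then show ?thesis
    unfolding field_in_chart_def q_def[symmetric] to_chart_eq d_def[symmetric]
    by (simp add: Dtr_inverse[OF c(1) q d])
qed

text \<open>In the chart at \<open>p\<close> the extended fields are constant, so that all their derivatives and brackets vanish.\<close>

theorem curvature_tensor_in_chart:
  assumes p: "c' \<in> atlas M" "p \<in> fst c'"
  shows "curvature_tensor M g p u v w
    = local_curvature (metric_in_chart M g (chart_at M p)) (snd (chart_at M p) p) u v w"
proof -
  define c where "c = chart_at M p"
  have c: "c \<in> atlas M" "p \<in> fst c" using chart_at_in[OF p] by (auto simp: c_def)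
  define z where "z = snd c p"
  have z: "z \<in> snd c ` fst c" using c by (auto simp: z_def)
  have o: "open (snd c ` fst c)" by (rule is_chart_open[OF chart[OF c(1)]])
  interpret L: local_metric "snd c ` fst c" "metric_in_chart M g c"
    by (rule local_metric_chart[OF c(1)])
  let ?\<Gamma> = "christoffel (metric_in_chart M g c)"
  have ext: "extend M p u p = u" for u by (rule extend_at[OF c])
  have const: "field_in_chart M c (extend M p u) y = u" if "y \<in> snd c ` fst c" for u y
    using extend_in_chart[OF c(1) that c(1) pt_in[OF that] c_def] Dtr_same[OF c(1) pt_in[OF that]] by simp
  have "((\<lambda>y. u) has_derivative (\<lambda>_. 0)) (at z)" for u :: 'e by (rule has_derivative_const)
  then have "(field_in_chart M c (extend M p u) has_derivative (\<lambda>_. 0)) (at z)" for u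
    by (rule has_derivative_transform_within_open[OF _ o z]) (simp add: const)
  then have d0: "FD (field_in_chart M c (extend M p u)) z = (\<lambda>_. 0)" for u by (rule FD_eqI)
  have n1: "nabla M g X (extend M p w) p = ?\<Gamma> z (X p) w" for X w
    unfolding nabla_def Let_def c_def[symmetric] z_def[symmetric] by (simp add: d0 ext)
  have n2: "nabla M g (extend M p u) (nabla M g (extend M p v) (extend M p w)) p
      = FD (\<lambda>y. ?\<Gamma> y v w) z u + ?\<Gamma> z u (?\<Gamma> z v w)" for u v w
  proof -
    have "FD (\<lambda>y. ?\<Gamma> y v w) z = FD (field_in_chart M c (nabla M g (extend M p v) (extend M p w))) z"
      by (rule FD_cong_open[OF smooth_on_differentiable[OF L.smooth_christoffel z] o z])
        (simp add: nabla_extend_in_chart[OF c(1) c_def])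
    then show ?thesis
      unfolding nabla_def[of M g "extend M p u" "nabla M g (extend M p v) (extend M p w)"] Let_def
        c_def[symmetric] z_def[symmetric] n1 ext by simp
  qed
  have lb: "lie_bracket M (extend M p u) (extend M p v) p = 0"
    unfolding lie_bracket_def Let_def c_def[symmetric] z_def[symmetric] by (simp add: d0)
  show ?thesis
    unfolding curvature_tensor_def curvature_def n2 n1 lb c_def[symmetric] z_def[symmetric]
      local_curvature_def by (simp add: L.christoffel_simps[OF z])
qed

end

lemma riemannian_manifold_atlas:
  assumes "riemannian_manifold M g" shows "riemannian_atlas M g"
proof -
  have s: "smooth_manifold M" and r: "riemannian_metric M g"
    using assms by (auto simp: riemannian_manifold_def)
  interpret chart_atlas M by (rule smooth_manifold_chart_atlas[OF s])
  show ?thesis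
  proof
    fix c q assume c: "c \<in> atlas M"
    show "smooth_on (snd c ` fst c) (\<lambda>z. metric_in_chart M g c z u v)" for u v
      using r c by (simp add: riemannian_metric_def)
    assume q: "q \<in> fst c"
    have "q \<in> pts M" using s c q unfolding smooth_manifold_def by blast
    then show "bilinear (g q) \<and> (\<forall>u v. g q u v = g q v u) \<and> (\<forall>u. u \<noteq> 0 \<longrightarrow> g q u u > 0)"
      using r by (simp add: riemannian_metric_def)
  qed
qed

section \<open>Submanifolds and the Gauss equation\<close>

lemma coord_continuous:
  assumes "is_chart X c" shows "continuous_map (subtopology X (fst c)) euclidean (snd c)"
  using assms homeomorphic_imp_continuous_map continuous_map_into_fulltopology
  unfolding is_chart_def by blast

lemma coord_preimage_open:
  assumes c: "is_chart X c" and U: "open U"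
  shows "openin X {q \<in> fst c. snd c q \<in> U}"
proof -
  have t: "topspace (subtopology X (fst c)) = fst c"
    using openin_subset[OF is_chart_openin[OF c]] by auto
  have "openin (subtopology X (fst c)) {q \<in> fst c. snd c q \<in> U}"
    using openin_continuous_map_preimage[OF coord_continuous[OF c], of U] U unfolding t by simp
  then show ?thesis using is_chart_openin[OF c] openin_trans_full by blast
qed

lemma pt_continuous:
  assumes c: "is_chart X c"
  shows "continuous_map (top_of_set (snd c ` fst c)) (subtopology X (fst c)) (pt c)"
  unfolding continuous_map
proof (intro conjI allI impI)
  have t: "topspace (subtopology X (fst c)) = fst c"
    using openin_subset[OF is_chart_openin[OF c]] by auto
  show "pt c ` topspace (top_of_set (snd c ` fst c)) \<subseteq> topspace (subtopology X (fst c))"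
    unfolding t by (auto simp: pt_coord[OF c])
  fix U assume "openin (subtopology X (fst c)) U"
  then have U: "openin X U" "U \<subseteq> fst c"
    using is_chart_openin[OF c] openin_trans_full openin_subset t by (blast, metis)
  have "{x \<in> topspace (top_of_set (snd c ` fst c)). pt c x \<in> U} = snd c ` (fst c \<inter> U)"
    using U(2) by (auto simp: pt_coord[OF c])
  moreover have "openin (top_of_set (snd c ` fst c)) (snd c ` (fst c \<inter> U))"
    by (rule open_openin_trans[OF is_chart_open[OF c] coord_image_open[OF c U(1)]]) auto
  ultimately show "openin (top_of_set (snd c ` fst c)) {x \<in> topspace (top_of_set (snd c ` fst c)). pt c x \<in> U}"
    by simp
qed

lemma Dtr_compose:
  assumes 1: "((snd d \<circ> pt c) has_derivative Dtr c d q) (at (snd c q))" "pt c (snd c q) = q"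
    and 2: "((snd e \<circ> pt d) has_derivative Dtr d e q) (at (snd d q))"
    and O: "open W" "snd c q \<in> W" "\<And>z. z \<in> W \<Longrightarrow> pt d (snd d (pt c z)) = pt c z"
  shows "Dtr d e q (Dtr c d q u) = Dtr c e q u"
proof -
  have "((snd e \<circ> pt d) has_derivative Dtr d e q) (at ((snd d \<circ> pt c) (snd c q)))"
    using 1(2) 2 by simp
  from diff_chain_at[OF 1(1) this]
  have "((snd e \<circ> pt c) has_derivative (Dtr d e q \<circ> Dtr c d q)) (at (snd c q))"
    by (rule has_derivative_transform_within_open[OF _ O(1,2)]) (simp add: O(3))
  from FD_eqI[OF this] show ?thesis unfolding Dtr_def[of c e] by (metis comp_apply)
qed

locale riemannian_submanifold = riemannian_atlas M g
  for M :: "('a, 'e::euclidean_space) manifold" and g :: "('a, 'e) metric" +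
  fixes S :: "'a set" and N :: "('a, 'v::euclidean_space) manifold"
  assumes S_covered: "q \<in> S \<Longrightarrow> \<exists>c\<in>atlas M. q \<in> fst c"
    and N_def: "N = submanifold M S"
begin

lemma sub_chart: "d \<in> atlas N \<Longrightarrow> is_chart (subtopology (mtop M) S) d"
  by (simp add: N_def submanifold_def)

lemma mtop_N: "mtop N = subtopology (mtop M) S"
  by (simp add: N_def submanifold_def)

lemma sub_subset: "d \<in> atlas N \<Longrightarrow> q \<in> fst d \<Longrightarrow> q \<in> S"
  using openin_subset[OF is_chart_openin[OF sub_chart]] by fastforce

lemma ambient_chart: assumes "d \<in> atlas N" "q \<in> fst d" obtains c where "c \<in> atlas M" "q \<in> fst c"
  using S_covered[OF sub_subset[OF assms]] by blast

lemma incl_smooth: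
  "d \<in> atlas N \<Longrightarrow> c \<in> atlas M \<Longrightarrow> smooth_on (snd d ` (fst d \<inter> fst c)) (snd c \<circ> pt d)"
  by (simp add: N_def submanifold_def)

lemma incl_inj:
  "d \<in> atlas N \<Longrightarrow> c \<in> atlas M \<Longrightarrow> q \<in> fst d \<Longrightarrow> q \<in> fst c \<Longrightarrow> inj (Dtr d c q)"
  by (simp add: N_def submanifold_def Dtr_def)

lemma incl_has_derivative:
  assumes "d \<in> atlas N" "c \<in> atlas M" "q \<in> fst d" "q \<in> fst c"
  shows "((snd c \<circ> pt d) has_derivative Dtr d c q) (at (snd d q))"
  unfolding Dtr_def
  by (rule smooth_on_has_derivative[OF incl_smooth[OF assms(1,2)]]) (use assms in auto)

lemma incl_linear:
  "d \<in> atlas N \<Longrightarrow> c \<in> atlas M \<Longrightarrow> q \<in> fst d \<Longrightarrow> q \<in> fst c \<Longrightarrow> linear (Dtr d c q)"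
  by (rule has_derivative_linear[OF incl_has_derivative])

lemma sub_ambient_openin:
  "c \<in> atlas M \<Longrightarrow> openin (subtopology (mtop M) S) (S \<inter> fst c)"
  using is_chart_openin[OF chart] by (simp add: openin_subtopology_Int2)

lemma incl_overlap_open:
  assumes "d \<in> atlas N" "c \<in> atlas M"
  shows "open (snd d ` (fst d \<inter> fst c))"
proof -
  have "fst d \<inter> fst c = fst d \<inter> (S \<inter> fst c)" using sub_subset[OF assms(1)] by auto
  then show ?thesis
    using coord_image_open[OF sub_chart[OF assms(1)] sub_ambient_openin[OF assms(2)]] by simp
qed

lemma incl_chain:
  assumes "d \<in> atlas N" "q \<in> fst d" "c \<in> atlas M" "q \<in> fst c" "c' \<in> atlas M" "q \<in> fst c'"
  shows "Dtr c c' q (Dtr d c q u) = Dtr d c' q u"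
  by (rule Dtr_compose[OF incl_has_derivative _ transition_has_derivative incl_overlap_open[OF assms(1,3)]])
    (use assms in \<open>auto simp: pt_coord[OF sub_chart] pt_coord[OF chart]\<close>)

text \<open>Composing with a linear left inverse of its derivative turns an immersion into a local
  diffeomorphism of the parameter space; this expresses the coordinates of one chart of the submanifold
  smoothly through ambient coordinates.\<close>

lemma sub_transition_smooth:
  assumes d: "d \<in> atlas N" and d': "d' \<in> atlas N"
  shows "smooth_on (snd d ` (fst d \<inter> fst d')) (snd d' \<circ> pt d)"
proof (rule smooth_on_local)
  fix w assume "w \<in> snd d ` (fst d \<inter> fst d')"
  then obtain q where q: "q \<in> fst d" "q \<in> fst d'" "w = snd d q" by auto
  obtain c where c: "c \<in> atlas M" "q \<in> fst c" using ambient_chart[OF d q(1)] by blast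
  let ?f = "snd c \<circ> pt d" and ?f' = "snd c \<circ> pt d'"
  let ?W' = "snd d' ` (fst d' \<inter> fst c)"
  have w': "snd d' q \<in> ?W'" using q c by auto
  obtain L where L: "linear L" "L \<circ> Dtr d' c q = id"
    using linear_injective_left_inverse[OF incl_linear[OF d' c(1) q(2) c(2)] incl_inj[OF d' c(1) q(2) c(2)]] by blast
  have bL: "bounded_linear L" using L(1) linear_linear by blast
  have oW': "open ?W'" by (rule incl_overlap_open[OF d' c(1)])
  have sLf: "smooth_on ?W' (\<lambda>w. L (?f' w))"
    by (rule smooth_on_linear[OF oW' bL incl_smooth[OF d' c(1)]])
  have "FD (\<lambda>w. L (?f' w)) (snd d' q) = (\<lambda>v. L (Dtr d' c q v))"
    by (rule FD_eqI[OF bounded_linear.has_derivative[OF bL incl_has_derivative[OF d' c(1) q(2) c(2)]]])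
  then have "FD (\<lambda>w. L (?f' w)) (snd d' q) = id" using L(2) by (simp add: o_def)
  then have "inj (FD (\<lambda>w. L (?f' w)) (snd d' q))" by simp
  then obtain U V k where k: "open U" "U \<subseteq> ?W'" "snd d' q \<in> U" "open V"
    "homeomorphism U V (\<lambda>w. L (?f' w)) k" "smooth_on V k"
    using smooth_inverse_function_endo[OF oW' sLf w'] by metis
  define Q where "Q = {q \<in> fst d'. snd d' q \<in> U}"
  have Q: "openin (subtopology (mtop M) S) Q"
    unfolding Q_def by (rule coord_preimage_open[OF sub_chart[OF d'] k(1)])
  have Qc: "q' \<in> fst c" if "q' \<in> Q" for q'
  proof -
    have "snd d' q' \<in> ?W'" "q' \<in> fst d'" using that k(2) by (auto simp: Q_def)
    then show ?thesis using inj_onD[OF is_chart_inj[OF sub_chart[OF d']]] by blast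
  qed
  let ?T = "snd d ` (fst d \<inter> Q)"
  have oT: "open ?T" by (rule coord_image_open[OF sub_chart[OF d] Q])
  have key: "L (?f y) \<in> V" "k (L (?f y)) = (snd d' \<circ> pt d) y" if y: "y \<in> ?T" for y
  proof -
    obtain q' where q': "q' \<in> fst d" "q' \<in> Q" "y = snd d q'" using y by auto
    have "?f y = ?f' (snd d' q')" and e: "(snd d' \<circ> pt d) y = snd d' q'"
      using q' by (simp_all add: Q_def pt_coord[OF sub_chart[OF d]] pt_coord[OF sub_chart[OF d']])
    moreover have "snd d' q' \<in> U" using q' by (simp add: Q_def)
    ultimately show "L (?f y) \<in> V" "k (L (?f y)) = (snd d' \<circ> pt d) y"
      using k(5) by (auto simp: homeomorphism_def)
  qed
  \<comment> \<open>On \<open>?T\<close> the transition is the composition of the inclusion, \<open>L\<close> and the local inverse \<open>k\<close>.\<close>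
  have TW: "?T \<subseteq> snd d ` (fst d \<inter> fst c)" using Qc by auto
  have "smooth_on ?T (\<lambda>y. k (L (?f y)))"
    by (rule smooth_on_compose[OF oT k(4) _ k(6) smooth_on_linear[OF oT bL smooth_on_mono[OF incl_smooth[OF d c(1)] TW]]])
      (use key(1) in auto)
  then have "smooth_on ?T (snd d' \<circ> pt d)"
    by (rule smooth_on_cong[OF oT key(2), rotated]) auto
  moreover have "w \<in> ?T" using q k(3) by (auto simp: Q_def)
  ultimately show "\<exists>U. open U \<and> w \<in> U \<and> smooth_on U (snd d' \<circ> pt d)" using oT by blast
qed

sublocale sub: chart_atlas N
  by unfold_locales (auto simp: mtop_N intro: sub_chart sub_transition_smooth)

lemma incl_chain_sub:
  assumes "d \<in> atlas N" "q \<in> fst d" "d' \<in> atlas N" "q \<in> fst d'" "c \<in> atlas M" "q \<in> fst c"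
  shows "Dtr d' c q (Dtr d d' q u) = Dtr d c q u"
  by (rule Dtr_compose[OF sub.transition_has_derivative _ incl_has_derivative sub.open_overlap[OF assms(1,3)]])
    (use assms in \<open>auto simp: pt_coord[OF sub_chart]\<close>)

definition induced_metric :: "('a, 'v) metric" where
  "induced_metric = pullback_metric N M (\<lambda>q. q) g"

lemma differential_incl: "differential N M (\<lambda>q. q) q = Dtr (chart_at N q) (chart_at M q) q"
  by (simp add: differential_def Dtr_def comp_def)

text \<open>The pullback metric is computed in the charts selected at \<open>q\<close>; by the chain rule these may be replaced by any charts.\<close>

lemma induced_metric_in_chart:
  assumes d: "d \<in> atlas N" "q \<in> fst d" and c: "c \<in> atlas M" "q \<in> fst c"
  shows "metric_in_chart N induced_metric d (snd d q) u v
    = metric_in_chart M g c (snd c q) (Dtr d c q u) (Dtr d c q v)"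
  unfolding metric_in_chart_coord[OF c] from_chart_eq incl_chain[OF d c chart_at_in[OF c]]
  by (simp add: metric_in_chart_def pt_coord[OF sub_chart[OF d(1)] d(2)] induced_metric_def
      pullback_metric_def differential_incl from_chart_eq
      incl_chain_sub[OF d chart_at_in[OF d] chart_at_in[OF c]])

sublocale sub: riemannian_atlas N induced_metric
proof
  fix d q assume d: "d \<in> atlas N" "q \<in> fst d"
  obtain c where c: "c \<in> atlas M" "q \<in> fst c" using ambient_chart[OF d] by blast
  note m = metric_at[OF c]
  let ?l = "Dtr (chart_at N q) (chart_at M q) q"
  have l: "linear ?l" "inj ?l"
    using incl_linear incl_inj chart_at_in[OF d] chart_at_in[OF c] by auto
  have ig: "induced_metric q u v = g q (?l u) (?l v)" for u v
    by (simp add: induced_metric_def pullback_metric_def differential_incl)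
  show "bilinear (induced_metric q) \<and> (\<forall>u v. induced_metric q u v = induced_metric q v u) \<and>
      (\<forall>u. u \<noteq> 0 \<longrightarrow> induced_metric q u u > 0)"
  proof (intro conjI allI impI)
    have b: "linear (g q x)" "linear (\<lambda>x. g q x y)" for x y using m by (auto simp: bilinear_def)
    show "bilinear (induced_metric q)"
      unfolding bilinear_def ig
      using linear_compose[OF l(1) b(1)] linear_compose[OF l(1) b(2)] by (simp add: o_def)
    show "induced_metric q u v = induced_metric q v u" for u v using m by (simp add: ig)
    show "induced_metric q u u > 0" if "u \<noteq> 0" for u
    proof -
      have "?l u \<noteq> 0" using l that linear_0[OF l(1)] by (metis injD)
      then show ?thesis using m by (simp add: ig)
    qed
  qed
next
  fix d u v assume d: "d \<in> atlas N"
  show "smooth_on (snd d ` fst d) (\<lambda>z. metric_in_chart N induced_metric d z u v)"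
  proof (rule smooth_on_local)
    fix w assume "w \<in> snd d ` fst d"
    then obtain q where q: "q \<in> fst d" "w = snd d q" by auto
    obtain c where c: "c \<in> atlas M" "q \<in> fst c" using ambient_chart[OF d q(1)] by blast
    interpret L: local_metric "snd c ` fst c" "metric_in_chart M g c" by (rule local_metric_chart[OF c(1)])
    let ?W = "snd d ` (fst d \<inter> fst c)" and ?f = "snd c \<circ> pt d"
    note oW = incl_overlap_open[OF d c(1)] and sf = incl_smooth[OF d c(1)]
    have fW: "?f ` ?W \<subseteq> snd c ` fst c" by (auto simp: pt_coord[OF sub_chart[OF d]])
    have "smooth_on ?W (\<lambda>w. metric_in_chart M g c (?f w) (FD ?f w u) (FD ?f w v))"
      by (rule smooth_on_bilinear_family[where B = "\<lambda>w. metric_in_chart M g c (?f w)",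
            OF oW L.bilinear_G smooth_on_compose[OF oW L.open_Z fW L.smooth_G sf] smooth_on_FD[OF sf] smooth_on_FD[OF sf]])
        (use fW in blast)
    then have "smooth_on ?W (\<lambda>z. metric_in_chart N induced_metric d z u v)"
    proof (rule smooth_on_cong[OF oW, rotated])
      fix y assume "y \<in> ?W"
      then obtain q' where q': "q' \<in> fst d" "q' \<in> fst c" "y = snd d q'" by auto
      show "metric_in_chart M g c (?f y) (FD ?f y u) (FD ?f y v) = metric_in_chart N induced_metric d y u v"
        using induced_metric_in_chart[OF d q'(1) c(1) q'(2), of u v]
        by (simp add: q'(3) pt_coord[OF sub_chart[OF d] q'(1)] Dtr_def)
    qed
    moreover have "w \<in> ?W" using q c by auto
    ultimately show "\<exists>U. open U \<and> w \<in> U \<and> smooth_on U (\<lambda>z. metric_in_chart N induced_metric d z u v)"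
      using oW by blast
  qed
qed

lemma inclusion_isometric:
  assumes d: "d \<in> atlas N" and c: "c \<in> atlas M"
  shows "isometric_immersion (snd c ` fst c) (metric_in_chart M g c)
    (snd d ` (fst d \<inter> fst c)) (metric_in_chart N induced_metric d) (snd c \<circ> pt d)"
proof (rule isometric_immersion.intro)
  show "local_metric (snd c ` fst c) (metric_in_chart M g c)" by (rule local_metric_chart[OF c])
  show "local_metric (snd d ` (fst d \<inter> fst c)) (metric_in_chart N induced_metric d)"
    by (rule local_metric_subset[OF sub.local_metric_chart[OF d] incl_overlap_open[OF d c]]) auto
  show "isometric_immersion_axioms (snd c ` fst c) (metric_in_chart M g c)
    (snd d ` (fst d \<inter> fst c)) (metric_in_chart N induced_metric d) (snd c \<circ> pt d)"
  proof
    show "smooth_on (snd d ` (fst d \<inter> fst c)) (snd c \<circ> pt d)" by (rule incl_smooth[OF d c])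
    show "(snd c \<circ> pt d) ` snd d ` (fst d \<inter> fst c) \<subseteq> snd c ` fst c"
      by (auto simp: pt_coord[OF sub_chart[OF d]])
    fix w a b assume "w \<in> snd d ` (fst d \<inter> fst c)"
    then obtain q where q: "q \<in> fst d" "q \<in> fst c" "w = snd d q" by auto
    show "metric_in_chart N induced_metric d w a b
      = metric_in_chart M g c ((snd c \<circ> pt d) w) (FD (snd c \<circ> pt d) w a) (FD (snd c \<circ> pt d) w b)"
      using induced_metric_in_chart[OF d q(1) c q(2), of a b]
      by (simp add: q(3) pt_coord[OF sub_chart[OF d] q(1)] Dtr_def)
  qed
qed

end

lemma (in riemannian_atlas) metric_in_chart_at:
  assumes "c' \<in> atlas M" "p \<in> fst c'"
  shows "metric_in_chart M g (chart_at M p) (snd (chart_at M p) p) u v = g p u v"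
  unfolding metric_in_chart_coord[OF chart_at_in[OF assms]] from_chart_eq
  by (simp add: Dtr_same[OF chart_at_in[OF assms]])

section \<open>Orthonormal bases of an inner product\<close>

locale inner_form =
  fixes B :: "'e::euclidean_space \<Rightarrow> 'e \<Rightarrow> real"
  assumes bilinear_B: "bilinear B" and sym_B: "B u v = B v u" and pos_B: "u \<noteq> 0 \<Longrightarrow> B u u > 0"
begin

lemma B_simps:
  "B (u + v) w = B u w + B v w" "B u (v + w) = B u v + B u w"
  "B (u - v) w = B u w - B v w" "B u (v - w) = B u v - B u w"
  "B (a *\<^sub>R u) w = a * B u w" "B u (a *\<^sub>R w) = a * B u w"
  "B 0 w = 0" "B u 0 = 0" "B (- u) w = - B u w" "B u (- w) = - B u w"
  using bilinear_B
  by (simp_all add: bilinear_ladd bilinear_radd bilinear_lsub bilinear_rsub bilinear_lmul bilinear_rmul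
      bilinear_lzero bilinear_rzero bilinear_lneg bilinear_rneg)

lemma linear_B: "linear (B u)" "linear (\<lambda>u. B u v)"
  using bilinear_B by (auto simp: bilinear_def)

lemma B_sum: "B (sum f I) v = (\<Sum>i\<in>I. B (f i) v)" "B u (sum f I) = (\<Sum>i\<in>I. B u (f i))"
  using linear_sum[OF linear_B(2)] linear_sum[OF linear_B(1)] by blast+

lemma B_eq_0: "B u u = 0 \<longleftrightarrow> u = 0"
  using pos_B[of u] B_simps(7) by force

lemma B_nonneg: "B u u \<ge> 0"
  using pos_B[of u] B_simps(7)[of 0] by (cases "u = 0") auto

lemma subspace_orth_comp: "subspace (orth_comp B W)"
  unfolding subspace_def orth_comp_def by (simp add: B_simps)

lemma onb_in: "orthonormal_basis B W I U \<Longrightarrow> i \<in> I \<Longrightarrow> U i \<in> W"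
  unfolding orthonormal_basis_def by (metis imageI span_base)

lemma onb_subspace: "orthonormal_basis B W I U \<Longrightarrow> subspace W"
  unfolding orthonormal_basis_def by (metis subspace_span)

lemma onb_inner: "orthonormal_basis B W I U \<Longrightarrow> i \<in> I \<Longrightarrow> j \<in> I \<Longrightarrow> B (U i) (U j) = (if i = j then 1 else 0)"
  unfolding orthonormal_basis_def by blast

lemma onb_expansion:
  assumes U: "orthonormal_basis B W I U" and I: "finite I" and x: "x \<in> W"
  shows "x = (\<Sum>i\<in>I. B x (U i) *\<^sub>R U i)"
proof -
  define y where "y = x - (\<Sum>i\<in>I. B x (U i) *\<^sub>R U i)"
  have sW: "subspace W" by (rule onb_subspace[OF U])
  have yW: "y \<in> W" unfolding y_def
    by (intro subspace_diff subspace_sum subspace_scale sW x onb_in[OF U])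
  have yU: "B y (U j) = 0" if "j \<in> I" for j
  proof -
    have "(\<Sum>i\<in>I. B x (U i) * B (U i) (U j)) = (\<Sum>i\<in>I. if i = j then B x (U j) else 0)"
      by (intro sum.cong refl) (simp add: onb_inner[OF U _ that])
    also have "\<dots> = B x (U j)" using I that by simp
    finally show ?thesis unfolding y_def by (simp add: B_simps B_sum)
  qed
  have "subspace {v. B y v = 0}" unfolding subspace_def by (simp add: B_simps)
  moreover have "U ` I \<subseteq> {v. B y v = 0}" using yU by auto
  ultimately have "span (U ` I) \<subseteq> {v. B y v = 0}" by (metis span_minimal)
  then have "B y y = 0" using U yW unfolding orthonormal_basis_def by blast
  then have "y = 0" by (simp add: B_eq_0)
  then show ?thesis by (simp add: y_def)
qed

text \<open>The trace of a bilinear form does not depend on the orthonormal basis. With values in a vector space and with products of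
  linear forms this covers traces, squared norms and Parseval sums.\<close>

lemma onb_bilinear_sum:
  assumes U: "orthonormal_basis B W I U" and I: "finite I"
    and U': "orthonormal_basis B W I' U'" and I': "finite I'"
    and m: "bilinear m"
  shows "(\<Sum>i\<in>I. m (U i) (U i)) = (\<Sum>j\<in>I'. m (U' j) (U' j))"
proof -
  have l: "linear (m x)" "linear (\<lambda>x. m x y)" for x y using m by (auto simp: bilinear_def)
  have e: "m x y = (\<Sum>i\<in>I. \<Sum>k\<in>I. (B x (U i) * B y (U k)) *\<^sub>R m (U i) (U k))" if "x \<in> W" "y \<in> W" for x y
  proof -
    have "m x y = m (\<Sum>i\<in>I. B x (U i) *\<^sub>R U i) (\<Sum>k\<in>I. B y (U k) *\<^sub>R U k)"
      using onb_expansion[OF U I that(1)] onb_expansion[OF U I that(2)] by simp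
    also have "\<dots> = (\<Sum>i\<in>I. \<Sum>k\<in>I. (B x (U i) * B y (U k)) *\<^sub>R m (U i) (U k))"
      by (simp only: linear_sum[OF l(2)] linear_cmul[OF l(2)])
        (simp only: linear_sum[OF l(1)] linear_cmul[OF l(1)] scaleR_sum_right scaleR_scaleR)
    finally show ?thesis .
  qed
  have p: "(\<Sum>j\<in>I'. B (U' j) (U i) * B (U' j) (U k)) = B (U i) (U k)" if "i \<in> I" "k \<in> I" for i k
  proof -
    have "B (U i) (U k) = B (\<Sum>j\<in>I'. B (U i) (U' j) *\<^sub>R U' j) (U k)"
      using onb_expansion[OF U' I' onb_in[OF U that(1)]] by simp
    also have "\<dots> = (\<Sum>j\<in>I'. B (U' j) (U i) * B (U' j) (U k))"
      by (simp add: B_sum B_simps sym_B[of "U i"])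
    finally show ?thesis by simp
  qed
  have "(\<Sum>j\<in>I'. m (U' j) (U' j))
      = (\<Sum>j\<in>I'. \<Sum>i\<in>I. \<Sum>k\<in>I. (B (U' j) (U i) * B (U' j) (U k)) *\<^sub>R m (U i) (U k))"
    by (intro sum.cong refl e onb_in[OF U'])
  also have "\<dots> = (\<Sum>i\<in>I. \<Sum>j\<in>I'. \<Sum>k\<in>I. (B (U' j) (U i) * B (U' j) (U k)) *\<^sub>R m (U i) (U k))"
    by (rule sum.swap)
  also have "\<dots> = (\<Sum>i\<in>I. \<Sum>k\<in>I. \<Sum>j\<in>I'. (B (U' j) (U i) * B (U' j) (U k)) *\<^sub>R m (U i) (U k))"
    by (intro sum.cong refl sum.swap)
  also have "\<dots> = (\<Sum>i\<in>I. \<Sum>k\<in>I. B (U i) (U k) *\<^sub>R m (U i) (U k))"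
    by (intro sum.cong refl) (simp add: scaleR_sum_left[symmetric] p)
  also have "\<dots> = (\<Sum>i\<in>I. \<Sum>k\<in>I. if k = i then m (U i) (U i) else 0)"
    by (intro sum.cong refl) (auto simp: onb_inner[OF U])
  also have "\<dots> = (\<Sum>i\<in>I. m (U i) (U i))" using I by simp
  finally show ?thesis by simp
qed

lemma onb_independent: 
  assumes U: "orthonormal_basis B W I U" and I: "finite I"
  shows "inj_on U I" "independent (U ` I)"
proof -
  show inj: "inj_on U I"
    by (rule inj_onI) (metis onb_inner[OF U] zero_neq_one)
  show "independent (U ` I)"
  proof (rule independent_if_scalars_zero)
    fix f x assume s: "(\<Sum>x\<in>U ` I. f x *\<^sub>R x) = 0" and x: "x \<in> U ` I"
    then obtain i where i: "i \<in> I" "x = U i" by auto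
    have "0 = B (\<Sum>x\<in>U ` I. f x *\<^sub>R x) (U i)" using s by (simp add: B_simps)
    also have "\<dots> = (\<Sum>j\<in>I. f (U j) * B (U j) (U i))"
      by (simp add: B_sum B_simps sum.reindex[OF inj])
    also have "\<dots> = (\<Sum>j\<in>I. if j = i then f (U i) else 0)"
      by (intro sum.cong refl) (simp add: onb_inner[OF U _ i(1)])
    also have "\<dots> = f x" using I i by simp
    finally show "f x = 0" by simp
  qed (use I in simp)
qed

lemma onb_dim:
  assumes "orthonormal_basis B W I U" and "finite I"
  shows "dim W = card I"
proof -
  have "dim W = dim (U ` I)" using assms(1) unfolding orthonormal_basis_def by (metis dim_span)
  also have "\<dots> = card (U ` I)" by (rule dim_eq_card_independent[OF onb_independent(2)[OF assms]])
  also have "\<dots> = card I" by (rule card_image[OF onb_independent(1)[OF assms]])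
  finally show ?thesis .
qed

text \<open>One step of the Gram-Schmidt process, keeping the vectors found so far.\<close>

lemma onb_extend:
  assumes U: "orthonormal_basis B W {1..n} U" and a: "a \<notin> W"
  obtains u where "orthonormal_basis B (span (insert a W)) {1..Suc n} (U(Suc n := u))"
proof -
  define a' where "a' = a - (\<Sum>i\<in>{1..n}. B a (U i) *\<^sub>R U i)"
  have sW: "subspace W" by (rule onb_subspace[OF U])
  have sumW: "(\<Sum>i\<in>{1..n}. B a (U i) *\<^sub>R U i) \<in> W"
    by (intro subspace_sum subspace_scale sW onb_in[OF U])
  have "a' \<noteq> 0" using a sumW unfolding a'_def by auto
  then have pa: "B a' a' > 0" by (rule pos_B)
  have orth: "B a' (U j) = 0" if "j \<in> {1..n}" for j
  proof -
    have "(\<Sum>i\<in>{1..n}. B a (U i) * B (U i) (U j)) = (\<Sum>i\<in>{1..n}. if i = j then B a (U j) else 0)"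
      by (intro sum.cong refl) (simp add: onb_inner[OF U _ that])
    also have "\<dots> = B a (U j)" using that by simp
    finally show ?thesis unfolding a'_def by (simp add: B_simps B_sum)
  qed
  define u where "u = (1 / sqrt (B a' a')) *\<^sub>R a'"
  have uu: "B u u = 1" using pa by (simp add: u_def B_simps)
  have uU: "B u (U j) = 0" "B (U j) u = 0" if "j \<in> {1..n}" for j
    using orth[OF that] sym_B[of "U j"] by (simp_all add: u_def B_simps)
  have W: "span (U ` {1..n}) = W" using U unfolding orthonormal_basis_def by blast
  have im: "(U(Suc n := u)) ` {1..Suc n} = insert u (U ` {1..n})"
    by (auto simp: atLeastAtMostSuc_conv)
  have "span (insert u (U ` {1..n})) = span (insert a W)"
  proof (rule span_eq[THEN iffD2], intro conjI)
    have a1: "a \<in> span (insert a W)" by (simp add: span_base)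
    have a2: "W \<subseteq> span (insert a W)" by (meson span_superset subset_insertI subset_trans)
    have "a' \<in> span (insert a W)"
      unfolding a'_def using a1 a2 sumW by (intro span_diff) auto
    then have "u \<in> span (insert a W)" unfolding u_def by (rule span_scale)
    then show "insert u (U ` {1..n}) \<subseteq> span (insert a W)" using a2 onb_in[OF U] by auto
    let ?S = "span (insert u (U ` {1..n}))"
    have b2: "W \<subseteq> ?S" unfolding W[symmetric] by (rule span_mono) auto
    have "a' = sqrt (B a' a') *\<^sub>R u" using pa by (simp add: u_def)
    moreover have "u \<in> ?S" by (simp add: span_base)
    ultimately have "a' \<in> ?S" by (metis span_scale)
    then have "a' + (\<Sum>i\<in>{1..n}. B a (U i) *\<^sub>R U i) \<in> ?S" using b2 sumW by (intro span_add) auto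
    then show "insert a W \<subseteq> ?S" using b2 by (simp add: a'_def)
  qed
  then have "orthonormal_basis B (span (insert a W)) {1..Suc n} (U(Suc n := u))"
    unfolding orthonormal_basis_def im
    using onb_inner[OF U] uu uU by (auto simp: atLeastAtMostSuc_conv)
  then show ?thesis by (rule that)
qed

lemma onb_exists:
  assumes W: "subspace W"
  shows "\<exists>U. orthonormal_basis B W {1..dim W} U"
proof -
  have *: "\<exists>U. orthonormal_basis B (span S) {1..card S} U" if "finite S" "independent S" for S
    using that
  proof (induction S rule: finite_induct)
    case empty
    show ?case by (auto simp: orthonormal_basis_def)
  next
    case (insert a S)
    then obtain U where U: "orthonormal_basis B (span S) {1..card S} U"
      using independent_mono[of "insert a S" S] by auto
    have "a \<notin> span S" using insert by (simp add: independent_insert)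
    from onb_extend[OF U this] obtain u where
      "orthonormal_basis B (span (insert a (span S))) {1..Suc (card S)} (U(Suc (card S) := u))" by blast
    moreover have "span (insert a (span S)) = span (insert a S)"
      by (rule span_eq[THEN iffD2]) (auto intro: span_base span_mono[THEN subsetD, rotated] span_superset[THEN subsetD])
    ultimately show ?case using insert by auto
  qed
  obtain S where S: "S \<subseteq> W" "independent S" "W \<subseteq> span S" "card S = dim W"
    using basis_exists[of W] by blast
  have "span S = W" using S W by (metis span_subspace)
  then show ?thesis using *[of S] S independent_imp_finite by metis
qed

lemma some_onb: "subspace W \<Longrightarrow> orthonormal_basis B W {1..dim W} (some_onb B W)"
  unfolding some_onb_def using someI_ex[OF onb_exists] by blast

lemma orth_proj_exists:
  assumes W: "subspace W"
  shows "\<exists>w. w \<in> W \<and> x - w \<in> orth_comp B W"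
proof -
  obtain U where U: "orthonormal_basis B W {1..dim W} U" using onb_exists[OF W] by blast
  let ?w = "\<Sum>i\<in>{1..dim W}. B x (U i) *\<^sub>R U i"
  have "?w \<in> W" by (intro subspace_sum subspace_scale W onb_in[OF U])
  moreover have "B (x - ?w) v = 0" if "v \<in> W" for v
  proof -
    have "B ?w v = (\<Sum>i\<in>{1..dim W}. B v (U i) * B x (U i))"
      by (simp add: B_sum B_simps sym_B[of v] mult.commute)
    also have "\<dots> = B x (\<Sum>i\<in>{1..dim W}. B v (U i) *\<^sub>R U i)" by (simp add: B_sum B_simps)
    also have "\<dots> = B x v" using onb_expansion[OF U _ that] by simp
    finally show ?thesis by (simp add: B_simps)
  qed
  ultimately show ?thesis unfolding orth_comp_def by blast
qed

lemma orth_proj_unique: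
  assumes W: "subspace W" and "w \<in> W" "x - w \<in> orth_comp B W" "w' \<in> W" "x - w' \<in> orth_comp B W"
  shows "w = w'"
proof -
  have d: "w - w' \<in> W" using assms subspace_diff by blast
  have "B (x - w') (w - w') - B (x - w) (w - w') = 0" using assms d unfolding orth_comp_def by auto
  then have "B (w - w') (w - w') = 0" by (simp add: B_simps)
  then show ?thesis by (simp add: B_eq_0)
qed

lemma orth_proj:
  assumes W: "subspace W"
  shows orth_proj_in: "orth_proj B W x \<in> W" and orth_proj_orth: "x - orth_proj B W x \<in> orth_comp B W"
proof -
  have "\<exists>!w. w \<in> W \<and> x - w \<in> orth_comp B W"
    using orth_proj_exists[OF W] orth_proj_unique[OF W] by blast
  from theI'[OF this] show "orth_proj B W x \<in> W" "x - orth_proj B W x \<in> orth_comp B W"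
    unfolding orth_proj_def by auto
qed

lemma orth_proj_same: "subspace W \<Longrightarrow> x \<in> W \<Longrightarrow> orth_proj B W x = x"
  by (rule orth_proj_unique[OF _ orth_proj_in orth_proj_orth])
    (auto simp: orth_comp_def B_simps)

lemma dim_orth_comp:
  assumes V: "subspace V"
  shows "dim V + dim (orth_comp B V) = DIM('e)"
proof -
  have "V \<inter> orth_comp B V = {0}"
    using subspace_0[OF V] subspace_0[OF subspace_orth_comp] B_eq_0 by (auto simp: orth_comp_def)
  moreover have "{x + y |x y. x \<in> V \<and> y \<in> orth_comp B V} = UNIV"
  proof -
    have "v \<in> {x + y |x y. x \<in> V \<and> y \<in> orth_comp B V}" for v
    proof -
      have "v = orth_proj B V v + (v - orth_proj B V v)" by simp
      then show ?thesis using orth_proj[OF V, of v] by blast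
    qed
    then show ?thesis by blast
  qed
  ultimately show ?thesis
    using dim_sums_Int[OF V subspace_orth_comp, of V] by (simp add: dim_UNIV)
qed

section \<open>Hyperplanes and their normals\<close>

lemma unit_sphere_compact:
  assumes V: "subspace V"
  shows "compact {n \<in> V. B n n = 1}"
proof -
  have bb: "bounded_bilinear B" using bilinear_B bilinear_conv_bounded_bilinear by blast
  have cont: "continuous_on S (\<lambda>n. B n n)" for S
    by (rule bounded_bilinear.continuous_on[OF bb continuous_on_id continuous_on_id])
  have "closed {n. B n n = 1}"
    using continuous_closed_vimage[of "{1}" "\<lambda>n. B n n"] cont[of UNIV]
    by (simp add: continuous_on_eq_continuous_at vimage_def)
  moreover have "{n \<in> V. B n n = 1} = V \<inter> {n. B n n = 1}" by auto
  ultimately have cl: "closed {n \<in> V. B n n = 1}" using closed_subspace[OF V] by auto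
  obtain b :: 'e where b: "b \<in> Basis" using nonempty_Basis by blast
  have "sphere 0 1 \<noteq> ({} :: 'e set)" using b norm_Basis by (auto intro!: exI[of _ b])
  then obtain x where x: "x \<in> sphere 0 1" "\<And>y. y \<in> sphere 0 1 \<Longrightarrow> B x x \<le> B y y"
    using continuous_attains_inf[OF compact_sphere _ cont] by metis
  have m: "B x x > 0" using x(1) by (intro pos_B) auto
  have "norm n \<le> sqrt (1 / B x x)" if "B n n = 1" for n
  proof -
    have n0: "n \<noteq> 0" using that by (auto simp: B_simps)
    have "B x x \<le> B ((1 / norm n) *\<^sub>R n) ((1 / norm n) *\<^sub>R n)" using n0 by (intro x(2)) simp
    also have "\<dots> = 1 / (norm n)\<^sup>2" using that by (simp add: B_simps power2_eq_square)
    finally have "(norm n)\<^sup>2 \<le> 1 / B x x" using n0 m by (simp add: field_simps)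
    then show ?thesis by (rule real_le_rsqrt)
  qed
  then have "bounded {n \<in> V. B n n = 1}" by (auto simp: bounded_iff)
  then show ?thesis using cl compact_eq_bounded_closed by blast
qed

lemma hyperplane_adapted_basis:
  assumes V: "subspace V" "dim V = Suc k" and L: "L \<in> hyperplanes V"
    and U: "orthonormal_basis B L {1..k} U"
  obtains u where "orthonormal_basis B V {1..Suc k} (U(Suc k := u))"
proof -
  have L': "subspace L" "L \<subseteq> V" "dim L = k" using L V by (auto simp: hyperplanes_def)
  obtain a where a: "a \<in> V" "a \<notin> L" using L' V by (metis n_not_Suc_n subsetI subset_antisym)
  from onb_extend[OF U a(2)] obtain u where
    u: "orthonormal_basis B (span (insert a L)) {1..Suc k} (U(Suc k := u))" by blast
  have sub: "span (insert a L) \<subseteq> V" using a L' V by (intro span_minimal) auto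
  have "dim (span (insert a L)) = dim V" using onb_dim[OF u] V by simp
  then have "span (insert a L) = V" using sub V(1) by (metis subspace_dim_equal subspace_span order_refl)
  then show ?thesis using u that by blast
qed

lemma normal_hyperplane:
  assumes U: "orthonormal_basis B V {1..Suc k} U"
  shows "span (U ` {1..k}) \<in> hyperplanes V" "orthonormal_basis B (span (U ` {1..k})) {1..k} U"
proof -
  show o: "orthonormal_basis B (span (U ` {1..k})) {1..k} U"
    using U unfolding orthonormal_basis_def by auto
  have "span (U ` {1..k}) \<subseteq> V"
    using onb_subspace[OF U] onb_in[OF U] by (intro span_minimal) auto
  then show "span (U ` {1..k}) \<in> hyperplanes V"
    using onb_dim[OF U] onb_dim[OF o] by (simp add: hyperplanes_def)
qed

end

section \<open>The Casorati inequality for a family of symmetric bilinear forms\<close>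

text \<open>The squared norm of the vector-valued form with components \<open>b \<beta>\<close>, restricted to the span of the \<open>U i\<close>. The Casorati
  curvature of a subspace is this number divided by the dimension.\<close>

definition sqnorm_on :: "nat set \<Rightarrow> (nat \<Rightarrow> 'e \<Rightarrow> 'e \<Rightarrow> real) \<Rightarrow> nat set \<Rightarrow> (nat \<Rightarrow> 'e) \<Rightarrow> real" where
  "sqnorm_on J b I U = (\<Sum>\<beta>\<in>J. \<Sum>i\<in>I. \<Sum>j\<in>I. (b \<beta> (U i) (U j))\<^sup>2)"

text \<open>The squared norm of the trace, that is of \<open>r\<close> times the mean curvature vector.\<close>

definition trace_sq :: "nat set \<Rightarrow> (nat \<Rightarrow> 'e \<Rightarrow> 'e \<Rightarrow> real) \<Rightarrow> nat set \<Rightarrow> (nat \<Rightarrow> 'e) \<Rightarrow> real" where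
  "trace_sq J b I U = (\<Sum>\<beta>\<in>J. (\<Sum>i\<in>I. b \<beta> (U i) (U i))\<^sup>2)"

text \<open>This is the Cauchy-Schwarz inequality for \<open>(a\<^sub>i / \<surd>\<mu>, x)\<close> and \<open>(\<surd>\<mu>, 1)\<close> with its defect made explicit. The second
  summand of the defect contains the equality condition, and when it vanishes the first one vanishes as well.\<close>

lemma weighted_trace_identity:
  fixes a :: "nat \<Rightarrow> real"
  assumes "\<mu> > 0" "finite I" "real (card I) = k"
  shows "(k * \<mu> + 1) * ((\<Sum>i\<in>I. (a i)\<^sup>2) / \<mu> + x\<^sup>2) - ((\<Sum>i\<in>I. a i) + x)\<^sup>2
    = (k * (\<Sum>i\<in>I. (a i)\<^sup>2) - (\<Sum>i\<in>I. a i)\<^sup>2) + (\<Sum>i\<in>I. (a i - \<mu> * x)\<^sup>2) / \<mu>"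
proof -
  have "(\<Sum>i\<in>I. (a i - \<mu> * x)\<^sup>2) = (\<Sum>i\<in>I. (a i)\<^sup>2) - 2 * \<mu> * x * (\<Sum>i\<in>I. a i) + k * (\<mu> * x)\<^sup>2"
    using assms(3) by (simp add: power2_diff sum.distrib sum_subtractf sum_distrib_left sum_distrib_right algebra_simps)
  then show ?thesis using assms(1)
    by (simp add: field_simps power2_eq_square)
qed

lemma weighted_trace_bound:
  fixes a :: "nat \<Rightarrow> real"
  assumes "\<mu> > 0" "finite I" "real (card I) = k"
  shows "((\<Sum>i\<in>I. a i) + x)\<^sup>2 \<le> (k * \<mu> + 1) * ((\<Sum>i\<in>I. (a i)\<^sup>2) / \<mu> + x\<^sup>2)"
    and "((\<Sum>i\<in>I. a i) + x)\<^sup>2 = (k * \<mu> + 1) * ((\<Sum>i\<in>I. (a i)\<^sup>2) / \<mu> + x\<^sup>2) \<longleftrightarrow> (\<forall>i\<in>I. a i = \<mu> * x)"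
proof -
  note id = weighted_trace_identity[OF assms, of a x]
  have cs: "(\<Sum>i\<in>I. a i)\<^sup>2 \<le> k * (\<Sum>i\<in>I. (a i)\<^sup>2)"
    using sum_squared_le_sum_of_squares[of a I] assms(2,3) by (simp add: mult.commute)
  have nn: "(\<Sum>i\<in>I. (a i - \<mu> * x)\<^sup>2) / \<mu> \<ge> 0"
    using assms(1) by (intro divide_nonneg_pos sum_nonneg) auto
  show "((\<Sum>i\<in>I. a i) + x)\<^sup>2 \<le> (k * \<mu> + 1) * ((\<Sum>i\<in>I. (a i)\<^sup>2) / \<mu> + x\<^sup>2)"
    using id cs nn by linarith
  show "((\<Sum>i\<in>I. a i) + x)\<^sup>2 = (k * \<mu> + 1) * ((\<Sum>i\<in>I. (a i)\<^sup>2) / \<mu> + x\<^sup>2) \<longleftrightarrow> (\<forall>i\<in>I. a i = \<mu> * x)"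
  proof
    assume "((\<Sum>i\<in>I. a i) + x)\<^sup>2 = (k * \<mu> + 1) * ((\<Sum>i\<in>I. (a i)\<^sup>2) / \<mu> + x\<^sup>2)"
    then have "(\<Sum>i\<in>I. (a i - \<mu> * x)\<^sup>2) / \<mu> = 0" using id cs nn by linarith
    then have "(\<Sum>i\<in>I. (a i - \<mu> * x)\<^sup>2) = 0" using assms(1) by simp
    then show "\<forall>i\<in>I. a i = \<mu> * x" using assms(2) by (simp add: sum_nonneg_eq_0_iff)
  next
    assume e: "\<forall>i\<in>I. a i = \<mu> * x"
    then have s: "(\<Sum>i\<in>I. a i) = k * (\<mu> * x)" "(\<Sum>i\<in>I. (a i)\<^sup>2) = k * (\<mu> * x)\<^sup>2"
      using assms(3) by simp_all
    show "((\<Sum>i\<in>I. a i) + x)\<^sup>2 = (k * \<mu> + 1) * ((\<Sum>i\<in>I. (a i)\<^sup>2) / \<mu> + x\<^sup>2)"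
      unfolding s using assms(1) by (simp add: field_simps power2_eq_square)
  qed
qed

lemma sum_square_split:
  fixes c :: "nat \<Rightarrow> nat \<Rightarrow> real"
  assumes "finite I"
  shows "(\<Sum>i\<in>I. \<Sum>j\<in>I. c i j) = (\<Sum>i\<in>I. c i i) + (\<Sum>i\<in>I. \<Sum>j\<in>I - {i}. c i j)"
  unfolding sum.distrib[symmetric] by (intro sum.cong refl) (simp add: sum.remove[OF assms])

text \<open>The coefficient \<open>1/\<mu> - 1\<close> of the hyperplane part gives the first \<open>k\<close> diagonal entries the weight \<open>1/\<mu>\<close> and the last one
  the weight \<open>1\<close>, as in \<open>weighted_trace_bound\<close>. All off-diagonal entries have positive weight, so equality makes them vanish.\<close>

lemma single_form_bound:
  fixes c :: "nat \<Rightarrow> nat \<Rightarrow> real"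
  assumes l: "\<mu> > 0"
  defines "N \<equiv> \<lambda>k. \<Sum>i\<in>{1..k}. \<Sum>j\<in>{1..k}. (c i j)\<^sup>2"
  shows "(\<Sum>i\<in>{1..Suc k}. c i i)\<^sup>2 \<le> (real k * \<mu> + 1) * (N (Suc k) + (1 / \<mu> - 1) * N k)" (is "?S \<le> ?R")
    and "(\<Sum>i\<in>{1..Suc k}. c i i)\<^sup>2 = (real k * \<mu> + 1) * (N (Suc k) + (1 / \<mu> - 1) * N k) \<longleftrightarrow>
      (\<forall>i\<in>{1..k}. c i i = \<mu> * c (Suc k) (Suc k)) \<and> (\<forall>i\<in>{1..Suc k}. \<forall>j\<in>{1..Suc k}. i \<noteq> j \<longrightarrow> c i j = 0)"
      (is "_ \<longleftrightarrow> ?D \<and> ?O")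
proof -
  let ?r = "Suc k"
  define off where "off = (\<Sum>i\<in>{1..k}. \<Sum>j\<in>{1..k} - {i}. (c i j)\<^sup>2)"
  define edge where "edge = (\<Sum>i\<in>{1..k}. (c i ?r)\<^sup>2 + (c ?r i)\<^sup>2)"
  define dg where "dg = (\<Sum>i\<in>{1..k}. (c i i)\<^sup>2)"
  have Nk: "N k = dg + off" unfolding N_def dg_def off_def by (rule sum_square_split) simp
  have Nr: "N ?r = N k + edge + (c ?r ?r)\<^sup>2"
    unfolding N_def edge_def by (simp add: atLeastAtMostSuc_conv sum.distrib)
  have nn: "off \<ge> 0" "edge \<ge> 0" unfolding off_def edge_def by (auto intro!: sum_nonneg add_nonneg_nonneg)
  have R: "?R = (real k * \<mu> + 1) * (dg / \<mu> + (c ?r ?r)\<^sup>2) + (real k * \<mu> + 1) * (off / \<mu> + edge)"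
    unfolding Nr Nk using l by (simp add: field_simps)
  have S: "?S = ((\<Sum>i\<in>{1..k}. c i i) + c ?r ?r)\<^sup>2" by (simp add: atLeastAtMostSuc_conv add.commute)
  have kp: "real k * \<mu> + 1 > 0" using l by (simp add: add_nonneg_pos)
  have rest: "(real k * \<mu> + 1) * (off / \<mu> + edge) \<ge> 0" using kp nn l by simp
  note b = weighted_trace_bound[OF l, of "{1..k}" "real k" "\<lambda>i. c i i" "c ?r ?r", folded dg_def]
  show "?S \<le> ?R" unfolding R S using add_mono[OF b(1) rest] by simp
  have "?O \<longleftrightarrow> off = 0 \<and> edge = 0"
  proof
    assume ?O
    then show "off = 0 \<and> edge = 0" unfolding off_def edge_def by (auto intro!: sum.neutral)
  next
    assume z: "off = 0 \<and> edge = 0"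
    have 1: "c i j = 0" if "i \<in> {1..k}" "j \<in> {1..k}" "i \<noteq> j" for i j
    proof -
      have "(\<Sum>j\<in>{1..k} - {i}. (c i j)\<^sup>2) = 0"
        using z that(1) unfolding off_def by (auto simp: sum_nonneg sum_nonneg_eq_0_iff)
      then show ?thesis using that by (auto simp: sum_nonneg_eq_0_iff)
    qed
    have 2: "c i ?r = 0 \<and> c ?r i = 0" if "i \<in> {1..k}" for i
    proof -
      have "(c i ?r)\<^sup>2 + (c ?r i)\<^sup>2 = 0" using z that unfolding edge_def by (simp add: sum_nonneg_eq_0_iff)
      then show ?thesis by (simp add: sum_power2_eq_zero_iff)
    qed
    show ?O using 1 2 by (auto simp: atLeastAtMostSuc_conv)
  qed
  moreover have "off = 0 \<and> edge = 0 \<longleftrightarrow> (real k * \<mu> + 1) * (off / \<mu> + edge) = 0"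
    using kp nn l by (auto simp: add_nonneg_eq_0_iff)
  ultimately have O: "?O \<longleftrightarrow> (real k * \<mu> + 1) * (off / \<mu> + edge) = 0" by (rule trans)
  have split: "a = q + e \<longleftrightarrow> a = q \<and> e = 0" if "a \<le> q" "e \<ge> 0" for a q e :: real
    using that by linarith
  have fin: "finite {1..k}" "real (card {1..k}) = real k" by simp_all
  show "?S = ?R \<longleftrightarrow> ?D \<and> ?O"
    unfolding O R S split[OF b(1)[OF fin] rest] b(2)[OF fin] ..
qed

text \<open>The equality case, in the same basis for all components \<open>b \<beta>\<close>.\<close>

definition diagonal_form :: "real \<Rightarrow> nat set \<Rightarrow> (nat \<Rightarrow> 'e \<Rightarrow> 'e \<Rightarrow> real) \<Rightarrow> nat \<Rightarrow> (nat \<Rightarrow> 'e) \<Rightarrow> bool" where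
  "diagonal_form \<mu> J b r U \<longleftrightarrow> (\<forall>\<beta>\<in>J. (\<forall>i\<in>{1..r-1}. b \<beta> (U i) (U i) = \<mu> * b \<beta> (U r) (U r)) \<and>
     (\<forall>i\<in>{1..r}. \<forall>j\<in>{1..r}. i \<noteq> j \<longrightarrow> b \<beta> (U i) (U j) = 0))"

lemma family_bound:
  assumes l: "\<mu> > 0" and J: "finite J"
  shows "trace_sq J b {1..Suc k} U
      \<le> (real k * \<mu> + 1) * (sqnorm_on J b {1..Suc k} U + (1 / \<mu> - 1) * sqnorm_on J b {1..k} U)" (is "?S \<le> ?R")
    and "trace_sq J b {1..Suc k} U
      = (real k * \<mu> + 1) * (sqnorm_on J b {1..Suc k} U + (1 / \<mu> - 1) * sqnorm_on J b {1..k} U)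
      \<longleftrightarrow> diagonal_form \<mu> J b (Suc k) U"
proof -
  let ?s = "\<lambda>\<beta>. (\<Sum>i\<in>{1..Suc k}. b \<beta> (U i) (U i))\<^sup>2"
  let ?n = "\<lambda>\<beta> k. \<Sum>i\<in>{1..k}. \<Sum>j\<in>{1..k}. (b \<beta> (U i) (U j))\<^sup>2"
  let ?r = "\<lambda>\<beta>. (real k * \<mu> + 1) * (?n \<beta> (Suc k) + (1 / \<mu> - 1) * ?n \<beta> k)"
  have R: "?R = (\<Sum>\<beta>\<in>J. ?r \<beta>)"
    unfolding sqnorm_on_def by (simp only: sum_distrib_left[symmetric] sum.distrib)
  have le: "?s \<beta> \<le> ?r \<beta>" for \<beta> by (rule single_form_bound(1)[OF l])
  show "?S \<le> ?R" unfolding R trace_sq_def by (rule sum_mono[OF le])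
  have "?S = ?R \<longleftrightarrow> (\<Sum>\<beta>\<in>J. ?r \<beta> - ?s \<beta>) = 0" unfolding R trace_sq_def by (auto simp: sum_subtractf)
  also have "\<dots> \<longleftrightarrow> (\<forall>\<beta>\<in>J. ?r \<beta> - ?s \<beta> = 0)"
    by (rule sum_nonneg_eq_0_iff[OF J]) (use le in simp)
  also have "\<dots> \<longleftrightarrow> (\<forall>\<beta>\<in>J. ?s \<beta> = ?r \<beta>)" by auto
  also have "\<dots> \<longleftrightarrow> diagonal_form \<mu> J b (Suc k) U"
    unfolding diagonal_form_def diff_Suc_1
    by (intro ball_cong refl single_form_bound(2)[OF l])
  finally show "?S = ?R \<longleftrightarrow> diagonal_form \<mu> J b (Suc k) U" .
qed

context inner_form
begin

lemma sqnorm_on_indep: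
  assumes U: "orthonormal_basis B W I U" and I: "finite I"
    and U': "orthonormal_basis B W I' U'" and I': "finite I'"
    and b: "\<And>\<beta>. \<beta> \<in> J \<Longrightarrow> bilinear (b \<beta>)"
  shows "sqnorm_on J b I U = sqnorm_on J b I' U'"
  unfolding sqnorm_on_def
proof (rule sum.cong[OF refl])
  fix \<beta> assume "\<beta> \<in> J"
  note bl = b[OF this]
  have l: "linear (b \<beta> x)" "linear (\<lambda>x. b \<beta> x y)" for x y using bl by (auto simp: bilinear_def)
  have m1: "bilinear (\<lambda>u v. b \<beta> x u * b \<beta> x v)" "bilinear (\<lambda>u v. b \<beta> u y * b \<beta> v y)" for x y
    unfolding bilinear_def
    by (auto intro!: linearI simp: linear_add[OF l(1)] linear_cmul[OF l(1)] linear_add[OF l(2)]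
        linear_cmul[OF l(2)] algebra_simps)
  have "(\<Sum>i\<in>I. \<Sum>j\<in>I. (b \<beta> (U i) (U j))\<^sup>2) = (\<Sum>i\<in>I. \<Sum>j\<in>I'. (b \<beta> (U i) (U' j))\<^sup>2)"
    unfolding power2_eq_square by (intro sum.cong refl onb_bilinear_sum[OF U I U' I' m1(1)])
  also have "\<dots> = (\<Sum>j\<in>I'. \<Sum>i\<in>I. (b \<beta> (U i) (U' j))\<^sup>2)" by (rule sum.swap)
  also have "\<dots> = (\<Sum>j\<in>I'. \<Sum>i\<in>I'. (b \<beta> (U' i) (U' j))\<^sup>2)"
    unfolding power2_eq_square by (intro sum.cong refl onb_bilinear_sum[OF U I U' I' m1(2)])
  also have "\<dots> = (\<Sum>i\<in>I'. \<Sum>j\<in>I'. (b \<beta> (U' i) (U' j))\<^sup>2)" by (rule sum.swap)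
  finally show "(\<Sum>i\<in>I. \<Sum>j\<in>I. (b \<beta> (U i) (U j))\<^sup>2) = (\<Sum>i\<in>I'. \<Sum>j\<in>I'. (b \<beta> (U' i) (U' j))\<^sup>2)" .
qed

lemma trace_sq_indep:
  assumes U: "orthonormal_basis B W I U" and I: "finite I"
    and U': "orthonormal_basis B W I' U'" and I': "finite I'"
    and b: "\<And>\<beta>. \<beta> \<in> J \<Longrightarrow> bilinear (b \<beta>)"
  shows "trace_sq J b I U = trace_sq J b I' U'"
  unfolding trace_sq_def
  by (intro sum.cong refl arg_cong[where f = "\<lambda>x. x\<^sup>2"] onb_bilinear_sum[OF U I U' I' b])

text \<open>In a basis adapted to a hyperplane with unit normal \<open>n\<close> the squared norm of the restriction
  is \<open>|b|\<^sup>2 - 2 |b(n, _)|\<^sup>2 + b(n, n)\<^sup>2\<close>, a continuous function on the unit sphere of \<open>V\<close>, so it attains its bounds.\<close>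

lemma extremal_hyperplane:
  fixes \<epsilon> :: real
  assumes V: "subspace V" "dim V = Suc k" and J: "finite J"
    and b: "\<And>\<beta>. \<beta> \<in> J \<Longrightarrow> bilinear (b \<beta>)" and sym: "\<And>\<beta> u v. \<beta> \<in> J \<Longrightarrow> b \<beta> u v = b \<beta> v u"
  obtains L where "L \<in> hyperplanes V"
    "\<And>L'. L' \<in> hyperplanes V \<Longrightarrow>
      \<epsilon> * sqnorm_on J b {1..k} (some_onb B L) \<le> \<epsilon> * sqnorm_on J b {1..k} (some_onb B L')"
proof -
  let ?r = "Suc k"
  obtain U where U: "orthonormal_basis B V {1..?r} U" using onb_exists[OF V(1)] V(2) by auto
  define q where "q n = (\<Sum>\<beta>\<in>J. (\<Sum>i\<in>{1..?r}. \<Sum>j\<in>{1..?r}. (b \<beta> (U i) (U j))\<^sup>2)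
      - 2 * (\<Sum>j\<in>{1..?r}. (b \<beta> n (U j))\<^sup>2) + (b \<beta> n n)\<^sup>2)" for n
  have q: "sqnorm_on J b {1..k} U' = q (U' ?r)" if U': "orthonormal_basis B V {1..?r} U'" for U'
  proof -
    have "(\<Sum>i\<in>{1..k}. \<Sum>j\<in>{1..k}. (b \<beta> (U' i) (U' j))\<^sup>2)
      = (\<Sum>i\<in>{1..?r}. \<Sum>j\<in>{1..?r}. (b \<beta> (U i) (U j))\<^sup>2)
      - 2 * (\<Sum>j\<in>{1..?r}. (b \<beta> (U' ?r) (U j))\<^sup>2) + (b \<beta> (U' ?r) (U' ?r))\<^sup>2" if \<beta>: "\<beta> \<in> J" for \<beta>
    proof -
      have "(\<Sum>i\<in>{1..?r}. \<Sum>j\<in>{1..?r}. (b \<beta> (U i) (U j))\<^sup>2) = (\<Sum>i\<in>{1..?r}. \<Sum>j\<in>{1..?r}. (b \<beta> (U' i) (U' j))\<^sup>2)"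
        using sqnorm_on_indep[OF U _ U', of "{\<beta>}" b] b \<beta> by (simp add: sqnorm_on_def)
      moreover have "(\<Sum>j\<in>{1..?r}. (b \<beta> (U' ?r) (U j))\<^sup>2) = (\<Sum>j\<in>{1..?r}. (b \<beta> (U' ?r) (U' j))\<^sup>2)"
      proof -
        have l: "linear (b \<beta> x)" for x using b[OF \<beta>] by (auto simp: bilinear_def)
        have "bilinear (\<lambda>u v. b \<beta> (U' ?r) u * b \<beta> (U' ?r) v)"
          unfolding bilinear_def
          by (auto intro!: linearI simp: linear_add[OF l] linear_cmul[OF l] algebra_simps)
        from onb_bilinear_sum[OF U _ U' _ this] show ?thesis by (simp add: power2_eq_square)
      qed
      moreover have "(\<Sum>i\<in>{1..k}. (b \<beta> (U' i) (U' ?r))\<^sup>2) = (\<Sum>i\<in>{1..k}. (b \<beta> (U' ?r) (U' i))\<^sup>2)"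
        by (simp add: sym[OF \<beta>, of _ "U' ?r"])
      ultimately show ?thesis by (simp add: atLeastAtMostSuc_conv sum.distrib)
    qed
    then show ?thesis unfolding sqnorm_on_def q_def by simp
  qed
  \<comment> \<open>Hyperplanes and unit normals produce the same values, so an extremal unit normal gives an extremal hyperplane.\<close>
  have hyp: "\<exists>n. n \<in> V \<and> B n n = 1 \<and> sqnorm_on J b {1..k} (some_onb B L) = q n" if L: "L \<in> hyperplanes V" for L
  proof -
    have L': "subspace L" "dim L = k" using L V by (auto simp: hyperplanes_def)
    have sL: "orthonormal_basis B L {1..k} (some_onb B L)" using some_onb[OF L'(1)] L'(2) by simp
    obtain u where u: "orthonormal_basis B V {1..?r} ((some_onb B L)(?r := u))"
      using hyperplane_adapted_basis[OF V L sL] by blast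
    have "sqnorm_on J b {1..k} (some_onb B L) = sqnorm_on J b {1..k} ((some_onb B L)(?r := u))"
      unfolding sqnorm_on_def by simp
    then show ?thesis using q[OF u] onb_in[OF u, of ?r] onb_inner[OF u, of ?r ?r] by auto
  qed
  have conv: "\<exists>L\<in>hyperplanes V. sqnorm_on J b {1..k} (some_onb B L) = q n" if n: "n \<in> V" "B n n = 1" for n
  proof -
    let ?L = "{v \<in> V. B v n = 0}"
    have sL: "subspace ?L" using V(1) unfolding subspace_def by (simp add: B_simps)
    obtain U0 where U0: "orthonormal_basis B ?L {1..dim ?L} U0" using onb_exists[OF sL] by blast
    have U1: "orthonormal_basis B V {1..Suc (dim ?L)} (U0(Suc (dim ?L) := n))"
      unfolding orthonormal_basis_def
    proof (intro conjI ballI)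
      fix i j assume "i \<in> {1..Suc (dim ?L)}" "j \<in> {1..Suc (dim ?L)}"
      moreover have "B (U0 i) n = 0" "B n (U0 i) = 0" if "i \<in> {1..dim ?L}" for i
        using onb_in[OF U0 that] sym_B[of n] by auto
      ultimately show "B ((U0(Suc (dim ?L) := n)) i) ((U0(Suc (dim ?L) := n)) j) = (if i = j then 1 else 0)"
        using onb_inner[OF U0, of i j] n(2) by (auto simp: le_Suc_eq)
    next
      have im: "(U0(Suc (dim ?L) := n)) ` {1..Suc (dim ?L)} = insert n (U0 ` {1..dim ?L})"
        by (auto simp: atLeastAtMostSuc_conv)
      show "span ((U0(Suc (dim ?L) := n)) ` {1..Suc (dim ?L)}) = V"
        unfolding im
      proof
        show "span (insert n (U0 ` {1..dim ?L})) \<subseteq> V"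
          using n V onb_in[OF U0] by (intro span_minimal) auto
        show "V \<subseteq> span (insert n (U0 ` {1..dim ?L}))"
        proof
          fix v assume v: "v \<in> V"
          have "v - B v n *\<^sub>R n \<in> ?L"
            using v n V(1) by (simp add: subspace_diff subspace_scale B_simps)
          then have "v - B v n *\<^sub>R n \<in> span (U0 ` {1..dim ?L})" using U0 unfolding orthonormal_basis_def by blast
          then show "v \<in> span (insert n (U0 ` {1..dim ?L}))" using span_breakdown_eq by blast
        qed
      qed
    qed
    have "dim ?L = k" using onb_dim[OF U1] V(2) by simp
    then have L: "?L \<in> hyperplanes V" and U1': "orthonormal_basis B V {1..?r} (U0(?r := n))"
      and U0': "orthonormal_basis B ?L {1..k} U0"
      using sL V(2) U1 U0 by (auto simp: hyperplanes_def)
    have sb: "orthonormal_basis B ?L {1..k} (some_onb B ?L)" using some_onb[OF sL] \<open>dim ?L = k\<close> by simp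
    have "sqnorm_on J b {1..k} (some_onb B ?L) = sqnorm_on J b {1..k} U0"
      by (rule sqnorm_on_indep[OF sb _ U0' _ b]) auto
    also have "\<dots> = sqnorm_on J b {1..k} (U0(?r := n))" unfolding sqnorm_on_def by simp
    finally show ?thesis using q[OF U1'] L by auto
  qed
  have cq: "continuous_on {n \<in> V. B n n = 1} (\<lambda>n. \<epsilon> * q n)"
  proof -
    have bb: "bounded_bilinear (b \<beta>)" if "\<beta> \<in> J" for \<beta>
      using b[OF that] bilinear_conv_bounded_bilinear by blast
    show ?thesis unfolding q_def
      by (intro continuous_on_mult continuous_on_const continuous_on_sum continuous_on_add continuous_on_diff
          continuous_on_power bounded_bilinear.continuous_on[OF bb] continuous_on_id)
  qed
  have "U ?r \<in> {n \<in> V. B n n = 1}" using onb_in[OF U] onb_inner[OF U] by simp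
  then obtain n where n: "n \<in> V" "B n n = 1" "\<And>n'. n' \<in> V \<Longrightarrow> B n' n' = 1 \<Longrightarrow> \<epsilon> * q n \<le> \<epsilon> * q n'"
    using continuous_attains_inf[OF unit_sphere_compact[OF V(1)] _ cq] by auto
  obtain L where L: "L \<in> hyperplanes V" "sqnorm_on J b {1..k} (some_onb B L) = q n" using conv[OF n(1,2)] by blast
  show ?thesis
  proof (rule that[OF L(1)])
    fix L' assume "L' \<in> hyperplanes V"
    from hyp[OF this] show "\<epsilon> * sqnorm_on J b {1..k} (some_onb B L) \<le> \<epsilon> * sqnorm_on J b {1..k} (some_onb B L')"
      using n(3) L(2) by auto
  qed
qed

text \<open>A basis adapted to the optimal hyperplane proves the inequality and shows that equality is a diagonal form. Conversely, a basis of diagonal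
  form gives equality for its own hyperplane, and the optimal hyperplane has a right side that is at most as large.
  The sign of \<open>1/\<mu> - 1\<close> decides whether optimal means minimal or maximal norm.\<close>

theorem casorati_optimal:
  assumes l: "\<mu> > 0" and V: "subspace V" "dim V = Suc k" and J: "finite J"
    and b: "\<And>\<beta>. \<beta> \<in> J \<Longrightarrow> bilinear (b \<beta>)"
    and L: "L \<in> hyperplanes V"
    and opt: "\<And>L'. L' \<in> hyperplanes V \<Longrightarrow>
      (1 / \<mu> - 1) * sqnorm_on J b {1..k} (some_onb B L) \<le> (1 / \<mu> - 1) * sqnorm_on J b {1..k} (some_onb B L')"
  defines "S \<equiv> trace_sq J b {1..Suc k} (some_onb B V)"
    and "R \<equiv> (real k * \<mu> + 1) * (sqnorm_on J b {1..Suc k} (some_onb B V)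
        + (1 / \<mu> - 1) * sqnorm_on J b {1..k} (some_onb B L))"
  shows "S \<le> R" "S = R \<longleftrightarrow> (\<exists>U. orthonormal_basis B V {1..Suc k} U \<and> diagonal_form \<mu> J b (Suc k) U)"
proof -
  have oV: "orthonormal_basis B V {1..Suc k} (some_onb B V)" using some_onb[OF V(1)] V(2) by simp
  have oL: "orthonormal_basis B L {1..k} (some_onb B L)" if "L \<in> hyperplanes V" for L
    using some_onb[of L] that V(2) by (auto simp: hyperplanes_def)
  obtain u where u: "orthonormal_basis B V {1..Suc k} ((some_onb B L)(Suc k := u))" (is "orthonormal_basis B V _ ?U")
    using hyperplane_adapted_basis[OF V L oL[OF L]] by blast
  have S: "S = trace_sq J b {1..Suc k} U" if "orthonormal_basis B V {1..Suc k} U" for U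
    unfolding S_def by (rule trace_sq_indep[OF oV _ that _ b]) auto
  have NV: "sqnorm_on J b {1..Suc k} (some_onb B V) = sqnorm_on J b {1..Suc k} U"
    if "orthonormal_basis B V {1..Suc k} U" for U
    by (rule sqnorm_on_indep[OF oV _ that _ b]) auto
  have NL: "sqnorm_on J b {1..k} (some_onb B L) = sqnorm_on J b {1..k} ?U" unfolding sqnorm_on_def by simp
  note fb = family_bound[OF l J, where k = k and b = b and U = ?U]
  have RU: "R = (real k * \<mu> + 1) * (sqnorm_on J b {1..Suc k} ?U + (1 / \<mu> - 1) * sqnorm_on J b {1..k} ?U)"
    unfolding R_def NV[OF u] NL ..
  show le: "S \<le> R" unfolding RU S[OF u] by (rule fb(1))
  show "S = R \<longleftrightarrow> (\<exists>U. orthonormal_basis B V {1..Suc k} U \<and> diagonal_form \<mu> J b (Suc k) U)"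
  proof
    assume "S = R"
    then have "diagonal_form \<mu> J b (Suc k) ?U" unfolding RU S[OF u] fb(2) .
    then show "\<exists>U. orthonormal_basis B V {1..Suc k} U \<and> diagonal_form \<mu> J b (Suc k) U" using u by blast
  next
    assume "\<exists>U. orthonormal_basis B V {1..Suc k} U \<and> diagonal_form \<mu> J b (Suc k) U"
    then obtain U where U: "orthonormal_basis B V {1..Suc k} U" "diagonal_form \<mu> J b (Suc k) U" by blast
    let ?L = "span (U ` {1..k})"
    note nh = normal_hyperplane[OF U(1)]
    have e: "sqnorm_on J b {1..k} (some_onb B ?L) = sqnorm_on J b {1..k} U"
      by (rule sqnorm_on_indep[OF oL[OF nh(1)] _ nh(2) _ b]) auto
    have "S = (real k * \<mu> + 1) * (sqnorm_on J b {1..Suc k} (some_onb B V)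
        + (1 / \<mu> - 1) * sqnorm_on J b {1..k} (some_onb B ?L))"
      unfolding S[OF U(1)] NV[OF U(1)] e using family_bound(2)[OF l J] U(2) by blast
    moreover have "real k * \<mu> + 1 \<ge> 0" using l by simp
    ultimately have "R \<le> S" unfolding R_def using opt[OF nh(1)] by (simp add: mult_left_mono)
    then show "S = R" using le by simp
  qed
qed

end

section \<open>Fibres of a Riemannian submersion\<close>

lemma orth_comp_alt: "x \<in> orth_comp B W \<Longrightarrow> w \<in> W \<Longrightarrow> B x w = 0"
  by (simp add: orth_comp_def)

locale submersion = riemannian_atlas M g + base: chart_atlas N
  for M :: "('a, 'e::euclidean_space) manifold" and g :: "('a, 'e) metric"
    and N :: "('b, 'f::euclidean_space) manifold" +
  fixes F :: "'a \<Rightarrow> 'b"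
  assumes covered: "q \<in> pts M \<Longrightarrow> \<exists>c\<in>atlas M. q \<in> fst c"
    and base_covered: "x \<in> pts N \<Longrightarrow> \<exists>e\<in>atlas N. x \<in> fst e"
    and continuous_F: "continuous_map (mtop M) (mtop N) F"
    and smooth_F: "c \<in> atlas M \<Longrightarrow> e \<in> atlas N \<Longrightarrow>
      smooth_on (snd c ` {q \<in> fst c. F q \<in> fst e}) (snd e \<circ> F \<circ> pt c)"
    and surj_differential: "q \<in> pts M \<Longrightarrow> surj (differential M N F q)"
begin

lemma in_pts: "c \<in> atlas M \<Longrightarrow> q \<in> fst c \<Longrightarrow> q \<in> pts M"
  using openin_subset[OF is_chart_openin[OF chart]] by blast

lemma F_in_base_chart:
  assumes "c \<in> atlas M" "q \<in> fst c"
  shows "chart_at N (F q) \<in> atlas N" "F q \<in> fst (chart_at N (F q))"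
proof -
  have "F q \<in> pts N"
    using continuous_F in_pts[OF assms] by (auto simp: continuous_map_def Pi_iff)
  then obtain e where "e \<in> atlas N" "F q \<in> fst e" using base_covered by blast
  from chart_at_in[OF this] show "chart_at N (F q) \<in> atlas N" "F q \<in> fst (chart_at N (F q))" .
qed

definition F_in_charts :: "('a, 'e) chart \<Rightarrow> ('b, 'f) chart \<Rightarrow> 'e \<Rightarrow> 'f" where
  "F_in_charts c e = snd e \<circ> F \<circ> pt c"

definition rep_dom :: "('a, 'e) chart \<Rightarrow> ('b, 'f) chart \<Rightarrow> 'e set" where
  "rep_dom c e = snd c ` {q \<in> fst c. F q \<in> fst e}"

lemma openin_vimage_F: "e \<in> atlas N \<Longrightarrow> openin (mtop M) {q \<in> pts M. F q \<in> fst e}"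
  using openin_continuous_map_preimage[OF continuous_F is_chart_openin[OF base.chart]] .

lemma open_rep_dom:
  assumes c: "c \<in> atlas M" and e: "e \<in> atlas N"
  shows "open (rep_dom c e)"
proof -
  have "{q \<in> fst c. F q \<in> fst e} = fst c \<inter> {q \<in> pts M. F q \<in> fst e}"
    using in_pts[OF c] by auto
  then show ?thesis
    unfolding rep_dom_def using coord_image_open[OF chart[OF c] openin_vimage_F[OF e]] by simp
qed

lemma smooth_rep: "c \<in> atlas M \<Longrightarrow> e \<in> atlas N \<Longrightarrow> smooth_on (rep_dom c e) (F_in_charts c e)"
  unfolding rep_dom_def F_in_charts_def by (rule smooth_F)

lemma rep_dom_subset: "rep_dom c e \<subseteq> snd c ` fst c"
  unfolding rep_dom_def by auto

lemma in_rep_dom: "q \<in> fst c \<Longrightarrow> F q \<in> fst e \<Longrightarrow> snd c q \<in> rep_dom c e"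
  unfolding rep_dom_def by auto

lemma rep_has_derivative:
  assumes "c \<in> atlas M" "e \<in> atlas N" "q \<in> fst c" "F q \<in> fst e"
  shows "(F_in_charts c e has_derivative FD (F_in_charts c e) (snd c q)) (at (snd c q))"
  by (rule smooth_on_has_derivative[OF smooth_rep[OF assms(1,2)] in_rep_dom[OF assms(3,4)]])

lemma rep_coord: "c \<in> atlas M \<Longrightarrow> q \<in> fst c \<Longrightarrow> F_in_charts c e (snd c q) = snd e (F q)"
  by (simp add: F_in_charts_def pt_coord[OF chart])

lemma rep_chain:
  assumes c: "c \<in> atlas M" "q \<in> fst c" and c': "c' \<in> atlas M" "q \<in> fst c'"
    and e: "e \<in> atlas N" "F q \<in> fst e" and e': "e' \<in> atlas N" "F q \<in> fst e'"
  shows "FD (F_in_charts c e) (snd c q) u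
    = Dtr e' e (F q) (FD (F_in_charts c' e') (snd c' q) (Dtr c c' q u))"
proof -
  let ?h = "(snd e \<circ> pt e') \<circ> (F_in_charts c' e' \<circ> (snd c' \<circ> pt c))"
  have 1: "((snd c' \<circ> pt c) has_derivative Dtr c c' q) (at (snd c q))"
    by (rule transition_has_derivative[OF c(1) c'(1) c(2) c'(2)])
  have p1: "(snd c' \<circ> pt c) (snd c q) = snd c' q" by (simp add: pt_coord[OF chart[OF c(1)] c(2)])
  have 2: "((F_in_charts c' e' \<circ> (snd c' \<circ> pt c)) has_derivative FD (F_in_charts c' e') (snd c' q) \<circ> Dtr c c' q) (at (snd c q))"
    by (rule diff_chain_at[OF 1]) (simp only: p1 rep_has_derivative[OF c'(1) e'(1) c'(2) e'(2)])
  have p2: "(F_in_charts c' e' \<circ> (snd c' \<circ> pt c)) (snd c q) = snd e' (F q)"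
    using p1 rep_coord[OF c', of e'] by simp
  have 3: "(?h has_derivative Dtr e' e (F q) \<circ> (FD (F_in_charts c' e') (snd c' q) \<circ> Dtr c c' q)) (at (snd c q))"
    by (rule diff_chain_at[OF 2])
      (simp only: p2 base.transition_has_derivative[OF e'(1) e(1) e'(2) e(2)])
  let ?W = "snd c ` (fst c \<inter> fst c') \<inter> rep_dom c e'"
  have D: "(F_in_charts c e has_derivative Dtr e' e (F q) \<circ> (FD (F_in_charts c' e') (snd c' q) \<circ> Dtr c c' q)) (at (snd c q))"
  proof (rule has_derivative_transform_within_open[OF 3])
    show "open ?W" by (intro open_Int open_overlap[OF c(1) c'(1)] open_rep_dom[OF c(1) e'(1)])
    show "snd c q \<in> ?W" using c c' in_rep_dom[OF c(2) e'(2)] by auto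
    fix z assume z: "z \<in> ?W"
    then obtain q' where q': "q' \<in> fst c" "q' \<in> fst c'" "z = snd c q'" by auto
    obtain q'' where q'': "q'' \<in> fst c" "F q'' \<in> fst e'" "z = snd c q''"
      using z unfolding rep_dom_def by auto
    have "q' = q''" using inj_onD[OF is_chart_inj[OF chart[OF c(1)]], of q' q''] q' q'' by auto
    then show "?h z = F_in_charts c e z"
      using q' q'' by (simp add: F_in_charts_def pt_coord[OF chart[OF c(1)]] pt_coord[OF chart[OF c'(1)]]
          pt_coord[OF base.chart[OF e'(1)]])
  qed
  show ?thesis unfolding FD_eqI[OF D] by simp
qed

lemma differential_rep: "differential M N F q = FD (F_in_charts (chart_at M q) (chart_at N (F q))) (snd (chart_at M q) q)"
  by (simp add: differential_def F_in_charts_def)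

lemma rep_differential:
  assumes c: "c \<in> atlas M" "q \<in> fst c" and e: "e \<in> atlas N" "F q \<in> fst e"
  shows "FD (F_in_charts c e) (snd c q) u
    = Dtr (chart_at N (F q)) e (F q) (differential M N F q (from_chart M c q u))"
  unfolding differential_rep from_chart_eq
  by (rule rep_chain[OF c chart_at_in[OF c] e F_in_base_chart[OF c]])

text \<open>The differential is computed in the charts selected at \<open>q\<close>; in other charts around \<open>q\<close> the vertical vectors
  still form the kernel.\<close>

lemma rep_kernel:
  assumes c: "c \<in> atlas M" "q \<in> fst c" and e: "e \<in> atlas N" "F q \<in> fst e"
  shows "FD (F_in_charts c e) (snd c q) u = 0 \<longleftrightarrow> from_chart M c q u \<in> vert M N F q"
proof -
  note e' = F_in_base_chart[OF c]
  have "Dtr (chart_at N (F q)) e (F q) x = 0 \<longleftrightarrow> x = 0" for x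
    using base.Dtr_inverse[OF e' e, of x] linear_0[OF base.linear_Dtr[OF e(1) e'(1) e(2) e'(2)]]
      linear_0[OF base.linear_Dtr[OF e'(1) e(1) e'(2) e(2)]] by metis
  then show ?thesis unfolding rep_differential[OF c e] vert_def by simp
qed

lemma rep_surj:
  assumes c: "c \<in> atlas M" "q \<in> fst c" and e: "e \<in> atlas N" "F q \<in> fst e"
  obtains u where "FD (F_in_charts c e) (snd c q) u = y"
proof -
  note e' = F_in_base_chart[OF c] and c' = chart_at_in[OF c]
  obtain v where v: "differential M N F q v = Dtr e (chart_at N (F q)) (F q) y"
    using surj_differential[OF in_pts[OF c]] by (metis surjD)
  have "from_chart M c q (Dtr (chart_at M q) c q v) = v"
    unfolding from_chart_eq by (rule Dtr_inverse[OF c' c])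
  then have "FD (F_in_charts c e) (snd c q) (Dtr (chart_at M q) c q v) = y"
    unfolding rep_differential[OF c e] by (simp add: v base.Dtr_inverse[OF e e'])
  then show ?thesis by (rule that)
qed

lemma linear_rep:
  "c \<in> atlas M \<Longrightarrow> q \<in> fst c \<Longrightarrow> e \<in> atlas N \<Longrightarrow> F q \<in> fst e \<Longrightarrow> linear (FD (F_in_charts c e) (snd c q))"
  by (rule smooth_on_linear_FD[OF smooth_rep in_rep_dom])

lemma linear_differential: "c \<in> atlas M \<Longrightarrow> q \<in> fst c \<Longrightarrow> linear (differential M N F q)"
  unfolding differential_rep by (rule linear_rep[OF chart_at_in F_in_base_chart])

lemma subspace_vert: "c \<in> atlas M \<Longrightarrow> q \<in> fst c \<Longrightarrow> subspace (vert M N F q)"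
  unfolding vert_def by (rule linear_subspace_kernel[OF linear_differential])

lemma inner_form_metric: "c \<in> atlas M \<Longrightarrow> q \<in> fst c \<Longrightarrow> inner_form (g q)"
  using metric_at by unfold_locales auto

text \<open>Completing a local representation of the submersion by a linear map that is injective on the
  vertical space gives a local diffeomorphism; its second component restricts to coordinates on the fibre.\<close>

lemma fibre_chart_exists:
  assumes p: "p \<in> pts M" and dim: "dim (vert M N F p) = DIM('v::euclidean_space)"
  shows "\<exists>d\<in>atlas (fibre M F p :: ('a, 'v) manifold). p \<in> fst d"
proof -
  define S where "S = {q \<in> pts M. F q = F p}"
  obtain c0 where c0: "c0 \<in> atlas M" "p \<in> fst c0" using covered[OF p] by blast
  define c where "c = chart_at M p"
  define e where "e = chart_at N (F p)"
  have c: "c \<in> atlas M" "p \<in> fst c" using chart_at_in[OF c0] by (auto simp: c_def)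
  have e: "e \<in> atlas N" "F p \<in> fst e" using F_in_base_chart[OF c] by (auto simp: e_def)
  let ?\<Phi> = "F_in_charts c e" and ?O = "rep_dom c e" and ?z = "snd c p"
  let ?A = "FD ?\<Phi> ?z"
  have A: "?A = differential M N F p" by (simp add: differential_rep c_def e_def)
  note oO = open_rep_dom[OF c(1) e(1)] and s\<Phi> = smooth_rep[OF c(1) e(1)] and zO = in_rep_dom[OF c(2) e(2)]
  have sV: "subspace (vert M N F p)" by (rule subspace_vert[OF c])
  obtain \<pi> :: "'e \<Rightarrow> 'v" where \<pi>: "linear \<pi>" "\<pi> ` vert M N F p = UNIV" "inj_on \<pi> (vert M N F p)"
    using subspace_isomorphism[OF sV subspace_UNIV, where ?'b = 'v] dim by (auto simp: dim_UNIV)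
  have b\<pi>: "bounded_linear \<pi>" using \<pi>(1) linear_linear by blast
  let ?\<Psi> = "\<lambda>z. (?\<Phi> z, \<pi> z)"
  have s\<Psi>: "smooth_on ?O ?\<Psi>"
    by (rule smooth_on_Pair[OF oO s\<Phi> smooth_on_linear[OF oO b\<pi> smooth_on_ident[OF oO]]])
  have d\<Psi>: "FD ?\<Psi> ?z = (\<lambda>v. (?A v, \<pi> v))"
    by (rule FD_eqI[OF has_derivative_Pair[OF smooth_on_has_derivative[OF s\<Phi> zO] bounded_linear_imp_has_derivative[OF b\<pi>]]])
  have lA: "linear ?A" by (rule linear_rep[OF c e])
  have inj: "inj (\<lambda>v. (?A v, \<pi> v))"
  proof (rule injI)
    fix u v assume eq: "(?A u, \<pi> u) = (?A v, \<pi> v)"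
    then have "?A (u - v) = 0" by (simp add: linear_diff[OF lA])
    then have 1: "u - v \<in> vert M N F p" unfolding A vert_def by simp
    have "\<pi> (u - v) = \<pi> 0" using eq by (simp add: linear_diff[OF \<pi>(1)] linear_0[OF \<pi>(1)])
    then have "u - v = 0" using inj_onD[OF \<pi>(3) _ 1 subspace_0[OF sV]] by blast
    then show "u = v" by simp
  qed
  have surj: "surj (\<lambda>v. (?A v, \<pi> v))"
  proof -
    have "\<exists>v. (?A v, \<pi> v) = (y, w)" for y w
    proof -
      obtain v0 where v0: "?A v0 = y" using rep_surj[OF c e] by metis
      have "w - \<pi> v0 \<in> \<pi> ` vert M N F p" using \<pi>(2) by simp
      then obtain k where k: "k \<in> vert M N F p" "\<pi> k = w - \<pi> v0" by auto
      then have "?A k = 0" unfolding A vert_def by simp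
      then have "(?A (v0 + k), \<pi> (v0 + k)) = (y, w)"
        using v0 k(2) by (simp add: linear_add[OF lA] linear_add[OF \<pi>(1)])
      then show ?thesis by blast
    qed
    then show ?thesis unfolding surj_def by (metis surj_pair)
  qed
  have "bij (FD ?\<Psi> ?z)" unfolding d\<Psi> using inj surj by (simp add: bij_def)
  then obtain U V k where k: "open U" "U \<subseteq> ?O" "?z \<in> U" "open V" "homeomorphism U V ?\<Psi> k" "smooth_on V k"
    using smooth_inverse_function[OF oO s\<Psi> zO] by metis
  define y0 where "y0 = snd e (F p)"
  define W where "W = (\<lambda>w. (y0, w)) -` V"
  have cW: "continuous_on UNIV (\<lambda>w::'v. (y0, w))" by (intro continuous_intros)
  have oW: "open W" unfolding W_def by (rule open_vimage[OF k(4) cW])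
  \<comment> \<open>On the fibre the first component of \<open>?\<Psi>\<close> has the constant value \<open>y0\<close>, so \<open>x\<close> is a coordinate map and \<open>\<sigma>\<close> its inverse in
    the coordinates of \<open>c\<close>.\<close>
  define D where "D = S \<inter> {q \<in> fst c. snd c q \<in> U}"
  define x where "x q = \<pi> (snd c q)" for q
  define d where "d = (D, x)"
  define \<sigma> where "\<sigma> w = k (y0, w)" for w
  have kU: "k v \<in> U" "?\<Psi> (k v) = v" if "v \<in> V" for v using k(5) that by (auto simp: homeomorphism_def)
  have k\<Psi>: "k (?\<Psi> z) = z" "?\<Psi> z \<in> V" if "z \<in> U" for z using k(5) that by (auto simp: homeomorphism_def)
  have \<sigma>U: "\<sigma> w \<in> U" "?\<Phi> (\<sigma> w) = y0" "\<pi> (\<sigma> w) = w" if "w \<in> W" for w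
    using kU[of "(y0, w)"] that by (auto simp: W_def \<sigma>_def)
  have \<sigma>O: "\<sigma> w \<in> ?O" "\<sigma> w \<in> snd c ` fst c" if "w \<in> W" for w
    using \<sigma>U[OF that] k(2) rep_dom_subset by blast+
  have \<sigma>D: "pt c (\<sigma> w) \<in> D" "snd c (pt c (\<sigma> w)) = \<sigma> w" "x (pt c (\<sigma> w)) = w" if w: "w \<in> W" for w
  proof -
    obtain q where q: "q \<in> fst c" "F q \<in> fst e" "\<sigma> w = snd c q"
      using \<sigma>O(1)[OF w] unfolding rep_dom_def by auto
    have pq: "pt c (\<sigma> w) = q" by (simp add: q(3) pt_coord[OF chart[OF c(1)] q(1)])
    have "snd e (F q) = snd e (F p)"
      using \<sigma>U(2)[OF w] rep_coord[OF c(1) q(1), of e] q(3) by (simp add: y0_def)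
    then have "F q = F p" using inj_onD[OF is_chart_inj[OF base.chart[OF e(1)]]] q(2) e(2) by blast
    then show "pt c (\<sigma> w) \<in> D"
      unfolding pq using q in_pts[OF c(1) q(1)] \<sigma>U(1)[OF w] \<open>F q = F p\<close> by (simp add: D_def S_def)
    show "snd c (pt c (\<sigma> w)) = \<sigma> w" unfolding pq by (rule q(3)[symmetric])
    then show "x (pt c (\<sigma> w)) = w" using \<sigma>U(3)[OF w] by (simp add: x_def)
  qed
  have xD: "x q \<in> W" "\<sigma> (x q) = snd c q" "pt c (\<sigma> (x q)) = q" if q: "q \<in> D" for q
  proof -
    have q': "q \<in> fst c" "F q = F p" "snd c q \<in> U" using q by (auto simp: D_def S_def)
    have e: "?\<Psi> (snd c q) = (y0, x q)" using q' rep_coord[OF c(1) q'(1), of e] by (simp add: y0_def x_def)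
    show "x q \<in> W" using k\<Psi>(2)[OF q'(3)] unfolding e by (simp add: W_def)
    show s: "\<sigma> (x q) = snd c q" using k\<Psi>(1)[OF q'(3)] unfolding e by (simp add: \<sigma>_def)
    show "pt c (\<sigma> (x q)) = q" unfolding s by (rule pt_coord[OF chart[OF c(1)] q'(1)])
  qed
  have xW: "x ` D = W" using xD(1) \<sigma>D by (auto simp: image_iff) metis
  have injx: "inj_on x D" by (rule inj_onI) (metis xD(3))
  have ptd: "pt d w = pt c (\<sigma> w)" if "w \<in> W" for w
    unfolding pt_def d_def fst_conv snd_conv
    using inv_into_f_f[OF injx \<sigma>D(1)[OF that]] \<sigma>D(3)[OF that] by (simp add: pt_def)
  let ?X = "subtopology (mtop M) S"
  have oD: "openin ?X D"
    unfolding D_def using coord_preimage_open[OF chart[OF c(1)] k(1)] by (simp add: openin_subtopology_Int2)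
  have tD: "topspace (subtopology ?X D) = D"
    using openin_subset[OF oD] by auto
  have Dc: "D \<subseteq> fst c" by (auto simp: D_def)
  have s\<sigma>: "smooth_on W \<sigma>"
    unfolding \<sigma>_def
  proof (rule smooth_on_compose[OF oW k(4) _ k(6)])
    show "smooth_on W (\<lambda>w. (y0, w))" by (intro smooth_on_Pair smooth_on_const smooth_on_ident oW)
  qed (auto simp: W_def)
  have hm: "homeomorphic_maps (subtopology ?X D) (top_of_set W) x (\<lambda>w. pt c (\<sigma> w))"
    unfolding homeomorphic_maps_def
  proof (intro conjI ballI)
    have sub: "subtopology ?X D = subtopology (subtopology (mtop M) (fst c)) D"
      using Dc by (simp add: subtopology_subtopology D_def Int_absorb1 Int_commute)
    have "continuous_map (subtopology (subtopology (mtop M) (fst c)) D) euclidean (snd c)"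
      by (rule continuous_map_from_subtopology[OF coord_continuous[OF chart[OF c(1)]]])
    then have "continuous_map (subtopology ?X D) euclidean (\<pi> \<circ> snd c)"
      unfolding sub by (rule continuous_map_compose) (simp add: linear_continuous_on[OF b\<pi>])
    then show "continuous_map (subtopology ?X D) (top_of_set W) x"
      using xD(1) by (intro continuous_map_into_subtopology) (auto simp: x_def[abs_def] comp_def tD[simplified])
    have "continuous_map (top_of_set W) (top_of_set (snd c ` fst c)) \<sigma>"
      using smooth_on_continuous[OF s\<sigma>] \<sigma>O(2) by (auto intro!: continuous_map_into_subtopology)
    then have "continuous_map (top_of_set W) (subtopology (mtop M) (fst c)) (pt c \<circ> \<sigma>)"
      by (rule continuous_map_compose[OF _ pt_continuous[OF chart[OF c(1)]]])
    then have "continuous_map (top_of_set W) (subtopology (subtopology (mtop M) (fst c)) D) (pt c \<circ> \<sigma>)"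
      by (rule continuous_map_into_subtopology) (use \<sigma>D(1) in auto)
    then show "continuous_map (top_of_set W) (subtopology ?X D) (\<lambda>w. pt c (\<sigma> w))"
      unfolding sub by (simp add: comp_def)
    show "pt c (\<sigma> (x q)) = q" if "q \<in> topspace (subtopology ?X D)" for q
      using that xD(3) unfolding tD by blast
    show "x (pt c (\<sigma> w)) = w" if "w \<in> topspace (top_of_set W)" for w
      using that \<sigma>D(3) by simp
  qed
  have "is_chart ?X d"
    unfolding is_chart_def d_def fst_conv snd_conv xW
    using oD oW hm homeomorphic_map_maps by blast
  moreover have "smooth_on (snd d ` (fst d \<inter> fst c')) (snd c' \<circ> pt d) \<and>
      (\<forall>z\<in>snd d ` (fst d \<inter> fst c'). inj (FD (snd c' \<circ> pt d) z))" if c': "c' \<in> atlas M" for c'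
  proof -
    let ?T = "snd d ` (fst d \<inter> fst c')"
    have TW: "?T \<subseteq> W" using xD(1) by (auto simp: d_def)
    have "D \<inter> fst c' = D \<inter> (S \<inter> fst c')" by (auto simp: D_def)
    then have oT: "open ?T"
      using coord_image_open[OF \<open>is_chart ?X d\<close>, of "S \<inter> fst c'"] is_chart_openin[OF chart[OF c']]
      by (simp add: openin_subtopology_Int2 d_def)
    have \<sigma>T: "\<sigma> w \<in> snd c ` (fst c \<inter> fst c')" if w: "w \<in> ?T" for w
    proof -
      obtain q where q: "q \<in> D" "q \<in> fst c'" "w = x q" using w by (auto simp: d_def)
      then show ?thesis using xD(2)[OF q(1)] Dc by auto
    qed
    have eq: "(snd c' \<circ> pt c) (\<sigma> w) = (snd c' \<circ> pt d) w" if "w \<in> ?T" for w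
      using ptd that TW by auto
    have sT: "smooth_on ?T \<sigma>" by (rule smooth_on_mono[OF s\<sigma> TW])
    have s: "smooth_on ?T (\<lambda>w. (snd c' \<circ> pt c) (\<sigma> w))"
      by (rule smooth_on_compose[OF oT open_overlap[OF c(1) c'] _ smooth_transition[OF c(1) c'] sT])
        (use \<sigma>T in blast)
    have "inj (FD (snd c' \<circ> pt d) w)" if w: "w \<in> ?T" for w
    proof -
      obtain q where q: "q \<in> D" "q \<in> fst c'" "w = x q" using w by (auto simp: d_def)
      have \<sigma>w: "\<sigma> w = snd c q" using xD(2)[OF q(1)] q(3) by simp
      have qc: "q \<in> fst c" using q Dc by auto
      have "FD (snd c' \<circ> pt d) w = FD (\<lambda>w. (snd c' \<circ> pt c) (\<sigma> w)) w"
        by (rule FD_cong_open[OF smooth_on_differentiable[OF s w] oT w, symmetric]) (rule eq)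
      then have F1: "FD (snd c' \<circ> pt d) w v = Dtr c c' q (FD \<sigma> w v)" for v
        using FD_compose[OF smooth_on_has_derivative[OF sT w], of "snd c' \<circ> pt c"]
          transition_has_derivative[OF c(1) c' qc q(2)] unfolding \<sigma>w Dtr_def by metis
      have "((\<lambda>w. \<pi> (\<sigma> w)) has_derivative (\<lambda>v. \<pi> (FD \<sigma> w v))) (at w)"
        by (rule bounded_linear.has_derivative[OF b\<pi> smooth_on_has_derivative[OF sT w]])
      moreover have "((\<lambda>w. \<pi> (\<sigma> w)) has_derivative (\<lambda>v. v)) (at w)"
        by (rule has_derivative_transform_within_open[OF has_derivative_ident oT w])
          (use \<sigma>U(3) TW in auto)
      \<comment> \<open>The linear map \<open>\<pi>\<close> is a left inverse of \<open>\<sigma>\<close>, hence of its derivative.\<close>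
      ultimately have pv: "\<pi> (FD \<sigma> w v) = v" for v using has_derivative_unique by metis
      have "\<pi> (Dtr c' c q (FD (snd c' \<circ> pt d) w v)) = v" for v
        unfolding F1 Dtr_inverse[OF c(1) qc c' q(2)] by (rule pv)
      then show ?thesis by (metis injI)
    qed
    moreover have "smooth_on ?T (snd c' \<circ> pt d)" by (rule smooth_on_cong[OF oT eq s])
    ultimately show ?thesis by blast
  qed
  ultimately have "d \<in> atlas (fibre M F p :: ('a, 'v) manifold)"
    unfolding fibre_def submanifold_def S_def[symmetric] by simp
  moreover have "p \<in> fst d" using c p k(3) by (simp add: d_def D_def S_def)
  ultimately show ?thesis by blast
qed

end

section \<open>The second fundamental form of a fibre\<close>

locale fibred_point = submersion M g N F
  for M :: "('a, 'e::euclidean_space) manifold" and g :: "('a, 'e) metric"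
    and N :: "('b, 'f::euclidean_space) manifold" and F :: "'a \<Rightarrow> 'b" +
  fixes p :: 'a and fib :: "('a, 'v::euclidean_space) manifold"
  assumes p: "p \<in> pts M" and fib_def: "fib = fibre M F p"
    and dim_vert: "dim (vert M N F p) = DIM('v)"
begin

sublocale riemannian_submanifold M g "{q \<in> pts M. F q = F p}" fib
  by unfold_locales (auto simp: covered fib_def fibre_def)

definition total_chart :: "('a, 'e) chart" where "total_chart = chart_at M p"
definition base_chart :: "('b, 'f) chart" where "base_chart = chart_at N (F p)"
definition fibre_chart :: "('a, 'v) chart" where "fibre_chart = chart_at fib p"

lemma total_chart: "total_chart \<in> atlas M" "p \<in> fst total_chart"
proof -
  obtain c where "c \<in> atlas M" "p \<in> fst c" using covered[OF p] by blast
  from chart_at_in[OF this] show "total_chart \<in> atlas M" "p \<in> fst total_chart" unfolding total_chart_def .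
qed

lemma base_chart: "base_chart \<in> atlas N" "F p \<in> fst base_chart"
  using F_in_base_chart[OF total_chart] unfolding base_chart_def .

lemma fibre_chart: "fibre_chart \<in> atlas fib" "p \<in> fst fibre_chart"
proof -
  obtain d where "d \<in> atlas fib" "p \<in> fst d"
    using fibre_chart_exists[OF p dim_vert] unfolding fib_def by blast
  from chart_at_in[OF this] show "fibre_chart \<in> atlas fib" "p \<in> fst fibre_chart" unfolding fibre_chart_def .
qed

abbreviation "par \<equiv> snd total_chart \<circ> pt fibre_chart"
abbreviation "par_dom \<equiv> snd fibre_chart ` (fst fibre_chart \<inter> fst total_chart)"
abbreviation "w0 \<equiv> snd fibre_chart p"
abbreviation "z0 \<equiv> snd total_chart p"
abbreviation "\<iota> \<equiv> Dtr fibre_chart total_chart p"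

sublocale imm: isometric_immersion "snd total_chart ` fst total_chart" "metric_in_chart M g total_chart" par_dom
  "metric_in_chart fib induced_metric fibre_chart" par
  by (rule inclusion_isometric[OF fibre_chart(1) total_chart(1)])

sublocale gp: inner_form "g p"
  by (rule inner_form_metric[OF total_chart])

lemma w0: "w0 \<in> par_dom" using total_chart fibre_chart by auto

lemma par_w0: "par w0 = z0" by (simp add: pt_coord[OF sub_chart[OF fibre_chart(1)] fibre_chart(2)])

lemma \<iota>_eq: "FD par w0 = \<iota>" by (simp add: Dtr_def)

lemma metric_z0: "metric_in_chart M g total_chart z0 u v = g p u v"
  unfolding total_chart_def by (rule metric_in_chart_at[OF total_chart])

lemma par_fibre:
  assumes "w \<in> par_dom"
  obtains q where "q \<in> fst total_chart" "F q = F p" "par w = snd total_chart q"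
proof -
  obtain q where q: "q \<in> fst fibre_chart" "q \<in> fst total_chart" "w = snd fibre_chart q" using assms by auto
  have "F q = F p" using sub_subset[OF fibre_chart(1) q(1)] by simp
  moreover have "par w = snd total_chart q" by (simp add: q(3) pt_coord[OF sub_chart[OF fibre_chart(1)] q(1)])
  ultimately show ?thesis using that q(2) by blast
qed

lemma par_rep_dom: "w \<in> par_dom \<Longrightarrow> par w \<in> rep_dom total_chart base_chart"
  by (erule par_fibre) (use base_chart in \<open>auto simp: in_rep_dom\<close>)

lemma rep_par: "w \<in> par_dom \<Longrightarrow> F_in_charts total_chart base_chart (par w) = snd base_chart (F p)"
  by (erule par_fibre) (simp add: rep_coord[OF total_chart(1)])

lemma rep_par_derivative:
  assumes w: "w \<in> par_dom"
  shows "FD (F_in_charts total_chart base_chart) (par w) (FD par w b) = 0"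
proof -
  have "FD (\<lambda>w. F_in_charts total_chart base_chart (par w)) w b = FD (F_in_charts total_chart base_chart) (par w) (FD par w b)"
    by (rule FD_compose[OF smooth_on_has_derivative[OF imm.smooth_f w]
          smooth_on_has_derivative[OF smooth_rep[OF total_chart(1) base_chart(1)] par_rep_dom[OF w]]])
  moreover have "((\<lambda>w. F_in_charts total_chart base_chart (par w)) has_derivative (\<lambda>_. 0)) (at w)"
    by (rule has_derivative_transform_within_open[OF has_derivative_const[of "snd base_chart (F p)"] imm.ind.open_Z w])
      (rule rep_par[symmetric])
  ultimately show ?thesis by (simp add: FD_eqI)
qed

lemma vert_z0: "FD (F_in_charts total_chart base_chart) z0 u = 0 \<longleftrightarrow> u \<in> vert M N F p"
  using rep_kernel[OF total_chart base_chart, of u] by (simp add: from_chart_eq total_chart_def[symmetric] Dtr_same[OF total_chart])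

lemma range_\<iota>: "range \<iota> = vert M N F p"
proof (rule subspace_dim_equal)
  have lin: "linear \<iota>" and inj: "inj \<iota>"
    using incl_linear incl_inj fibre_chart total_chart by auto
  show "subspace (range \<iota>)" by (rule linear_subspace_image[OF lin subspace_UNIV])
  show "subspace (vert M N F p)" by (rule subspace_vert[OF total_chart])
  show "range \<iota> \<subseteq> vert M N F p"
    using rep_par_derivative[OF w0] unfolding par_w0 \<iota>_eq vert_z0 by blast
  show "dim (vert M N F p) \<le> dim (range \<iota>)"
    using dim_image_eq[OF lin, of UNIV] inj by (simp add: dim_vert dim_UNIV)
qed

text \<open>The orthogonal projection \<open>y\<close> of a constant field \<open>v\<close> is determined, together with a Lagrange multiplier, by
  a linear system with smooth invertible coefficients, hence it is a smooth field.\<close>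

lemma vproj_smooth:
  "smooth_on (rep_dom total_chart base_chart) (field_in_chart M total_chart (\<lambda>q. vproj M N F g q (extend M p v q)))"
proof -
  let ?O = "rep_dom total_chart base_chart" and ?A = "FD (F_in_charts total_chart base_chart)" and ?G = "metric_in_chart M g total_chart"
  let ?y = "field_in_chart M total_chart (\<lambda>q. vproj M N F g q (extend M p v q))"
  \<comment> \<open>The projection of \<open>v\<close> to the kernel of \<open>A\<close> is the \<open>u\<close> with \<open>A u = 0\<close> for which \<open>G (v - u)\<close> is a combination of
    the components of \<open>A\<close>; their coefficients are the multiplier.\<close>
  define L where "L z x = ((\<Sum>k\<in>Basis. (?G z (fst x) k + snd x \<bullet> ?A z k) *\<^sub>R k), ?A z (fst x))" for z and x :: "'e \<times> 'f"
  define b :: "'e \<Rightarrow> 'e \<times> 'f" where "b z = ((\<Sum>k\<in>Basis. ?G z v k *\<^sub>R k), 0)" for z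
  note oO = open_rep_dom[OF total_chart(1) base_chart(1)] and sA = smooth_on_FD[OF smooth_rep[OF total_chart(1) base_chart(1)]]
  have OZ: "?O \<subseteq> snd total_chart ` fst total_chart" by (rule rep_dom_subset)
  have sG: "smooth_on ?O (\<lambda>z. ?G z u k)" for u k by (rule smooth_on_mono[OF imm.amb.smooth_G OZ])
  have lA: "linear (?A z)" if "z \<in> ?O" for z by (rule smooth_on_linear_FD[OF smooth_rep[OF total_chart(1) base_chart(1)] that])
  have linL: "linear (L z)" if z: "z \<in> ?O" for z
  proof -
    have zZ: "z \<in> snd total_chart ` fst total_chart" using z OZ by auto
    have l1: "linear (\<lambda>x. ?G z (fst x) k + snd x \<bullet> ?A z k)" for k
      by (rule linearI) (simp_all add: imm.amb.G_simps[OF zZ] inner_add_left distrib_left)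
    have l2: "linear (\<lambda>x. (?G z (fst x) k + snd x \<bullet> ?A z k) *\<^sub>R k)" for k
    proof (rule linearI)
      show "(?G z (fst (x + y)) k + snd (x + y) \<bullet> ?A z k) *\<^sub>R k
        = (?G z (fst x) k + snd x \<bullet> ?A z k) *\<^sub>R k + (?G z (fst y) k + snd y \<bullet> ?A z k) *\<^sub>R k" for x y
        unfolding linear_add[OF l1] by (rule scaleR_add_left)
      show "(?G z (fst (r *\<^sub>R x)) k + snd (r *\<^sub>R x) \<bullet> ?A z k) *\<^sub>R k
        = r *\<^sub>R ((?G z (fst x) k + snd x \<bullet> ?A z k) *\<^sub>R k)" for r x
        unfolding linear_cmul[OF l1] by simp
    qed
    have l3: "linear (\<lambda>x. \<Sum>k\<in>Basis. (?G z (fst x) k + snd x \<bullet> ?A z k) *\<^sub>R k)"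
      by (rule linear_compose_sum) (use l2 in blast)
    have l4: "linear (\<lambda>x. ?A z (fst x))"
      by (rule linearI) (simp_all add: linear_add[OF lA[OF z]] linear_cmul[OF lA[OF z]])
    show ?thesis unfolding L_def
      by (rule linearI)
        (simp_all only: linear_add[OF l3] linear_cmul[OF l3] linear_add[OF l4] linear_cmul[OF l4] add_Pair scaleR_Pair)
  qed
  have L1: "?G z (fst x) k + snd x \<bullet> ?A z k = u \<bullet> k"
    if "z \<in> ?O" "L z x = (u, w)" for z x u w and k :: 'e
  proof -
    have zZ: "z \<in> snd total_chart ` fst total_chart" using that OZ by auto
    have lin: "linear (\<lambda>k. ?G z (fst x) k + snd x \<bullet> ?A z k)"
      by (rule linearI) (simp_all add: imm.amb.G_simps[OF zZ] linear_add[OF lA[OF that(1)]]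
          linear_cmul[OF lA[OF that(1)]] inner_add_right distrib_left)
    have "u = (\<Sum>k\<in>Basis. (?G z (fst x) k + snd x \<bullet> ?A z k) *\<^sub>R k)" using that(2) by (simp add: L_def)
    then show ?thesis
      using linear_basis_expansion[OF lin, of k] by (simp add: inner_sum_left inner_commute[of k] mult.commute)
  qed
  have surjA: "\<exists>u. ?A z u = y" if "z \<in> ?O" for z y
  proof -
    obtain q where q: "q \<in> fst total_chart" "F q \<in> fst base_chart" "z = snd total_chart q" using \<open>z \<in> ?O\<close> unfolding rep_dom_def by auto
    from rep_surj[OF total_chart(1) q(1) base_chart(1) q(2)] show ?thesis unfolding q(3) by metis
  qed
  have injL: "inj (L z)" if z: "z \<in> ?O" for z
  proof (subst linear_injective_0[OF linL[OF z]], intro allI impI)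
    have zZ: "z \<in> snd total_chart ` fst total_chart" using z OZ by auto
    fix x assume x: "L z x = 0"
    then have x': "L z x = (0, 0)" by (simp add: zero_prod_def)
    have A0: "?A z (fst x) = 0" using x' by (simp add: L_def)
    have "?G z (fst x) (fst x) = 0" using L1[OF z x', of "fst x"] by (simp add: A0)
    then have f0: "fst x = 0" using imm.amb.pos_G[OF zZ, of "fst x"] by force
    obtain u where u: "?A z u = snd x" using surjA[OF z] by blast
    have "snd x \<bullet> snd x = 0" using L1[OF z x', of u] by (simp add: u f0 imm.amb.G_simps[OF zZ])
    then show "x = 0" using f0 by (simp add: prod_eq_iff)
  qed
  define sol where "sol z = (SOME x. L z x = b z)" for z
  have sol: "L z (sol z) = b z" if z: "z \<in> ?O" for z
  proof -
    have "surj (L z)" by (rule linear_injective_imp_surjective[OF linL[OF z] injL[OF z] refl])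
    then have "\<exists>x. L z x = b z" by (metis surjD)
    then show ?thesis unfolding sol_def by (rule someI_ex)
  qed
  have ssol: "smooth_on ?O sol"
  proof (rule smooth_on_linear_system[where L = L and b = b, OF oO linL injL _ _ sol])
    show "smooth_on ?O (\<lambda>z. L z x)" for x
      unfolding L_def
      by (intro smooth_on_Pair smooth_on_sum smooth_on_linear[OF _ bounded_linear_scaleR_left]
          smooth_on_linear[OF _ bounded_linear_inner_right] smooth_on_add oO sG sA)
    show "smooth_on ?O b"
      unfolding b_def
      by (intro smooth_on_Pair smooth_on_sum smooth_on_linear[OF _ bounded_linear_scaleR_left]
          smooth_on_const oO sG)
  qed
  have "smooth_on ?O (\<lambda>z. fst (sol z))" by (rule smooth_on_linear[OF oO bounded_linear_fst ssol])
  then show ?thesis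
  proof (rule smooth_on_cong[OF oO, rotated])
    fix z assume z: "z \<in> ?O"
    have zZ: "z \<in> snd total_chart ` fst total_chart" using z OZ by auto
    obtain q where q: "q \<in> fst total_chart" "F q \<in> fst base_chart" "z = snd total_chart q" using z unfolding rep_dom_def by auto
    have ptz: "pt total_chart z = q" by (simp add: q(3) pt_coord[OF chart[OF total_chart(1)] q(1)])
    note cq = chart_at_in[OF total_chart(1) q(1)]
    interpret gq: inner_form "g q" by (rule inner_form_metric[OF total_chart(1) q(1)])
    have sV: "subspace (vert M N F q)" by (rule subspace_vert[OF total_chart(1) q(1)])
    let ?fr = "from_chart M total_chart q"
    have ext: "extend M p v q = ?fr v" by (simp add: extend_def total_chart_def)
    have y: "?y z = to_chart M total_chart q (vproj M N F g q (?fr v))" by (simp add: field_in_chart_def ptz ext)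
    have fr_y: "?fr (?y z) = vproj M N F g q (?fr v)"
      unfolding y from_chart_eq to_chart_eq by (rule Dtr_inverse[OF cq total_chart(1) q(1)])
    have lin_fr: "linear ?fr" unfolding from_chart_eq by (rule linear_Dtr[OF total_chart(1) cq(1) q(1) cq(2)])
    have "?fr (?y z) \<in> vert M N F q"
      unfolding fr_y unfolding vproj_def by (rule gq.orth_proj_in[OF sV])
    then have Ay: "?A z (?y z) = 0"
      using rep_kernel[OF total_chart(1) q(1) base_chart(1) q(2), of "?y z"] unfolding q(3)[symmetric] by blast
    have Gy: "?G z (v - ?y z) k = 0" if k: "?A z k = 0" for k
    proof -
      have k': "?fr k \<in> vert M N F q" using k unfolding q(3) rep_kernel[OF total_chart(1) q(1) base_chart(1) q(2)] .
      have "?G z (v - ?y z) k = g q (?fr v - ?fr (?y z)) (?fr k)"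
        unfolding q(3) metric_in_chart_coord[OF total_chart(1) q(1)] by (simp add: linear_diff[OF lin_fr])
      also have "\<dots> = 0" unfolding fr_y unfolding vproj_def
        by (rule orth_comp_alt[OF gq.orth_proj_orth[OF sV] k'])
      finally show ?thesis .
    qed
    let ?s = "fst (sol z)"
    have As: "?A z ?s = 0" using sol[OF z] by (simp add: L_def b_def)
    have Gs: "?G z (v - ?s) k = 0" if k: "?A z k = 0" for k
      using L1[OF z sol[OF z, unfolded b_def], of k] imm.amb.gram_inner[OF zZ, of v k]
      by (simp add: k imm.amb.G_simps[OF zZ] imm.amb.gram_def)
    let ?d = "?s - ?y z"
    have "?A z ?d = 0" by (simp add: linear_diff[OF lA[OF z]] As Ay)
    from Gs[OF this] Gy[OF this] have "?G z ?d ?d = 0" by (simp add: imm.amb.G_simps[OF zZ])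
    then have "?d = 0" using imm.amb.pos_G[OF zZ, of ?d] by force
    then show "?s = ?y z" by simp
  qed
qed

text \<open>Let \<open>Y\<close> be the vertical projection of the extension of \<open>\<iota> b\<close>. Along the fibre both \<open>Y\<close> and the coordinate field \<open>Df b\<close>
  are vertical, and they agree at \<open>p\<close>. Differentiating the condition that their difference is annihilated by the
  differential of the submersion shows that the derivative of the difference is vertical. Hence the covariant derivatives of the two
  fields have the same horizontal part.\<close>

lemma T_tensor_sff:
  assumes W: "W \<in> hor M N F g p"
  shows "g p (T_tensor M N F g p (\<iota> a) (\<iota> b)) W = g p (imm.sff w0 a b) W"
proof -
  let ?A = "FD (F_in_charts total_chart base_chart)" and ?V = "vert M N F p" and ?H = "hor M N F g p"
  define u where "u = \<iota> a"
  define v where "v = \<iota> b"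
  have uv: "u \<in> ?V" "v \<in> ?V" using range_\<iota> by (auto simp: u_def v_def)
  have sV: "subspace ?V" by (rule subspace_vert[OF total_chart])
  have sH: "subspace ?H" unfolding hor_def by (rule gp.subspace_orth_comp)
  have VW: "g p x W = 0" if "x \<in> ?V" for x
    using W that gp.sym_B[of x W] unfolding hor_def orth_comp_def by simp
  have ext: "extend M p x p = x" for x by (rule extend_at[OF total_chart])
  have vp: "vproj M N F g p x = x" if "x \<in> ?V" for x
    unfolding vproj_def by (rule gp.orth_proj_same[OF sV that])
  define Y where "Y = (\<lambda>q. vproj M N F g q (extend M p v q))"
  define y where "y = field_in_chart M total_chart Y"
  define X where "X = nabla M g (\<lambda>q. vproj M N F g q (extend M p u q)) Y p"
  have X: "X = FD y z0 u + christoffel (metric_in_chart M g total_chart) z0 u v"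
    unfolding X_def nabla_def Let_def total_chart_def[symmetric] y_def[symmetric]
    by (simp add: ext vp[OF uv(1)] vp[OF uv(2)] Y_def)
  have "g p (T_tensor M N F g p u v) W = g p (hproj M N F g p X) W"
    unfolding T_tensor_def oneill_T_def Let_def X_def Y_def
    by (simp add: gp.B_simps VW vproj_def gp.orth_proj_in[OF sV])
  also have "\<dots> = g p X W"
  proof -
    have "g p (X - hproj M N F g p X) W = 0"
      unfolding hproj_def by (rule orth_comp_alt[OF gp.orth_proj_orth[OF sH] W])
    then show ?thesis by (simp add: gp.B_simps)
  qed
  also have "X - imm.sff w0 a b \<in> ?V"
  proof -
    have sy: "smooth_on (rep_dom total_chart base_chart) y" unfolding y_def Y_def by (rule vproj_smooth)
    note oO = open_rep_dom[OF total_chart(1) base_chart(1)] and oW = imm.ind.open_Z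
    have zO: "z0 \<in> rep_dom total_chart base_chart" by (rule in_rep_dom[OF total_chart(2) base_chart(2)])
    have sub: "par ` par_dom \<subseteq> rep_dom total_chart base_chart" using par_rep_dom by blast
    \<comment> \<open>The difference of the two vertical fields along the fibre; it vanishes at \<open>w0\<close>.\<close>
    define \<psi> where "\<psi> w = y (par w) - FD par w b" for w
    have s1: "smooth_on par_dom (\<lambda>w. y (par w))"
      by (rule smooth_on_compose[OF oW oO sub sy imm.smooth_f])
    have s2: "smooth_on par_dom (\<lambda>w. FD par w b)" by (rule smooth_on_FD[OF imm.smooth_f])
    have s\<psi>: "smooth_on par_dom \<psi>" unfolding \<psi>_def by (rule smooth_on_diff[OF oW s1 s2])
    have lA: "linear (?A (par w))" if "w \<in> par_dom" for w
      by (rule smooth_on_linear_FD[OF smooth_rep[OF total_chart(1) base_chart(1)] par_rep_dom[OF that]])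
    have y0: "y z0 = v"
      unfolding y_def field_in_chart_def Y_def
      by (simp add: pt_coord[OF chart[OF total_chart(1)] total_chart(2)] ext vp[OF uv(2)] to_chart_eq total_chart_def[symmetric] Dtr_same[OF total_chart])
    have \<psi>0: "\<psi> w0 = 0" unfolding \<psi>_def par_w0 \<iota>_eq y0 v_def by simp
    have Ay: "?A (par w) (y (par w)) = 0" if w: "w \<in> par_dom" for w
    proof -
      obtain q where q: "q \<in> fst total_chart" "F q = F p" "par w = snd total_chart q" using par_fibre[OF w] by blast
      have Fq: "F q \<in> fst base_chart" using q(2) base_chart by simp
      note cq = chart_at_in[OF total_chart(1) q(1)]
      interpret gq: inner_form "g q" by (rule inner_form_metric[OF total_chart(1) q(1)])
      have "from_chart M total_chart q (y (snd total_chart q)) = vproj M N F g q (extend M p v q)"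
        unfolding y_def field_in_chart_def Y_def pt_coord[OF chart[OF total_chart(1)] q(1)] from_chart_eq to_chart_eq
        by (rule Dtr_inverse[OF cq total_chart(1) q(1)])
      then show ?thesis
        unfolding q(3) rep_kernel[OF total_chart(1) q(1) base_chart(1) Fq]
        by (simp add: vproj_def gq.orth_proj_in[OF subspace_vert[OF total_chart(1) q(1)]])
    qed
    have A\<psi>: "?A (par w) (\<psi> w) = 0" if "w \<in> par_dom" for w
      unfolding \<psi>_def by (simp only: linear_diff[OF lA[OF that]] Ay[OF that] rep_par_derivative[OF that] diff_zero)
    have zero: "FD (\<lambda>w. ?A (par w) (\<psi> w)) w0 a = 0"
    proof -
      have "((\<lambda>w. ?A (par w) (\<psi> w)) has_derivative (\<lambda>_. 0)) (at w0)"
        by (rule has_derivative_transform_within_open[OF has_derivative_const[of 0] oW w0]) (rule A\<psi>[symmetric])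
      then show ?thesis by (simp add: FD_eqI)
    qed
    have zero2: "FD (\<lambda>w. ?A (par w) (\<psi> w0)) w0 a = 0"
    proof -
      have "((\<lambda>w. ?A (par w) (\<psi> w0)) has_derivative (\<lambda>_. 0)) (at w0)"
        by (rule has_derivative_transform_within_open[OF has_derivative_const[of 0] oW w0])
          (simp only: \<psi>0 linear_0[OF lA])
      then show ?thesis by (simp add: FD_eqI)
    qed
    have "FD (\<lambda>w. ?A (par w) (\<psi> w)) w0 a = FD (\<lambda>w. ?A (par w) (\<psi> w0)) w0 a + ?A (par w0) (FD \<psi> w0 a)"
      by (rule FD_linear_family[where L = "\<lambda>w. ?A (par w)", OF oW w0 lA _ s\<psi>])
        (assumption, rule smooth_on_compose[OF oW oO sub smooth_on_FD[OF smooth_rep[OF total_chart(1) base_chart(1)]] imm.smooth_f])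
    then have "?A z0 (FD \<psi> w0 a) = 0" unfolding zero zero2 par_w0 by simp
    then have 1: "FD \<psi> w0 a \<in> ?V" unfolding vert_z0 .
    have "FD \<psi> w0 a = FD (\<lambda>w. y (par w)) w0 a - FD (\<lambda>w. FD par w b) w0 a"
      unfolding \<psi>_def by (rule FD_diff[OF smooth_on_differentiable[OF s1 w0] smooth_on_differentiable[OF s2 w0]])
    also have "FD (\<lambda>w. y (par w)) w0 a = FD y (par w0) (FD par w0 a)"
      by (rule FD_compose[OF smooth_on_has_derivative[OF imm.smooth_f w0]])
        (unfold par_w0, rule smooth_on_has_derivative[OF sy zO])
    finally have D\<psi>: "FD \<psi> w0 a = FD y (par w0) (FD par w0 a) - FD (\<lambda>w. FD par w b) w0 a" .
    have alg: "(A + C) - (B + C - D) = A - B + D" for A B C D :: 'e by simp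
    have "X - imm.sff w0 a b = FD \<psi> w0 a + \<iota> (christoffel (metric_in_chart fib induced_metric fibre_chart) w0 a b)"
      unfolding X imm.sff_def imm.hess_def cov_along_def D\<psi> par_w0 \<iota>_eq u_def v_def by (rule alg)
    then show ?thesis using 1 range_\<iota> subspace_add[OF sV] by auto
  qed
  then have "g p X W = g p (imm.sff w0 a b) W" using VW[of "X - imm.sff w0 a b"] by (simp add: gp.B_simps)
  finally show ?thesis unfolding u_def v_def .
qed

lemma sff_horizontal: "imm.sff w0 a b \<in> hor M N F g p"
proof -
  have "g p (imm.sff w0 a b) (\<iota> k) = 0" for k
    using imm.sff_normal[OF w0, of a b k] unfolding par_w0 metric_z0 \<iota>_eq .
  then show ?thesis unfolding hor_def orth_comp_def range_\<iota>[symmetric] by auto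
qed

lemma gauss_fibre:
  "g p (fibre_curvature TYPE('v) M F g p (\<iota> a) (\<iota> b) (\<iota> x)) (\<iota> y)
   = g p (curvature_tensor M g p (\<iota> a) (\<iota> b) (\<iota> x)) (\<iota> y)
     + g p (imm.sff w0 b x) (imm.sff w0 a y) - g p (imm.sff w0 a x) (imm.sff w0 b y)"
proof -
  have inj: "inj \<iota>" using incl_inj fibre_chart total_chart by auto
  have d\<iota>: "differential fib M (\<lambda>q. q) p = \<iota>"
    by (simp add: differential_incl total_chart_def fibre_chart_def)
  have "fibre_curvature TYPE('v) M F g p (\<iota> a) (\<iota> b) (\<iota> x) = \<iota> (curvature_tensor fib induced_metric p a b x)"
    unfolding fibre_curvature_def Let_def fib_def[symmetric] d\<iota> induced_metric_def[symmetric]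
    by (simp add: inv_f_f[OF inj])
  moreover have "g p (\<iota> k) (\<iota> l) = metric_in_chart fib induced_metric fibre_chart w0 k l" for k l
    using induced_metric_in_chart[OF fibre_chart total_chart, of k l] metric_z0 by simp
  ultimately have 1: "g p (fibre_curvature TYPE('v) M F g p (\<iota> a) (\<iota> b) (\<iota> x)) (\<iota> y)
      = metric_in_chart fib induced_metric fibre_chart w0 (local_curvature (metric_in_chart fib induced_metric fibre_chart) w0 a b x) y"
    using sub.curvature_tensor_in_chart[OF fibre_chart, of a b x] by (simp add: fibre_chart_def[symmetric])
  have 2: "curvature_tensor M g p = local_curvature (metric_in_chart M g total_chart) z0"
    by (intro ext) (simp add: curvature_tensor_in_chart[OF total_chart] total_chart_def)
  show ?thesis
    using imm.gauss_equation[OF w0, of a b x y] unfolding 1 2 par_w0 \<iota>_eq metric_z0 by simp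
qed

text \<open>A left inverse of the inclusion extends the second fundamental form to a bilinear form \<open>h\<close> on the whole tangent space, so that
  linear algebra applies to it without restriction to vertical vectors.\<close>

theorem second_fundamental_form:
  obtains h where "bilinear h" "\<And>u v. h u v = h v u" "\<And>u v. h u v \<in> hor M N F g p"
    "\<And>u v W. u \<in> vert M N F p \<Longrightarrow> v \<in> vert M N F p \<Longrightarrow> W \<in> hor M N F g p \<Longrightarrow>
      g p (T_tensor M N F g p u v) W = g p (h u v) W"
    "\<And>u v x y. u \<in> vert M N F p \<Longrightarrow> v \<in> vert M N F p \<Longrightarrow> x \<in> vert M N F p \<Longrightarrow> y \<in> vert M N F p \<Longrightarrow>
      g p (fibre_curvature TYPE('v) M F g p u v x) y = g p (curvature_tensor M g p u v x) y
        + g p (h v x) (h u y) - g p (h u x) (h v y)"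
proof -
  have lin: "linear \<iota>" and inj: "inj \<iota>" using incl_linear incl_inj fibre_chart total_chart by auto
  obtain \<kappa> where \<kappa>: "linear \<kappa>" "\<kappa> \<circ> \<iota> = id" using linear_injective_left_inverse[OF lin inj] by blast
  have \<kappa>\<iota>: "\<kappa> (\<iota> a) = a" for a using \<kappa>(2) by (metis comp_apply id_apply)
  have \<iota>\<kappa>: "\<iota> (\<kappa> u) = u" if "u \<in> vert M N F p" for u using that range_\<iota> \<kappa>\<iota> by (metis imageE)
  define h where "h u v = imm.sff w0 (\<kappa> u) (\<kappa> v)" for u v
  have bs: "linear (imm.sff w0 a)" "linear (\<lambda>a. imm.sff w0 a b)" for a b
    using imm.bilinear_sff[OF w0] by (auto simp: bilinear_def)
  show ?thesis
  proof (rule that[of h])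
    show "bilinear h" unfolding bilinear_def h_def
      using linear_compose[OF \<kappa>(1) bs(1)] linear_compose[OF \<kappa>(1) bs(2)] by (simp add: o_def)
    show "h u v = h v u" for u v unfolding h_def by (rule imm.sff_sym[OF w0])
    show "h u v \<in> hor M N F g p" for u v unfolding h_def by (rule sff_horizontal)
    show "g p (T_tensor M N F g p u v) W = g p (h u v) W"
      if "u \<in> vert M N F p" "v \<in> vert M N F p" "W \<in> hor M N F g p" for u v W
      using T_tensor_sff[OF that(3), of "\<kappa> u" "\<kappa> v"] by (simp add: \<iota>\<kappa> that h_def)
    show "g p (fibre_curvature TYPE('v) M F g p u v x) y = g p (curvature_tensor M g p u v x) y
        + g p (h v x) (h u y) - g p (h u x) (h v y)"
      if "u \<in> vert M N F p" "v \<in> vert M N F p" "x \<in> vert M N F p" "y \<in> vert M N F p" for u v x y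
      using gauss_fibre[of "\<kappa> u" "\<kappa> v" "\<kappa> x" "\<kappa> y"] by (simp add: \<iota>\<kappa> that h_def)
  qed
qed

end

section \<open>The Casorati inequalities for a fibre\<close>

context inner_form
begin

lemma onb_inner_expansion:
  assumes U: "orthonormal_basis B W I U" "finite I" and x: "x \<in> W"
  shows "B x y = (\<Sum>i\<in>I. B x (U i) * B y (U i))"
proof -
  have "B x y = B (\<Sum>i\<in>I. B x (U i) *\<^sub>R U i) y" using onb_expansion[OF U x] by simp
  then show ?thesis by (simp add: B_sum B_simps sym_B[of y])
qed

lemma onb_components_zero:
  assumes U: "orthonormal_basis B W I U" "finite I" and x: "x \<in> W"
  shows "(\<forall>i\<in>I. B x (U i) = 0) \<longleftrightarrow> x = 0"
  using onb_inner_expansion[OF U x, of x] by (auto simp: B_simps B_eq_0)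

lemma onb_shift:
  assumes "orthonormal_basis B W {1..n} U"
  shows "orthonormal_basis B W {r+1..r+n} (\<lambda>i. U (i - r))"
proof -
  have "(\<lambda>i. U (i - r)) ` {r+1..r+n} = U ` {1..n}"
  proof
    show "(\<lambda>i. U (i - r)) ` {r+1..r+n} \<subseteq> U ` {1..n}" by (auto intro!: imageI)
    show "U ` {1..n} \<subseteq> (\<lambda>i. U (i - r)) ` {r+1..r+n}"
    proof
      fix x assume "x \<in> U ` {1..n}"
      then obtain i where "i \<in> {1..n}" "x = U i" by auto
      then show "x \<in> (\<lambda>i. U (i - r)) ` {r+1..r+n}" by (intro image_eqI[of _ _ "i + r"]) auto
    qed
  qed
  moreover have "B (U (i - r)) (U (j - r)) = (if i = j then 1 else 0)"
    if "i \<in> {r+1..r+n}" "j \<in> {r+1..r+n}" for i j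
  proof -
    have "i - r \<in> {1..n}" "j - r \<in> {1..n}" "i - r = j - r \<longleftrightarrow> i = j" using that by auto
    then show ?thesis using onb_inner[OF assms, of "i - r" "j - r"] by simp
  qed
  ultimately show ?thesis using assms unfolding orthonormal_basis_def by simp
qed

lemma onb_cong:
  assumes "orthonormal_basis B W I U" "\<And>i. i \<in> I \<Longrightarrow> U' i = U i"
  shows "orthonormal_basis B W I U'"
proof -
  have "U' ` I = U ` I" using assms(2) by auto
  then show ?thesis using assms unfolding orthonormal_basis_def by auto
qed

end

text \<open>Multiplied by \<open>r (r - 1)\<close>, the two Casorati inequalities become the bounds of \<open>casorati_optimal\<close> for \<open>\<mu> = 1/2\<close>
  and \<open>\<mu> = 2\<close>; here \<open>y = r\<close> and \<open>x = r - 1\<close>.\<close>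

lemma casorati_arith:
  fixes x y NV NL S K :: real
  assumes x: "x > 0" and y: "y = x + 1"
  shows "1/2 * (NV / y) + (y + 1) / (2 * y) * (NL / x) + K - (K + (S - NV) / ((x + 1) * x))
      = ((x * (1/2) + 1) * (NV + (1 / (1/2) - 1) * NL) - S) / ((x + 1) * x)"
    and "2 * (NV / y) - (2 * y - 1) / (2 * y) * (NL / x) + K - (K + (S - NV) / ((x + 1) * x))
      = ((x * 2 + 1) * (NV + (1 / 2 - 1) * NL) - S) / ((x + 1) * x)"
proof -
  have n: "x \<noteq> 0" "y \<noteq> 0" using x y by simp_all
  have "1/2 * (NV / y) + (y + 1) / (2 * y) * (NL / x) + K - (K + (S - NV) / (y * x))
      = (1/2 * NV * x + (y + 1) / 2 * NL + NV - S) / (y * x)"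
    using n by (simp add: field_simps)
  also have "1/2 * NV * x + (y + 1) / 2 * NL + NV - S = (x * (1/2) + 1) * (NV + (1 / (1/2) - 1) * NL) - S"
    unfolding y by (simp add: algebra_simps add_divide_distrib)
  finally show "1/2 * (NV / y) + (y + 1) / (2 * y) * (NL / x) + K - (K + (S - NV) / ((x + 1) * x))
      = ((x * (1/2) + 1) * (NV + (1 / (1/2) - 1) * NL) - S) / ((x + 1) * x)" unfolding y .
  have "2 * (NV / y) - (2 * y - 1) / (2 * y) * (NL / x) + K - (K + (S - NV) / (y * x))
      = (2 * NV * x - (2 * y - 1) / 2 * NL + NV - S) / (y * x)"
    using n by (simp add: field_simps)
  also have "2 * NV * x - (2 * y - 1) / 2 * NL + NV - S = (x * 2 + 1) * (NV + (1 / 2 - 1) * NL) - S"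
    unfolding y by (simp add: field_simps)
  finally show "2 * (NV / y) - (2 * y - 1) / (2 * y) * (NL / x) + K - (K + (S - NV) / ((x + 1) * x))
      = ((x * 2 + 1) * (NV + (1 / 2 - 1) * NL) - S) / ((x + 1) * x)" unfolding y .
qed

context fibred_point
begin

text \<open>The additive term \<open>K\<close> is the normalized sum of the ambient sectional curvatures of the vertical space. It enters the normalized scalar
  curvature through the Gauss equation and is otherwise unrelated to the Casorati curvatures.\<close>

theorem casorati_inequalities_fibre:
  assumes k: "dim (vert M N F p) = Suc k" "k > 0"
    and R: "\<And>U. orthonormal_basis (g p) (vert M N F p) {1..Suc k} U \<Longrightarrow>
      (\<Sum>i=1..Suc k. \<Sum>j=1..Suc k. g p (curvature_tensor M g p (U i) (U j) (U j)) (U i))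
        = (real k + 1) * real k * K"
  shows "casorati_inequalities TYPE('v) M N F g p K"
proof -
  let ?V = "vert M N F p" and ?H = "hor M N F g p" and ?r = "Suc k" and ?T = "T_tensor M N F g p"
  obtain h where h: "bilinear h" "\<And>u v. h u v = h v u" "\<And>u v. h u v \<in> ?H"
    and T: "\<And>u v W. u \<in> ?V \<Longrightarrow> v \<in> ?V \<Longrightarrow> W \<in> ?H \<Longrightarrow> g p (?T u v) W = g p (h u v) W"
    and gauss: "\<And>u v x y. u \<in> ?V \<Longrightarrow> v \<in> ?V \<Longrightarrow> x \<in> ?V \<Longrightarrow> y \<in> ?V \<Longrightarrow>
      g p (fibre_curvature TYPE('v) M F g p u v x) y = g p (curvature_tensor M g p u v x) y
        + g p (h v x) (h u y) - g p (h u x) (h v y)"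
    using second_fundamental_form by metis
  have sV: "subspace ?V" by (rule subspace_vert[OF total_chart])
  have sH: "subspace ?H" unfolding hor_def by (rule gp.subspace_orth_comp)
  define J where "J = {1..dim ?H}"
  define Wb where "Wb = some_onb (g p) ?H"
  have fJ: "finite J" by (simp add: J_def)
  have W: "orthonormal_basis (g p) ?H J Wb" unfolding J_def Wb_def by (rule gp.some_onb[OF sH])
  define b where "b \<beta> u v = g p (h u v) (Wb \<beta>)" for \<beta> u v
  have bil: "bilinear (b \<beta>)" for \<beta>
    unfolding b_def bilinear_def using h(1)
    by (auto intro!: linearI simp: gp.B_simps bilinear_ladd bilinear_radd bilinear_lmul bilinear_rmul)
  have symb: "b \<beta> u v = b \<beta> v u" for \<beta> u v unfolding b_def h(2)[of u v] ..
  have hh: "g p (h u v) (h x y) = (\<Sum>\<beta>\<in>J. b \<beta> u v * b \<beta> x y)" for u v x y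
    unfolding b_def by (rule gp.onb_inner_expansion[OF W fJ h(3)])
  define Nsq where "Nsq L = sqnorm_on J b {1..dim L} (some_onb (g p) L)" for L
  have cas: "casorati M N F g p L = Nsq L / real (dim L)" if L: "subspace L" "L \<subseteq> ?V" for L
  proof -
    have o: "orthonormal_basis (g p) L {1..dim L} (some_onb (g p) L)" by (rule gp.some_onb[OF L(1)])
    have "g p (?T (some_onb (g p) L i) (some_onb (g p) L j)) (Wb \<beta>)
        = b \<beta> (some_onb (g p) L i) (some_onb (g p) L j)"
      if "\<beta> \<in> J" "i \<in> {1..dim L}" "j \<in> {1..dim L}" for i j \<beta>
      unfolding b_def using L(2) gp.onb_in[OF o] gp.onb_in[OF W that(1)] that(2,3) by (intro T) auto
    then show ?thesis
      unfolding casorati_def Let_def Nsq_def sqnorm_on_def Wb_def[symmetric] J_def[symmetric] by simp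
  qed
  define UV where "UV = some_onb (g p) ?V"
  have oV: "orthonormal_basis (g p) ?V {1..?r} UV" unfolding UV_def using gp.some_onb[OF sV] k(1) by simp
  define S where "S = trace_sq J b {1..?r} UV"
  define NV where "NV = sqnorm_on J b {1..?r} UV"
  have NV: "Nsq ?V = NV" by (simp add: Nsq_def NV_def UV_def k(1))
  have tau: "2 * tau_vert TYPE('v) M N F g p = (real k + 1) * real k * K + S - NV"
  proof -
    have "2 * tau_vert TYPE('v) M N F g p
      = (\<Sum>i=1..?r. \<Sum>j=1..?r. g p (fibre_curvature TYPE('v) M F g p (UV i) (UV j) (UV j)) (UV i))"
      by (simp add: tau_vert_def Let_def UV_def k(1))
    also have "\<dots> = (\<Sum>i=1..?r. \<Sum>j=1..?r. g p (curvature_tensor M g p (UV i) (UV j) (UV j)) (UV i)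
        + ((\<Sum>\<beta>\<in>J. b \<beta> (UV j) (UV j) * b \<beta> (UV i) (UV i)) - (\<Sum>\<beta>\<in>J. (b \<beta> (UV i) (UV j))\<^sup>2)))"
    proof (intro sum.cong refl)
      fix i j assume ij: "i \<in> {1..?r}" "j \<in> {1..?r}"
      show "g p (fibre_curvature TYPE('v) M F g p (UV i) (UV j) (UV j)) (UV i)
        = g p (curvature_tensor M g p (UV i) (UV j) (UV j)) (UV i)
        + ((\<Sum>\<beta>\<in>J. b \<beta> (UV j) (UV j) * b \<beta> (UV i) (UV i)) - (\<Sum>\<beta>\<in>J. (b \<beta> (UV i) (UV j))\<^sup>2))"
        using gauss[of "UV i" "UV j" "UV j" "UV i"] gp.onb_in[OF oV] ij
        by (simp add: hh power2_eq_square symb[of _ "UV j" "UV i"])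
    qed
    also have "\<dots> = (\<Sum>i=1..?r. \<Sum>j=1..?r. g p (curvature_tensor M g p (UV i) (UV j) (UV j)) (UV i))
        + ((\<Sum>i=1..?r. \<Sum>j=1..?r. \<Sum>\<beta>\<in>J. b \<beta> (UV j) (UV j) * b \<beta> (UV i) (UV i))
           - (\<Sum>i=1..?r. \<Sum>j=1..?r. \<Sum>\<beta>\<in>J. (b \<beta> (UV i) (UV j))\<^sup>2))"
      by (simp only: sum.distrib sum_subtractf)
    also have "(\<Sum>i=1..?r. \<Sum>j=1..?r. \<Sum>\<beta>\<in>J. b \<beta> (UV j) (UV j) * b \<beta> (UV i) (UV i)) = S"
    proof -
      have "(\<Sum>i=1..?r. \<Sum>j=1..?r. \<Sum>\<beta>\<in>J. b \<beta> (UV j) (UV j) * b \<beta> (UV i) (UV i))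
        = (\<Sum>i=1..?r. \<Sum>\<beta>\<in>J. \<Sum>j=1..?r. b \<beta> (UV j) (UV j) * b \<beta> (UV i) (UV i))"
        by (intro sum.cong refl sum.swap)
      also have "\<dots> = (\<Sum>\<beta>\<in>J. \<Sum>i=1..?r. \<Sum>j=1..?r. b \<beta> (UV j) (UV j) * b \<beta> (UV i) (UV i))"
        by (rule sum.swap)
      also have "\<dots> = S"
        unfolding S_def trace_sq_def power2_eq_square
        by (intro sum.cong refl) (simp only: sum_product mult.commute)
      finally show ?thesis .
    qed
    also have "(\<Sum>i=1..?r. \<Sum>j=1..?r. \<Sum>\<beta>\<in>J. (b \<beta> (UV i) (UV j))\<^sup>2) = NV"
    proof -
      have "(\<Sum>i=1..?r. \<Sum>j=1..?r. \<Sum>\<beta>\<in>J. (b \<beta> (UV i) (UV j))\<^sup>2)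
        = (\<Sum>i=1..?r. \<Sum>\<beta>\<in>J. \<Sum>j=1..?r. (b \<beta> (UV i) (UV j))\<^sup>2)"
        by (intro sum.cong refl sum.swap)
      also have "\<dots> = NV" unfolding NV_def sqnorm_on_def by (rule sum.swap)
      finally show ?thesis .
    qed
    finally show ?thesis unfolding R[OF oV] by simp
  qed
  have rho: "rho_vert TYPE('v) M N F g p = K + (S - NV) / ((real k + 1) * real k)"
  proof -
    have d: "real (Suc k) * (real (Suc k) - 1) = (real k + 1) * real k" by simp
    have n: "(real k + 1) * real k \<noteq> 0" using k(2) by simp
    show ?thesis
      unfolding rho_vert_def Let_def tau k(1) d using n
      by (simp only: add_divide_distrib diff_divide_distrib nonzero_mult_div_cancel_left) simp
  qed
  have hyp: "subspace L \<and> L \<subseteq> ?V \<and> dim L = k" if "L \<in> hyperplanes ?V" for L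
    using that k(1) unfolding hyperplanes_def by simp
  have NsqL: "Nsq L = sqnorm_on J b {1..k} (some_onb (g p) L)" if "L \<in> hyperplanes ?V" for L
  proof -
    have d: "dim L = k" using hyp[OF that] by blast
    show ?thesis unfolding Nsq_def d ..
  qed
  have casL: "casorati M N F g p L = Nsq L / real k" if "L \<in> hyperplanes ?V" for L
    using cas[of L] hyp[OF that] by simp
  have extr: "\<exists>L\<in>hyperplanes ?V. \<forall>L'\<in>hyperplanes ?V. \<epsilon> * Nsq L \<le> \<epsilon> * Nsq L'" for \<epsilon>
  proof -
    show ?thesis
    proof (rule gp.extremal_hyperplane[where J = J and b = b and \<epsilon> = \<epsilon>, OF sV k(1) fJ bil symb])
      fix L assume L: "L \<in> hyperplanes ?V" "\<And>L'. L' \<in> hyperplanes ?V \<Longrightarrow>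
        \<epsilon> * sqnorm_on J b {1..k} (some_onb (g p) L) \<le> \<epsilon> * sqnorm_on J b {1..k} (some_onb (g p) L')"
      show ?thesis
      proof (rule bexI[OF _ L(1)], rule ballI)
        fix L' assume L': "L' \<in> hyperplanes ?V"
        show "\<epsilon> * Nsq L \<le> \<epsilon> * Nsq L'" unfolding NsqL[OF L(1)] NsqL[OF L'] by (rule L(2)[OF L'])
      qed
    qed
  qed
  have diag: "T_diagonal_form \<mu> M N F g p \<longleftrightarrow>
      (\<exists>U. orthonormal_basis (g p) ?V {1..?r} U \<and> diagonal_form \<mu> J b ?r U)" for \<mu>
  proof -
    let ?m = "DIM('e)"
    \<comment> \<open>Diagonal form does not depend on the basis of the horizontal space: it says that certain horizontal vectors vanish.\<close>
    define Dg where "Dg U \<longleftrightarrow> (\<forall>i\<in>{1..k}. h (U i) (U i) - \<mu> *\<^sub>R h (U ?r) (U ?r) = 0) \<and>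
      (\<forall>i\<in>{1..?r}. \<forall>j\<in>{1..?r}. i \<noteq> j \<longrightarrow> h (U i) (U j) = 0)" for U
    have Dg: "(\<forall>\<beta>\<in>J'. (\<forall>i\<in>{1..?r-1}. g p (h (U i) (U i)) (W' \<beta>) = \<mu> * g p (h (U ?r) (U ?r)) (W' \<beta>)) \<and>
        (\<forall>i\<in>{1..?r}. \<forall>j\<in>{1..?r}. i \<noteq> j \<longrightarrow> g p (h (U i) (U j)) (W' \<beta>) = 0)) \<longleftrightarrow> Dg U"
      if W': "orthonormal_basis (g p) ?H J' W'" "finite J'" for J' W' U
    proof -
      have in1: "h (U i) (U i) - \<mu> *\<^sub>R h (U ?r) (U ?r) \<in> ?H" for i
        by (intro subspace_diff subspace_scale sH h(3))
      show ?thesis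
        unfolding Dg_def diff_Suc_1 gp.onb_components_zero[OF W' in1, symmetric]
          gp.onb_components_zero[OF W' h(3), symmetric]
        by (simp only: gp.B_simps right_minus_eq) blast
    qed
    have dimH: "?r + dim ?H = ?m"
      using gp.dim_orth_comp[OF sV] k(1) unfolding hor_def by simp
    have T_h: "g p (?T (U i) (U j)) (U \<beta>) = g p (h (U i) (U j)) (U \<beta>)"
      if "orthonormal_basis (g p) ?V {1..?r} U" "orthonormal_basis (g p) ?H {?r+1..?m} U"
        "i \<in> {1..?r}" "j \<in> {1..?r}" "\<beta> \<in> {?r+1..?m}" for U i j \<beta>
      by (rule T[OF gp.onb_in[OF that(1,3)] gp.onb_in[OF that(1,4)] gp.onb_in[OF that(2,5)]])
    have "T_diagonal_form \<mu> M N F g p \<longleftrightarrow>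
      (\<exists>U. orthonormal_basis (g p) ?V {1..?r} U \<and> orthonormal_basis (g p) ?H {?r+1..?m} U \<and> Dg U)"
      unfolding T_diagonal_form_def Let_def k(1)
    proof (intro iff_exI conj_cong refl)
      fix U assume o: "orthonormal_basis (g p) ?V {1..?r} U" "orthonormal_basis (g p) ?H {?r+1..?m} U"
      show "(\<forall>\<beta>\<in>{?r+1..?m}. (\<forall>i\<in>{1..?r-1}. g p (?T (U i) (U i)) (U \<beta>) = \<mu> * g p (?T (U ?r) (U ?r)) (U \<beta>)) \<and>
         (\<forall>i\<in>{1..?r}. \<forall>j\<in>{1..?r}. i \<noteq> j \<longrightarrow> g p (?T (U i) (U j)) (U \<beta>) = 0)) = Dg U"
        unfolding Dg[OF o(2) finite_atLeastAtMost, symmetric]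
        by (intro ball_cong refl conj_cong imp_cong) (auto simp: T_h[OF o])
    qed
    also have "\<dots> \<longleftrightarrow> (\<exists>U. orthonormal_basis (g p) ?V {1..?r} U \<and> Dg U)"
    proof
      assume "\<exists>U. orthonormal_basis (g p) ?V {1..?r} U \<and> Dg U"
      then obtain U where U: "orthonormal_basis (g p) ?V {1..?r} U" "Dg U" by blast
      define U' where "U' i = (if i \<le> ?r then U i else Wb (i - ?r))" for i
      have "orthonormal_basis (g p) ?V {1..?r} U'"
        by (rule gp.onb_cong[OF U(1)]) (simp add: U'_def)
      moreover have "orthonormal_basis (g p) ?H {?r+1..?m} U'"
        using gp.onb_cong[OF gp.onb_shift[OF W[unfolded J_def], of ?r], of U'] dimH by (simp add: U'_def)
      moreover have "Dg U'" using U(2) unfolding Dg_def U'_def by simp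
      ultimately show "\<exists>U. orthonormal_basis (g p) ?V {1..?r} U \<and> orthonormal_basis (g p) ?H {?r+1..?m} U \<and> Dg U"
        by blast
    qed blast
    also have "\<dots> \<longleftrightarrow> (\<exists>U. orthonormal_basis (g p) ?V {1..?r} U \<and> diagonal_form \<mu> J b ?r U)"
      unfolding diagonal_form_def b_def Dg[OF W fJ] ..
    finally show ?thesis .
  qed
  have opt: "S \<le> (real k * \<mu> + 1) * (NV + (1 / \<mu> - 1) * Nsq L)"
    "S = (real k * \<mu> + 1) * (NV + (1 / \<mu> - 1) * Nsq L) \<longleftrightarrow> T_diagonal_form \<mu> M N F g p"
    if \<mu>: "\<mu> > 0" and L: "L \<in> hyperplanes ?V"
      and m: "\<forall>L'\<in>hyperplanes ?V. (1 / \<mu> - 1) * Nsq L \<le> (1 / \<mu> - 1) * Nsq L'" for \<mu> L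
  proof -
    note e = NsqL
    have m': "(1 / \<mu> - 1) * sqnorm_on J b {1..k} (some_onb (g p) L)
        \<le> (1 / \<mu> - 1) * sqnorm_on J b {1..k} (some_onb (g p) L')" if "L' \<in> hyperplanes ?V" for L'
      using bspec[OF m that] unfolding e[OF that] e[OF L] .
    note co = gp.casorati_optimal[where J = J and b = b, OF \<mu> sV k(1) fJ bil L m', folded UV_def, folded S_def NV_def, folded e[OF L]]
    show "S \<le> (real k * \<mu> + 1) * (NV + (1 / \<mu> - 1) * Nsq L)" by (rule co(1))
    show "S = (real k * \<mu> + 1) * (NV + (1 / \<mu> - 1) * Nsq L) \<longleftrightarrow> T_diagonal_form \<mu> M N F g p"
      unfolding diag by (rule co(2))
  qed
  have kr: "real k > 0" "real k + 1 > 0" using k(2) by simp_all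
  have pos: "(real k + 1) * real k > 0" using kr by simp
  \<comment> \<open>For \<open>\<mu> = 1/2\<close> the coefficient of the hyperplane norm is \<open>1\<close> and the optimum is the infimum; for \<open>\<mu> = 2\<close> it is \<open>-1/2\<close> and
    the optimum is the supremum.\<close>
  obtain L1 where L1: "L1 \<in> hyperplanes ?V" "\<forall>L'\<in>hyperplanes ?V. (1 / (1/2) - 1) * Nsq L1 \<le> (1 / (1/2) - 1) * Nsq L'"
    using extr by blast
  obtain L2 where L2: "L2 \<in> hyperplanes ?V" "\<forall>L'\<in>hyperplanes ?V. (1 / 2 - 1) * Nsq L2 \<le> (1 / 2 - 1) * Nsq L'"
    using extr by blast
  have inf: "(INF L\<in>hyperplanes ?V. casorati M N F g p L) = Nsq L1 / real k"
  proof (rule cInf_eq_minimum)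
    show "Nsq L1 / real k \<in> casorati M N F g p ` hyperplanes ?V" using casL[OF L1(1)] L1(1) by (metis imageI)
    fix x assume "x \<in> casorati M N F g p ` hyperplanes ?V"
    then obtain L where L: "L \<in> hyperplanes ?V" "x = casorati M N F g p L" by auto
    have "Nsq L1 \<le> Nsq L" using L1(2) L(1) by simp
    then show "Nsq L1 / real k \<le> x" unfolding L(2) casL[OF L(1)] by (rule divide_right_mono) simp
  qed
  have sup: "(SUP L\<in>hyperplanes ?V. casorati M N F g p L) = Nsq L2 / real k"
  proof (rule cSup_eq_maximum)
    show "Nsq L2 / real k \<in> casorati M N F g p ` hyperplanes ?V" using casL[OF L2(1)] L2(1) by (metis imageI)
    fix x assume "x \<in> casorati M N F g p ` hyperplanes ?V"
    then obtain L where L: "L \<in> hyperplanes ?V" "x = casorati M N F g p L" by auto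
    have "Nsq L \<le> Nsq L2" using L2(2) L(1) by simp
    then show "x \<le> Nsq L2 / real k" unfolding L(2) casL[OF L(1)] by (rule divide_right_mono) simp
  qed
  define R1 where "R1 = (real k * (1/2) + 1) * (NV + (1 / (1/2) - 1) * Nsq L1)"
  define R2 where "R2 = (real k * 2 + 1) * (NV + (1 / 2 - 1) * Nsq L2)"
  have d1: "delta_vert M N F g p + K - rho_vert TYPE('v) M N F g p = (R1 - S) / ((real k + 1) * real k)"
    unfolding delta_vert_def Let_def inf rho R1_def cas[OF sV order_refl] NV k(1)
    by (rule casorati_arith(1)[OF kr(1)]) simp
  have d2: "delta_hat_vert M N F g p + K - rho_vert TYPE('v) M N F g p = (R2 - S) / ((real k + 1) * real k)"
    unfolding delta_hat_vert_def Let_def sup rho R2_def cas[OF sV order_refl] NV k(1)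
    by (rule casorati_arith(2)[OF kr(1)]) simp
  have fin: "\<rho> \<le> \<delta> \<and> (\<rho> = \<delta> \<longleftrightarrow> S = X)" if "\<delta> - \<rho> = (X - S) / ((real k + 1) * real k)" "S \<le> X" for \<rho> \<delta> X :: real
  proof -
    have "(X - S) / ((real k + 1) * real k) \<ge> 0" using that(2) pos by simp
    moreover have "(X - S) / ((real k + 1) * real k) = 0 \<longleftrightarrow> S = X" using pos by auto
    ultimately show ?thesis using that(1) by linarith
  qed
  note o1 = opt[of "1/2", OF _ L1, folded R1_def] and o2 = opt[of 2, OF _ L2, folded R2_def]
  show ?thesis
    unfolding casorati_inequalities_def
    using fin[OF d1 o1(1)] fin[OF d2 o2(1)] o1(2) o2(2) by simp
qed

end

section \<open>Slant fibres in generalized Sasakian space forms\<close>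

context inner_form
begin

lemma orth_proj_pythagoras:
  assumes W: "subspace W"
  shows "B x x = B (orth_proj B W x) (orth_proj B W x) + B (x - orth_proj B W x) (x - orth_proj B W x)"
proof -
  have "B (x - orth_proj B W x) (orth_proj B W x) = 0"
    by (rule orth_comp_alt[OF orth_proj_orth[OF W] orth_proj_in[OF W]])
  then show ?thesis using sym_B[of x "orth_proj B W x"] by (simp add: B_simps)
qed

lemma cos_angle_to:
  assumes W: "subspace W" and x: "x \<noteq> 0"
  shows "(cos (angle_to B x W))\<^sup>2 * B x x = B (orth_proj B W x) (orth_proj B W x)"
proof -
  let ?P = "orth_proj B W x"
  have px: "B x x > 0" by (rule pos_B[OF x])
  have le: "B ?P ?P \<le> B x x" using orth_proj_pythagoras[OF W, of x] B_nonneg[of "x - ?P"] by simp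
  have r: "vnorm B ?P / vnorm B x = sqrt (B ?P ?P / B x x)" by (simp add: vnorm_def real_sqrt_divide)
  have "B ?P ?P / B x x \<le> 1" "B ?P ?P / B x x \<ge> 0" using le px B_nonneg by auto
  then have "0 \<le> sqrt (B ?P ?P / B x x)" "sqrt (B ?P ?P / B x x) \<le> 1" by simp_all
  then have "cos (angle_to B x W) = sqrt (B ?P ?P / B x x)"
    unfolding angle_to_def r by (intro cos_arccos) linarith+
  then have "(cos (angle_to B x W))\<^sup>2 = B ?P ?P / B x x" using px B_nonneg[of ?P] by simp
  then show ?thesis using px by simp
qed

lemma orth_proj_inner: "subspace W \<Longrightarrow> w \<in> W \<Longrightarrow> B (orth_proj B W x) w = B x w"
  using orth_comp_alt[OF orth_proj_orth, of W w x] by (simp add: B_simps)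

end

text \<open>The value at one point of an almost contact metric structure.\<close>

locale contact_form = inner_form B for B :: "'e::euclidean_space \<Rightarrow> 'e \<Rightarrow> real" +
  fixes \<phi> :: "'e \<Rightarrow> 'e" and \<xi> :: 'e and \<eta> :: "'e \<Rightarrow> real"
  assumes linear_\<phi>: "linear \<phi>" and \<phi>\<phi>: "\<phi> (\<phi> X) = - X + \<eta> X *\<^sub>R \<xi>" and \<eta>\<xi>: "\<eta> \<xi> = 1" and \<phi>\<xi>: "\<phi> \<xi> = 0"
    and compat: "B (\<phi> X) (\<phi> Y) = B X Y - \<eta> X * \<eta> Y"
begin

lemma \<eta>_eq: "\<eta> X = B X \<xi>"
  using compat[of X \<xi>] by (simp add: \<phi>\<xi> \<eta>\<xi> B_simps)

lemma \<eta>\<phi>: "\<eta> (\<phi> X) = 0"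
proof -
  have "\<phi> (\<phi> (\<phi> X)) = - \<phi> X + \<eta> (\<phi> X) *\<^sub>R \<xi>" by (rule \<phi>\<phi>)
  moreover have "\<phi> (\<phi> (\<phi> X)) = - \<phi> X"
    unfolding \<phi>\<phi>[of X] by (simp add: linear_diff[OF linear_\<phi>] linear_cmul[OF linear_\<phi>] \<phi>\<xi>)
  ultimately have "\<eta> (\<phi> X) *\<^sub>R \<xi> = 0" by simp
  moreover have "\<xi> \<noteq> 0" using \<eta>\<xi> by (auto simp: \<eta>_eq B_simps)
  ultimately show ?thesis by simp
qed

lemma \<phi>_skew: "B (\<phi> X) Y = - B X (\<phi> Y)"
proof -
  have "B (\<phi> X) (\<phi> (\<phi> Y)) = B X (\<phi> Y)" unfolding compat by (simp add: \<eta>\<phi>)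
  then show ?thesis unfolding \<phi>\<phi>[of Y] by (simp add: B_simps \<eta>_eq[symmetric] \<eta>\<phi>)
qed

lemma \<phi>_self: "B X (\<phi> X) = 0"
  using \<phi>_skew[of X X] sym_B[of X "\<phi> X"] by simp

text \<open>The endomorphism \<open>\<phi>\<close> is skew, so the sectional terms reduce to
  \<open>c1 (1 - \<delta>\<^sub>i\<^sub>j) + 3 c2 B(U\<^sub>i, \<phi> U\<^sub>j)\<^sup>2 + c3 (2 \<delta>\<^sub>i\<^sub>j \<eta>(U\<^sub>i) \<eta>(U\<^sub>j) - \<eta>(U\<^sub>i)\<^sup>2 - \<eta>(U\<^sub>j)\<^sup>2)\<close>.
  The sum of \<open>\<eta>(U\<^sub>i)\<^sup>2\<close> is \<open>1\<close> or \<open>0\<close> according to whether \<open>\<xi>\<close> belongs to \<open>V\<close> or is orthogonal to it.\<close>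

lemma curvature_trace:
  assumes V: "subspace V" and U: "orthonormal_basis B V {1..r} U"
    and slant: "\<And>u. u \<in> V \<Longrightarrow> B u \<xi> = 0 \<Longrightarrow> B (orth_proj B V (\<phi> u)) (orth_proj B V (\<phi> u)) = C * B u u"
    and \<xi>: "\<xi> \<in> V \<or> (\<forall>v\<in>V. B v \<xi> = 0)"
    and R: "\<And>X Y. R X Y = c1 *\<^sub>R (B Y Y *\<^sub>R X - B X Y *\<^sub>R Y)
        + c2 *\<^sub>R (B X (\<phi> Y) *\<^sub>R \<phi> Y - B Y (\<phi> Y) *\<^sub>R \<phi> X + (2 * B X (\<phi> Y)) *\<^sub>R \<phi> Y)
        + c3 *\<^sub>R ((\<eta> X * \<eta> Y) *\<^sub>R Y - (\<eta> Y * \<eta> Y) *\<^sub>R X + (B X Y * \<eta> Y) *\<^sub>R \<xi> - (B Y Y * \<eta> X) *\<^sub>R \<xi>)"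
  shows "(\<Sum>i=1..r. \<Sum>j=1..r. B (R (U i) (U j)) (U i))
    = c1 * (real r * real r - real r) + 3 * c2 * C * (real r - (if \<xi> \<in> V then 1 else 0))
      - 2 * c3 * (real r - 1) * (if \<xi> \<in> V then 1 else 0)"
proof -
  let ?I = "{1..r}"
  define s :: real where "s = (if \<xi> \<in> V then 1 else 0)"
  have s: "(\<Sum>i\<in>?I. (\<eta> (U i))\<^sup>2) = s"
  proof (cases "\<xi> \<in> V")
    case True
    have "(\<eta> (U i))\<^sup>2 = B \<xi> (U i) * B \<xi> (U i)" for i
      unfolding \<eta>_eq sym_B[of "U i" \<xi>] by (rule power2_eq_square)
    moreover have "(\<Sum>i\<in>?I. B \<xi> (U i) * B \<xi> (U i)) = B \<xi> \<xi>"
      by (rule onb_inner_expansion[OF U _ True, symmetric]) simp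
    ultimately show ?thesis using True \<eta>\<xi> by (simp add: s_def \<eta>_eq[of \<xi>])
  next
    case False
    then have "\<eta> (U i) = 0" if "i \<in> ?I" for i using \<xi> onb_in[OF U that] by (simp add: \<eta>_eq)
    then show ?thesis using False by (simp add: s_def)
  qed
  have proj: "(\<Sum>i\<in>?I. (B (U i) (\<phi> (U j)))\<^sup>2) = C * (1 - (\<eta> (U j))\<^sup>2)" if j: "j \<in> ?I" for j
  proof -
    let ?P = "orth_proj B V (\<phi> (U j))"
    \<comment> \<open>Subtracting the component along \<open>\<xi>\<close> does not change the image under \<open>\<phi>\<close>, and makes the slant condition applicable.\<close>
    define u where "u = U j - \<eta> (U j) *\<^sub>R \<xi>"
    have Uj: "U j \<in> V" by (rule onb_in[OF U j])
    have "\<eta> (U j) *\<^sub>R \<xi> \<in> V" using \<xi> Uj subspace_0[OF V] subspace_scale[OF V] by (auto simp: \<eta>_eq)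
    then have uV: "u \<in> V" unfolding u_def using Uj V by (simp add: subspace_diff)
    have \<xi>\<xi>: "B \<xi> \<xi> = 1" using \<eta>\<xi> by (simp add: \<eta>_eq)
    have u\<xi>: "B u \<xi> = 0" by (simp add: u_def B_simps \<eta>_eq \<xi>\<xi>)
    have "B u u = 1 - (\<eta> (U j))\<^sup>2"
      using onb_inner[OF U j j] sym_B[of \<xi> "U j"] by (simp add: u_def B_simps \<eta>_eq \<xi>\<xi> power2_eq_square)
    moreover have "\<phi> u = \<phi> (U j)"
      by (simp add: u_def linear_diff[OF linear_\<phi>] linear_cmul[OF linear_\<phi>] \<phi>\<xi>)
    ultimately have "B ?P ?P = C * (1 - (\<eta> (U j))\<^sup>2)" using slant[OF uV u\<xi>] by simp
    moreover have "B ?P ?P = (\<Sum>i\<in>?I. B ?P (U i) * B ?P (U i))"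
      by (rule onb_inner_expansion[OF U _ orth_proj_in[OF V]]) simp
    ultimately show ?thesis
      by (simp add: orth_proj_inner[OF V onb_in[OF U]] power2_eq_square sym_B[of "U _" "\<phi> (U j)"])
  qed
  have summand: "B (R (U i) (U j)) (U i) = c1 * (1 - (if i = j then 1 else 0)) + 3 * c2 * (B (U i) (\<phi> (U j)))\<^sup>2
      + c3 * ((if i = j then 2 * (\<eta> (U i))\<^sup>2 else 0) - (\<eta> (U j))\<^sup>2 - (\<eta> (U i))\<^sup>2)"
    if "i \<in> ?I" "j \<in> ?I" for i j
    using onb_inner[OF U that] onb_inner[OF U that(1,1)] onb_inner[OF U that(2,2)] onb_inner[OF U that(2,1)]
      sym_B[of "\<phi> (U j)" "U i"] sym_B[of \<xi> "U i"]
    unfolding R by (auto simp: B_simps \<phi>_self \<eta>_eq power2_eq_square algebra_simps)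
  have "(\<Sum>i\<in>?I. \<Sum>j\<in>?I. B (R (U i) (U j)) (U i))
    = (\<Sum>i\<in>?I. \<Sum>j\<in>?I. c1 * (1 - (if i = j then 1 else 0)) + 3 * c2 * (B (U i) (\<phi> (U j)))\<^sup>2
      + c3 * ((if i = j then 2 * (\<eta> (U i))\<^sup>2 else 0) - (\<eta> (U j))\<^sup>2 - (\<eta> (U i))\<^sup>2))"
    by (intro sum.cong refl summand)
  also have "\<dots> = c1 * (\<Sum>i\<in>?I. \<Sum>j\<in>?I. 1 - (if i = j then 1 else 0))
      + 3 * c2 * (\<Sum>i\<in>?I. \<Sum>j\<in>?I. (B (U i) (\<phi> (U j)))\<^sup>2)
      + c3 * (\<Sum>i\<in>?I. \<Sum>j\<in>?I. (if i = j then 2 * (\<eta> (U i))\<^sup>2 else 0) - (\<eta> (U j))\<^sup>2 - (\<eta> (U i))\<^sup>2)"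
    by (simp only: sum.distrib sum_distrib_left)
  also have "(\<Sum>i\<in>?I. \<Sum>j\<in>?I. 1 - (if i = j then 1 else 0 :: real)) = real r * real r - real r"
    by (simp add: sum_subtractf algebra_simps)
  also have "(\<Sum>i\<in>?I. \<Sum>j\<in>?I. (B (U i) (\<phi> (U j)))\<^sup>2) = C * (real r - s)"
  proof -
    have "(\<Sum>i\<in>?I. \<Sum>j\<in>?I. (B (U i) (\<phi> (U j)))\<^sup>2) = (\<Sum>j\<in>?I. \<Sum>i\<in>?I. (B (U i) (\<phi> (U j)))\<^sup>2)"
      by (rule sum.swap)
    also have "\<dots> = (\<Sum>j\<in>?I. C * (1 - (\<eta> (U j))\<^sup>2))" by (intro sum.cong refl proj)
    also have "\<dots> = C * (\<Sum>j\<in>?I. 1 - (\<eta> (U j))\<^sup>2)" by (simp only: sum_distrib_left)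
    also have "(\<Sum>j\<in>?I. 1 - (\<eta> (U j))\<^sup>2) = real r - s" by (simp only: sum_subtractf s) simp
    finally show ?thesis .
  qed
  also have "(\<Sum>i\<in>?I. \<Sum>j\<in>?I. (if i = j then 2 * (\<eta> (U i))\<^sup>2 else 0) - (\<eta> (U j))\<^sup>2 - (\<eta> (U i))\<^sup>2)
      = 2 * s - real r * s - real r * s"
  proof -
    have "(\<Sum>i\<in>?I. \<Sum>j\<in>?I. (if i = j then 2 * (\<eta> (U i))\<^sup>2 else 0)) = (\<Sum>i\<in>?I. 2 * (\<eta> (U i))\<^sup>2)"
      by (intro sum.cong refl) simp
    then have "(\<Sum>i\<in>?I. \<Sum>j\<in>?I. (if i = j then 2 * (\<eta> (U i))\<^sup>2 else 0)) = 2 * s"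
      by (simp only: sum_distrib_left[symmetric] s)
    then show ?thesis by (simp only: sum_subtractf s sum_constant card_atLeastAtMost sum_distrib_left[symmetric]) simp
  qed
  finally show ?thesis unfolding s_def[symmetric] by (simp add: algebra_simps)
qed

end

lemma riemannian_submersion_fibred_point:
  assumes rs: "riemannian_submersion M g N h F" and p: "p \<in> pts M"
    and d: "dim (vert M N F p) = DIM('v::euclidean_space)"
  shows "fibred_point M g N F p (fibre M F p :: ('a, 'v) manifold)"
proof -
  have M: "riemannian_manifold M g" and N: "riemannian_manifold N h" and F: "smooth_map M N F"
    using rs by (auto simp: riemannian_submersion_def)
  have cov: "\<exists>c\<in>atlas M. q \<in> fst c" if "q \<in> pts M" for q
    using M that unfolding riemannian_manifold_def smooth_manifold_def by blast
  have covN: "\<exists>c\<in>atlas N. q \<in> fst c" if "q \<in> pts N" for q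
    using N that unfolding riemannian_manifold_def smooth_manifold_def by blast
  have sN: "smooth_manifold N" using N by (simp add: riemannian_manifold_def)
  have "submersion M g N F"
  proof (rule submersion.intro[OF riemannian_manifold_atlas[OF M] smooth_manifold_chart_atlas[OF sN] submersion_axioms.intro])
    show "\<exists>c\<in>atlas M. q \<in> fst c" if "q \<in> pts M" for q by (rule cov[OF that])
    show "\<exists>e\<in>atlas N. x \<in> fst e" if "x \<in> pts N" for x by (rule covN[OF that])
    show "continuous_map (mtop M) (mtop N) F" using F unfolding smooth_map_def by blast
    show "smooth_on (snd c ` {q \<in> fst c. F q \<in> fst e}) (snd e \<circ> F \<circ> pt c)"
      if "c \<in> atlas M" "e \<in> atlas N" for c e using F that unfolding smooth_map_def by blast
    show "surj (differential M N F q)" if "q \<in> pts M" for q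
      using rs that unfolding riemannian_submersion_def by blast
  qed
  then show ?thesis by (rule fibred_point.intro[OF _ fibred_point_axioms.intro[OF p refl d]])
qed

text \<open>In the horizontal case \<open>\<xi>\<close> is orthogonal to the vertical space and the \<open>c3\<close> term disappears; the factor \<open>r\<close> instead of
  \<open>r - 1\<close> in front of \<open>cos\<^sup>2 \<theta>\<close> then cancels against the normalization.\<close>

theorem slant_casorati_inequalities:
  fixes M1 :: "('a, 'e::euclidean_space) manifold" and M2 :: "('b, 'f::euclidean_space) manifold"
  assumes ps: "pointwise_slant_submersion M1 \<phi>1 \<xi>1 \<eta>1 g1 M2 g2 F \<theta>"
    and r: "dim (vert M1 M2 F p) = r" "DIM('v::euclidean_space) = r" "r \<ge> 3" and p: "p \<in> pts M1"
    and sf: "generalized_sasakian_space_form M1 \<phi>1 \<xi>1 \<eta>1 g1 c1 c2 c3"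
  shows "vertical_field M1 M2 F \<xi>1 \<Longrightarrow> casorati_inequalities TYPE('v) M1 M2 F g1 p
      (c1 p + 3 * c2 p / real r * (cos (\<theta> p))\<^sup>2 - 2 * c3 p / real r)"
    and "horizontal_field M1 M2 F g1 \<xi>1 \<Longrightarrow> casorati_inequalities TYPE('v) M1 M2 F g1 p
      (c1 p + 3 * c2 p / (real r - 1) * (cos (\<theta> p))\<^sup>2)"
proof -
  have acm: "almost_contact_metric M1 \<phi>1 \<xi>1 \<eta>1 g1" and rs: "riemannian_submersion M1 g1 M2 g2 F"
    using ps by (auto simp: pointwise_slant_submersion_def)
  interpret P: fibred_point M1 g1 M2 F p "fibre M1 F p :: ('a, 'v) manifold"
    by (rule riemannian_submersion_fibred_point[OF rs p]) (simp add: r)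
  let ?V = "vert M1 M2 F p" and ?\<phi> = "\<phi>1 p" and ?\<xi> = "\<xi>1 p" and ?\<eta> = "\<eta>1 p" and ?g = "g1 p"
  have ac: "\<And>X. ?\<phi> (?\<phi> X) = - X + ?\<eta> X *\<^sub>R ?\<xi>" "?\<eta> ?\<xi> = 1" "?\<phi> ?\<xi> = 0"
    "\<And>X Y. ?g (?\<phi> X) (?\<phi> Y) = ?g X Y - ?\<eta> X * ?\<eta> Y" "linear ?\<phi>"
    using acm p unfolding almost_contact_metric_def smooth_endomorphism_def by blast+
  interpret C: contact_form ?g ?\<phi> ?\<xi> ?\<eta>
    by (intro contact_form.intro contact_form_axioms.intro P.gp.inner_form_axioms ac)
  have sV: "subspace ?V" by (rule P.subspace_vert[OF P.total_chart])
  have slant: "?g (orth_proj ?g ?V (?\<phi> u)) (orth_proj ?g ?V (?\<phi> u)) = (cos (\<theta> p))\<^sup>2 * ?g u u"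
    if u: "u \<in> ?V" "?g u ?\<xi> = 0" for u
  proof (cases "u = 0")
    case True
    then show ?thesis
      by (simp add: linear_0[OF C.linear_\<phi>] P.gp.orth_proj_same[OF sV subspace_0[OF sV]] P.gp.B_simps)
  next
    case False
    have ang: "angle_to ?g (?\<phi> u) ?V = \<theta> p"
      using ps p u False by (auto simp: pointwise_slant_submersion_def)
    have n: "?g (?\<phi> u) (?\<phi> u) = ?g u u" using u(2) by (simp add: C.compat C.\<eta>_eq)
    then have "?\<phi> u \<noteq> 0" using P.gp.pos_B[OF False] by (auto simp: P.gp.B_simps)
    from P.gp.cos_angle_to[OF sV this] show ?thesis unfolding ang n by simp
  qed
  obtain k where k: "r = Suc k" "k > 0" using r(3) by (cases r) auto
  have tr: "(\<Sum>i=1..Suc k. \<Sum>j=1..Suc k. ?g (curvature_tensor M1 g1 p (U i) (U j) (U j)) (U i))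
    = c1 p * (real r * real r - real r) + 3 * c2 p * (cos (\<theta> p))\<^sup>2 * (real r - (if ?\<xi> \<in> ?V then 1 else 0))
      - 2 * c3 p * (real r - 1) * (if ?\<xi> \<in> ?V then 1 else 0)"
    if U: "orthonormal_basis ?g ?V {1..Suc k} U" and \<xi>: "?\<xi> \<in> ?V \<or> (\<forall>v\<in>?V. ?g v ?\<xi> = 0)" for U
    unfolding k(1)[symmetric]
    by (rule C.curvature_trace[OF sV U[folded k(1)] slant \<xi>])
      (use sf p in \<open>auto simp: generalized_sasakian_space_form_def\<close>)
  have dk: "dim ?V = Suc k" using r k by simp
  have rk: "(real k + 1) * real k = real r * (real r - 1)" using k by simp
  have rp: "real r \<noteq> 0" "real r - 1 \<noteq> 0" using r(3) by simp_all
  show "casorati_inequalities TYPE('v) M1 M2 F g1 p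
      (c1 p + 3 * c2 p / real r * (cos (\<theta> p))\<^sup>2 - 2 * c3 p / real r)" if "vertical_field M1 M2 F \<xi>1"
  proof (rule P.casorati_inequalities_fibre[OF dk k(2)])
    fix U assume U: "orthonormal_basis ?g ?V {1..Suc k} U"
    have \<xi>: "?\<xi> \<in> ?V" using that p by (simp add: vertical_field_def)
    then show "(\<Sum>i=1..Suc k. \<Sum>j=1..Suc k. ?g (curvature_tensor M1 g1 p (U i) (U j) (U j)) (U i))
      = (real k + 1) * real k * (c1 p + 3 * c2 p / real r * (cos (\<theta> p))\<^sup>2 - 2 * c3 p / real r)"
      unfolding tr[OF U disjI1[OF \<xi>]] rk using rp(1) by (simp add: field_simps)
  qed
  show "casorati_inequalities TYPE('v) M1 M2 F g1 p
      (c1 p + 3 * c2 p / (real r - 1) * (cos (\<theta> p))\<^sup>2)" if "horizontal_field M1 M2 F g1 \<xi>1"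
  proof (rule P.casorati_inequalities_fibre[OF dk k(2)])
    fix U assume U: "orthonormal_basis ?g ?V {1..Suc k} U"
    have perp: "\<forall>v\<in>?V. ?g v ?\<xi> = 0"
    proof
      fix v assume "v \<in> ?V"
      then have "?g ?\<xi> v = 0" using that p by (simp add: horizontal_field_def hor_def orth_comp_def)
      then show "?g v ?\<xi> = 0" using P.gp.sym_B[of v ?\<xi>] by simp
    qed
    have n\<xi>: "?\<xi> \<notin> ?V" using perp C.\<eta>\<xi> C.\<eta>_eq[of ?\<xi>] by auto
    show "(\<Sum>i=1..Suc k. \<Sum>j=1..Suc k. ?g (curvature_tensor M1 g1 p (U i) (U j) (U j)) (U i))
      = (real k + 1) * real k * (c1 p + 3 * c2 p / (real r - 1) * (cos (\<theta> p))\<^sup>2)"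
      unfolding tr[OF U disjI2[OF perp]] rk using rp n\<xi> by (simp add: divide_simps) (simp add: algebra_simps)
  qed
qed

theorem corollary4p2:
  fixes M1 :: "('a, 'e::euclidean_space) manifold"
    and M2 :: "('b, 'f::euclidean_space) manifold"
    and \<phi>1 :: "'a \<Rightarrow> 'e \<Rightarrow> 'e" and \<xi>1 :: "'a \<Rightarrow> 'e" and \<eta>1 :: "'a \<Rightarrow> 'e \<Rightarrow> real"
    and g1 :: "('a, 'e) metric" and g2 :: "('b, 'f) metric"
    and F :: "'a \<Rightarrow> 'b" and \<theta> :: "'a \<Rightarrow> real" and r :: nat and c \<alpha> :: real and p :: 'a
  assumes "pointwise_slant_submersion M1 \<phi>1 \<xi>1 \<eta>1 g1 M2 g2 F \<theta>"
    and "\<forall>q\<in>pts M1. dim (vert M1 M2 F q) = r"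
    and "DIM('v::euclidean_space) = r"
    and "r \<ge> 3"
    and "p \<in> pts M1"
  shows
    "(sasakian_space_form M1 \<phi>1 \<xi>1 \<eta>1 g1 c \<longrightarrow>
        (vertical_field M1 M2 F \<xi>1 \<longrightarrow> casorati_inequalities TYPE('v) M1 M2 F g1 p
           ((c + 3) / 4 + 3 * (c - 1) / (4 * real r) * (cos (\<theta> p))\<^sup>2 - (c - 1) / (2 * real r))) \<and>
        (horizontal_field M1 M2 F g1 \<xi>1 \<longrightarrow> casorati_inequalities TYPE('v) M1 M2 F g1 p
           ((c + 3) / 4 + 3 * (c - 1) / (4 * (real r - 1)) * (cos (\<theta> p))\<^sup>2)))
     \<and>
     (kenmotsu_space_form M1 \<phi>1 \<xi>1 \<eta>1 g1 c \<longrightarrow>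
        (vertical_field M1 M2 F \<xi>1 \<longrightarrow> casorati_inequalities TYPE('v) M1 M2 F g1 p
           ((c - 3) / 4 + 3 * (c + 1) / (4 * real r) * (cos (\<theta> p))\<^sup>2 - (c + 1) / (2 * real r))) \<and>
        (horizontal_field M1 M2 F g1 \<xi>1 \<longrightarrow> casorati_inequalities TYPE('v) M1 M2 F g1 p
           ((c - 3) / 4 + 3 * (c + 1) / (4 * (real r - 1)) * (cos (\<theta> p))\<^sup>2)))
     \<and>
     (cosymplectic_space_form M1 \<phi>1 \<xi>1 \<eta>1 g1 c \<longrightarrow>
        (vertical_field M1 M2 F \<xi>1 \<longrightarrow> casorati_inequalities TYPE('v) M1 M2 F g1 p
           (c / 4 + 3 * c / (4 * real r) * (cos (\<theta> p))\<^sup>2 - c / (2 * real r))) \<and>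
        (horizontal_field M1 M2 F g1 \<xi>1 \<longrightarrow> casorati_inequalities TYPE('v) M1 M2 F g1 p
           (c / 4 + 3 * c / (4 * (real r - 1)) * (cos (\<theta> p))\<^sup>2)))
     \<and>
     (almost_C_space_form M1 \<phi>1 \<xi>1 \<eta>1 g1 \<alpha> c \<longrightarrow>
        (vertical_field M1 M2 F \<xi>1 \<longrightarrow> casorati_inequalities TYPE('v) M1 M2 F g1 p
           ((c + 3 * \<alpha>\<^sup>2) / 4 + 3 * (c - \<alpha>\<^sup>2) / (4 * real r) * (cos (\<theta> p))\<^sup>2
              - (c - \<alpha>\<^sup>2) / (2 * real r))) \<and>
        (horizontal_field M1 M2 F g1 \<xi>1 \<longrightarrow> casorati_inequalities TYPE('v) M1 M2 F g1 p
           ((c + 3 * \<alpha>\<^sup>2) / 4 + 3 * (c - \<alpha>\<^sup>2) / (4 * (real r - 1)) * (cos (\<theta> p))\<^sup>2)))"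
proof -
  note ineq = slant_casorati_inequalities[where 'v = 'v, OF assms(1) _ assms(3,4,5)]
  have r: "dim (vert M1 M2 F p) = r" using assms(2,5) by blast
  have vertical: "casorati_inequalities TYPE('v) M1 M2 F g1 p K"
    if "generalized_sasakian_space_form M1 \<phi>1 \<xi>1 \<eta>1 g1 (\<lambda>_. A) (\<lambda>_. B) (\<lambda>_. B)"
      "vertical_field M1 M2 F \<xi>1" "K = A + 3 * B / real r * (cos (\<theta> p))\<^sup>2 - 2 * B / real r" for A B K
    unfolding that(3) using ineq(1)[OF r that(1,2)] .
  have horizontal: "casorati_inequalities TYPE('v) M1 M2 F g1 p K"
    if "generalized_sasakian_space_form M1 \<phi>1 \<xi>1 \<eta>1 g1 (\<lambda>_. A) (\<lambda>_. B) (\<lambda>_. B)"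
      "horizontal_field M1 M2 F g1 \<xi>1" "K = A + 3 * B / (real r - 1) * (cos (\<theta> p))\<^sup>2" for A B K
    unfolding that(3) using ineq(2)[OF r that(1,2)] .
  have rn: "real r \<noteq> 0" using assms(4) by simp
  show ?thesis
    unfolding sasakian_space_form_def kenmotsu_space_form_def cosymplectic_space_form_def
      almost_C_space_form_def
    by (intro conjI impI; (erule (1) vertical | erule (1) horizontal))
      (use rn in \<open>simp_all add: field_simps\<close>)
qed

end
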